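(* Assume the setting, assumptions (A1)–(A4) and construction recalled in the context. Then for each $1\le p\le \mathfrak q$, the sequence of functionals $\theta^{(p)}_n\,\mathcal I_n\colon \mathcal P(V)\to[0,+\infty)$ $\Gamma$-converges, as $n\to\infty$, to the functional $\mathcal I^{(p)}\colon\mathcal P(V)\to[0,+\infty]$.
   Context: **Setting.** $V$ is a fixed finite set; for $n\ge1$, $(X^{(n)}_t)_{t\ge0}$ is an irreducible $V$-valued continuous-time Markov chain with jump rates $R_n(x,y)$, $x\ne y$, holding rates $\lambda_n(x)=\sum_{y\neq x}R_n(x,y)$, generator $(\mathcal L_nf)(x)=\sum_{y}R_n(x,y)[f(y)-f(x)]$, unique stationary state $\pi_n$; $\mathbf P^n_x$ is its law started from $x$. $\mathcal P(W)$ is the set of probability measures on a finite set $W$ with the weak topology. For $A\subset V$, $\tau_1$ is the first jump time, $H_A=\inf\{t>0:X^{(n)}_t\in A\}$, $H_A^+=\inf\{t>\tau_1:X^{(n)}_t\in A\}$, $H_y=H_{\{y\}}$. For positive sequences, $\alpha_n\prec\beta_n$ means $\alpha_n/\beta_n\to0$; two sequences are comparable if $\alpha_n\prec\beta_n$, or $\beta_n\prec\alpha_n$, or $\alpha_n/\beta_n\to a\in(0,\infty)$. **Assumptions.** (A1) $R_n(x,y)\to\mathbb R_0(x,y)\in[0,\infty)$ for all $x\ne y$, and $\mathbb R_0(x',y')>0$ for some $x'\neq y'$. (A2) The Markov chain on $V$ with jump rates $\mathbb R_0$ has more than one closed irreducible class. (A3) There is a set $E\subset\{(x,y)\in V\times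 V:x\ne y\}$ such that for all $n\ge 1$: $R_n(x,y)>0$ iff $(x,y)\in E$. (A4) For every $m\ge1$, the sequences $\big(\prod_{(x,y)\in E}R_n(x,y)^{k(x,y)}\big)_{n\ge1}$, where $k$ ranges over functions $E\to\{0,1,2,\dots\}$ with $\sum_{E}k(x,y)=m$, are pairwise comparable. **Construction.** Let $\mathcal V^{(1)}_1,\dots,\mathcal V^{(1)}_{\mathfrak n_1}$ be the closed irreducible classes of the chain with rates $\mathbb R_0$, $S_1=\{1,\dots,\mathfrak n_1\}$, and $\pi^{(1)}_j$ the stationary state of that chain supported on $\mathcal V^{(1)}_j$. Recursively, given disjoint nonempty sets $\mathcal V^{(p)}_j$ and probability measures $\pi^{(p)}_j$ with support $\mathcal V^{(p)}_j$, $j\in S_p=\{1,\dots,\mathfrak n_p\}$, $\mathfrak n_p\ge2$: put $\mathcal V^{(p)}=\bigcup_{j\in S_p}\mathcal V^{(p)}_j$; let $R^{(p)}_n(x,y)=\lambda_n(x)\mathbf P^n_x[H_y=H^+_{\mathcal V^{(p)}}]$, $x\ne y\in\mathcal V^{(p)}$, be the jump rates of the trace of $X^{(n)}$ on $\mathcal V^{(p)}$ (the chain obtained by deleting the excursions outside $\mathcal V^{(p)}$), and for $i\neq j\in S_p$ $$r^{(p)}_n(i,j)=\frac1{\pi_n(\mathcal V^{(p)}_i)}\sum_{x\in\mathcal V^{(p)}_i}\pi_n(x)\sum_{y\in\mathcal V^{(p)}_j}R^{(p)}_n(x,y).$$ Known facts from earlier literature, part of the construction and to be taken as given: there is a sequence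 $\theta^{(p)}_n$ with $\theta^{(p-1)}_n\prec\theta^{(p)}_n$ ($\theta^{(0)}_n=1$) such that the limits $r^{(p)}(i,j)=\lim_n\theta^{(p)}_nr^{(p)}_n(i,j)\in[0,\infty)$ exist for all $i\ne j$ and are not all zero; $\lim_n\pi_n(z)/\pi_n(\mathcal V^{(p)}_j)=\pi^{(p)}_j(z)\in(0,1]$ for $z\in\mathcal V^{(p)}_j$; and the finite-dimensional distributions of $\Phi_p(X^{(n)}_{t\theta^{(p)}_n})$, with $\Phi_p=\sum_{j\in S_p} j\,\mathbf 1_{\mathcal V^{(p)}_j}$, converge to those of $\mathbb X^{(p)}_t$, the $S_p$-valued Markov chain with jump rates $r^{(p)}$. Fix such $\theta^{(p)}_n$. Let $\mathfrak R^{(p)}_1,\dots,\mathfrak R^{(p)}_{\mathfrak n_{p+1}}$ be the recurrent (closed irreducible) classes of $\mathbb X^{(p)}$ (one has $\mathfrak n_{p+1}<\mathfrak n_p$), $S_{p+1}=\{1,\dots,\mathfrak n_{p+1}\}$, $M^{(p)}_m$ the stationary state of $\mathbb X^{(p)}$ supported on $\mathfrak R^{(p)}_m$, and set $\mathcal V^{(p+1)}_m=\bigcup_{j\in\mathfrak R^{(p)}_m}\mathcal V^{(p)}_j$, $\pi^{(p+1)}_m=\sum_{j\in\mathfrak R^{(p)}_m}M^{(p)}_m(j)\pi^{(p)}_j$. The recursion stops at the first $p$ with $\mathfrak n_{p+1}=1$; this $p$ is called $\mathfrak q$. **Functionals.** $\mathcal I_n(\mu)=\sup_{H\colon V\to\mathbb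 R}-\int_Ve^{-H}\mathcal L_ne^H\,d\mu$ for $\mu\in\mathcal P(V)$. Let $\mathbb L^{(p)}$ be the generator of $\mathbb X^{(p)}$ and, for $\omega\in\mathcal P(S_p)$, $\mathbb I^{(p)}(\omega)=\sup_{\mathbf h\colon S_p\to\mathbb R}-\sum_{j\in S_p}\omega_je^{-\mathbf h(j)}(\mathbb L^{(p)}e^{\mathbf h})(j)$. For $\mu\in\mathcal P(V)$, $\mathcal I^{(p)}(\mu)=\mathbb I^{(p)}(\omega)$ if $\mu=\sum_{j\in S_p}\omega_j\pi^{(p)}_j$ for some $\omega\in\mathcal P(S_p)$, and $\mathcal I^{(p)}(\mu)=+\infty$ otherwise. **$\Gamma$-convergence.** Functionals $U_n\colon\mathcal X\to[0,\infty]$ on a Polish space $\Gamma$-converge to $U$ if (i) for every $x$ and every $x_n\to x$, $\liminf_nU_n(x_n)\ge U(x)$; (ii) for every $x$ there is $x_n\to x$ with $\limsup_nU_n(x_n)\le U(x)$. *)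

theory Defs
  imports "HOL-Probability.Probability"
begin

section \<open>Continuous-time Markov chains on a finite state space\<close>

text \<open>
  A chain is given by a finite state set S and jump rates R. The diagonal of R is never used.
\<close>

definition holding_rate :: "'a set \<Rightarrow> ('a \<Rightarrow> 'a \<Rightarrow> real) \<Rightarrow> 'a \<Rightarrow> real" where
  "holding_rate S R x = (\<Sum>y\<in>S - {x}. R x y)"

definition generator :: "'a set \<Rightarrow> ('a \<Rightarrow> 'a \<Rightarrow> real) \<Rightarrow> ('a \<Rightarrow> real) \<Rightarrow> 'a \<Rightarrow> real" where
  "generator S R f x = (\<Sum>y\<in>S. R x y * (f y - f x))"

definition rate_graph :: "'a set \<Rightarrow> ('a \<Rightarrow> 'a \<Rightarrow> real) \<Rightarrow> ('a \<times> 'a) set" where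
  "rate_graph S R = {(x, y). x \<in> S \<and> y \<in> S \<and> x \<noteq> y \<and> R x y > 0}"

definition irreducible_chain :: "'a set \<Rightarrow> ('a \<Rightarrow> 'a \<Rightarrow> real) \<Rightarrow> bool" where
  "irreducible_chain S R \<longleftrightarrow> (\<forall>x\<in>S. \<forall>y\<in>S. (x, y) \<in> (rate_graph S R)\<^sup>*)"

definition closed_irreducible_class :: "'a set \<Rightarrow> ('a \<Rightarrow> 'a \<Rightarrow> real) \<Rightarrow> 'a set \<Rightarrow> bool" where
  "closed_irreducible_class S R C \<longleftrightarrow>
     C \<noteq> {} \<and> C \<subseteq> S \<and>
     (\<forall>x\<in>C. \<forall>y\<in>C. (x, y) \<in> (rate_graph S R)\<^sup>*) \<and>
     (\<forall>x\<in>C. \<forall>y. (x, y) \<in> rate_graph S R \<longrightarrow> y \<in> C)"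

definition stationary_state :: "'a set \<Rightarrow> ('a \<Rightarrow> 'a \<Rightarrow> real) \<Rightarrow> 'a pmf \<Rightarrow> bool" where
  "stationary_state S R \<mu> \<longleftrightarrow>
     set_pmf \<mu> \<subseteq> S \<and>
     (\<forall>y\<in>S. (\<Sum>x\<in>S - {y}. pmf \<mu> x * R x y) = pmf \<mu> y * holding_rate S R y)"

subsection \<open>Jump-chain/holding-time construction of the process\<close>

text \<open>
  States with vanishing holding rate are absorbing.
\<close>

definition jump_pmf :: "'a set \<Rightarrow> ('a \<Rightarrow> 'a \<Rightarrow> real) \<Rightarrow> 'a \<Rightarrow> 'a pmf" where
  "jump_pmf S R x =
     (if holding_rate S R x = 0 then return_pmf x
      else embed_pmf (\<lambda>y. if y \<in> S - {x} then R x y / holding_rate S R x else 0))"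

text \<open>
  The randomness is an i.i.d. sequence of pairs (f, e), where e is a standard exponential variable
  and f is an independent random map on S whose values f(x) are independent with law
  jump_pmf S R x. If the chain is at x after k jumps, then the k-th pair (counted from 0) makes it
  stay at x for the time e / holding_rate S R x, which is exponential with parameter
  holding_rate S R x, and then jump to f(x). Since a fresh map is used for each jump, the jump
  chain is Markov with transition probabilities jump_pmf S R and, given the jump chain, the holding
  times are independent. The law of the process started from x is thus the image of chain_noise S R
  under chain_path S R x.
\<close>

definition chain_noise ::
    "'a set \<Rightarrow> ('a \<Rightarrow> 'a \<Rightarrow> real) \<Rightarrow> (('a \<Rightarrow> 'a) \<times> real) stream measure" where
  "chain_noise S R =
     stream_space (measure_pmf (Pi_pmf S undefined (jump_pmf S R))
                   \<Otimes>\<^sub>M density lborel (exponential_density 1))"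

primrec jump_state :: "'a \<Rightarrow> (('a \<Rightarrow> 'a) \<times> real) stream \<Rightarrow> nat \<Rightarrow> 'a" where
  "jump_state x \<omega> 0 = x"
| "jump_state x \<omega> (Suc k) = fst (\<omega> !! k) (jump_state x \<omega> k)"

text \<open>
  The time of the k-th jump. In the extended nonnegative reals e / 0 is infinite for e > 0, so the
  holding time at an absorbing state is almost surely infinite.
\<close>

definition jump_time ::
    "'a set \<Rightarrow> ('a \<Rightarrow> 'a \<Rightarrow> real) \<Rightarrow> 'a \<Rightarrow> (('a \<Rightarrow> 'a) \<times> real) stream \<Rightarrow> nat \<Rightarrow> ennreal" where
  "jump_time S R x \<omega> k =
     (\<Sum>i<k. ennreal (snd (\<omega> !! i)) / ennreal (holding_rate S R (jump_state x \<omega> i)))"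

text \<open>The second branch only concerns explosion, which has probability zero for finite S.\<close>

definition chain_path ::
    "'a set \<Rightarrow> ('a \<Rightarrow> 'a \<Rightarrow> real) \<Rightarrow> 'a \<Rightarrow> (('a \<Rightarrow> 'a) \<times> real) stream \<Rightarrow> real \<Rightarrow> 'a" where
  "chain_path S R x \<omega> t =
     (if \<exists>k. ennreal t < jump_time S R x \<omega> (Suc k)
      then jump_state x \<omega> (LEAST k. ennreal t < jump_time S R x \<omega> (Suc k))
      else x)"

subsection \<open>Hitting times of a path and the trace process\<close>

definition first_jump :: "(real \<Rightarrow> 'a) \<Rightarrow> ennreal" where
  "first_jump X = Inf {ennreal t | t. t > 0 \<and> X t \<noteq> X 0}"

definition hit :: "'a set \<Rightarrow> (real \<Rightarrow> 'a) \<Rightarrow> ennreal" where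
  "hit A X = Inf {ennreal t | t. t > 0 \<and> X t \<in> A}"

definition hit_plus :: "'a set \<Rightarrow> (real \<Rightarrow> 'a) \<Rightarrow> ennreal" where
  "hit_plus A X = Inf {ennreal t | t. ennreal t > first_jump X \<and> X t \<in> A}"

definition trace_rate :: "'a set \<Rightarrow> ('a \<Rightarrow> 'a \<Rightarrow> real) \<Rightarrow> 'a set \<Rightarrow> 'a \<Rightarrow> 'a \<Rightarrow> real" where
  "trace_rate S R A x y =
     holding_rate S R x *
     \<P>(\<omega> in chain_noise S R.
        hit {y} (chain_path S R x \<omega>) = hit_plus A (chain_path S R x \<omega>))"

text \<open>
  For disjoint sets W j with j in J: the mean rate, under the measure pi, at which the trace on
  their union jumps from W i to W j.
\<close>

definition mean_jump_rate ::
    "'a set \<Rightarrow> ('a \<Rightarrow> 'a \<Rightarrow> real) \<Rightarrow> 'a pmf \<Rightarrow> nat set \<Rightarrow> (nat \<Rightarrow> 'a set) \<Rightarrow> nat \<Rightarrow> nat \<Rightarrow> real" where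
  "mean_jump_rate S R \<pi> J W i j =
     1 / measure_pmf.prob \<pi> (W i) *
     (\<Sum>x\<in>W i. pmf \<pi> x * (\<Sum>y\<in>W j. trace_rate S R (\<Union>l\<in>J. W l) x y))"

definition projection :: "nat set \<Rightarrow> (nat \<Rightarrow> 'a set) \<Rightarrow> 'a \<Rightarrow> nat" where
  "projection J W x = (\<Sum>j\<in>J. j * indicator (W j) x)"

section \<open>Comparison of sequences\<close>

definition prec :: "(nat \<Rightarrow> real) \<Rightarrow> (nat \<Rightarrow> real) \<Rightarrow> bool" where
  "prec \<alpha> \<beta> \<longleftrightarrow> (\<lambda>n. \<alpha> n / \<beta> n) \<longlonglongrightarrow> 0"

definition comparable :: "(nat \<Rightarrow> real) \<Rightarrow> (nat \<Rightarrow> real) \<Rightarrow> bool" where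
  "comparable \<alpha> \<beta> \<longleftrightarrow>
     prec \<alpha> \<beta> \<or> prec \<beta> \<alpha> \<or> (\<exists>a>0. (\<lambda>n. \<alpha> n / \<beta> n) \<longlonglongrightarrow> a)"

section \<open>Large deviations functionals and \<open>\<Gamma>\<close>-convergence\<close>

text \<open>Only the values of H and of the measure on S enter.\<close>

definition ld_functional :: "'a set \<Rightarrow> ('a \<Rightarrow> 'a \<Rightarrow> real) \<Rightarrow> 'a pmf \<Rightarrow> ereal" where
  "ld_functional S R \<mu> =
     (SUP H :: 'a \<Rightarrow> real.
        ereal (- (\<Sum>x\<in>S. pmf \<mu> x * (exp (- H x) * generator S R (\<lambda>y. exp (H y)) x))))"

definition is_mixture :: "nat set \<Rightarrow> nat pmf \<Rightarrow> (nat \<Rightarrow> 'a pmf) \<Rightarrow> 'a pmf \<Rightarrow> bool" where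
  "is_mixture J \<omega> \<nu> \<mu> \<longleftrightarrow>
     set_pmf \<omega> \<subseteq> J \<and> (\<forall>x. pmf \<mu> x = (\<Sum>j\<in>J. pmf \<omega> j * pmf (\<nu> j) x))"

text \<open>The weights are unique when the measures have disjoint supports, as in the application.\<close>

definition level_functional ::
    "nat set \<Rightarrow> (nat \<Rightarrow> nat \<Rightarrow> real) \<Rightarrow> (nat \<Rightarrow> 'a pmf) \<Rightarrow> 'a pmf \<Rightarrow> ereal" where
  "level_functional J r \<nu> \<mu> =
     (if \<exists>\<omega>. is_mixture J \<omega> \<nu> \<mu>
      then ld_functional J r (THE \<omega>. is_mixture J \<omega> \<nu> \<mu>)
      else \<infinity>)"

text \<open>
  On a finite (discrete) space every real function is bounded and continuous; the weak topology is
  the coarsest one for which all integrals of such functions are continuous.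
\<close>

definition weak_topology :: "('a :: finite) pmf topology" where
  "weak_topology =
     topology_generated_by
       {{\<mu>. measure_pmf.expectation \<mu> f \<in> U} | (f :: 'a \<Rightarrow> real) U. open U}"

definition gamma_converges ::
    "'x topology \<Rightarrow> (nat \<Rightarrow> 'x \<Rightarrow> ereal) \<Rightarrow> ('x \<Rightarrow> ereal) \<Rightarrow> bool" where
  "gamma_converges T U U' \<longleftrightarrow>
     (\<forall>x\<in>topspace T.
        (\<forall>s. range s \<subseteq> topspace T \<and> limitin T s x sequentially \<longrightarrow>
             U' x \<le> liminf (\<lambda>n. U n (s n))) \<and>
        (\<exists>s. range s \<subseteq> topspace T \<and> limitin T s x sequentially \<and>
             limsup (\<lambda>n. U n (s n)) \<le> U' x))"

end

theory Submission
  imports Defs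
begin

text \<open>
  Both halves of the convergence rest on the resolvent equation
  \<open>(\<lambda> - \<theta>\<^sub>n L\<^sub>n) G\<^sub>n = g\<close>, where \<open>g\<close> is \<open>(\<lambda> - \<bbbL>) u\<close> lifted to the wells
  and a constant elsewhere. As \<open>G\<^sub>n\<close> is the Laplace transform of the semigroup, the convergence of the
  one-dimensional distributions gives \<open>G\<^sub>n \<rightarrow> u\<close> on the wells, without any analysis of the trace process.

  For the lower bound take \<open>u = e\<^sup>h\<close> and \<open>\<lambda>\<close> so large that \<open>g > 0\<close>. Then \<open>G\<^sub>n\<close> is bounded away from 0
  everywhere, and testing the functional with \<open>H = ln G\<^sub>n\<close> gives \<open>-\<integral> e\<^sup>-\<^sup>h \<bbbL> e\<^sup>h d\<omega>\<close> in the limit when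
  the limit measure is a mixture of the \<open>\<pi>\<^sub>j\<close> with weights \<open>\<omega>\<close>. If it is not a mixture, then the
  functional at the previous level is positive there, and the ratio of the time scales diverges.

  For the upper bound let first \<open>\<omega>\<close> be carried by one communicating class \<open>D\<close> of the limit chain and
  positive on it. There is an \<open>h\<close> on \<open>D\<close> for which \<open>\<omega>\<close> is stationary under the rates
  \<open>r(i,j) e\<^bsup>h(j)-h(i)\<^esup>\<close>. Take \<open>u = e\<^sup>h\<close> on \<open>D\<close>, \<open>u = 0\<close> elsewhere, and let the recovery sequence be
  a stationary state of the \<open>G\<^sub>n\<close>-transform of the chain on \<open>{G\<^sub>n > 0}\<close>. Its cost is at most
  \<open>\<integral> (g / G\<^sub>n - 1)\<close>, and the lower bound forces each of its limit points to be \<open>\<Sum>\<^sub>j \<omega>\<^sub>j \<pi>\<^sub>j\<close>.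
  Convexity and an approximation by positive \<open>\<omega>\<close> give the general case.
\<close>

section \<open>Resolvents of finite chains\<close>

text \<open>The states off the wells, where \<open>G\<close> need not converge, are handled by the
  constant prescribed there. In the lower bound it is 1: the maximum principle keeps
  \<open>G\<close> away from 0, the integrand stays bounded, and a limit mixture gives these states
  no mass. In the upper bound it is 0: the right-hand side is then at most 0 outside the wells of
  \<open>D\<close>, so that every charged state there contributes at most -1 to the cost per unit of
  mass, whereas a suitable test function for the limit chain bounds that contribution below by 0.
  This gap expels the mass from there. The price is that \<open>G\<close> may vanish or be negative
  off \<open>D\<close>, so \<open>ln G\<close> is no test function. Hence the restriction to {G >
  0}, and the identification of the limit by compactness. Single classes appear because the supremum
  over \<open>h\<close> need not be attained: jumps between distinct classes push \<open>h\<close>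
  to infinity. With the exponentials of these jumps deleted, the problem splits into one per class,
  and positive weights give each of them a solution.\<close>

lemma nn_integral_exp_exponential_density:
  fixes b :: real
  assumes "b \<ge> 0"
  shows "(\<integral>\<^sup>+e. ennreal (exp (- b * e)) \<partial>density lborel (exponential_density 1)) = ennreal (1 / (1 + b))"
proof -
  interpret E: prob_space "density lborel (exponential_density (1 + b))"
    by (rule prob_space_exponential_density) (use assms in auto)
  have "1 = (\<integral>\<^sup>+e. 1 \<partial>density lborel (exponential_density (1 + b)))"
    using E.emeasure_space_1 by simp
  also have "\<dots> = (\<integral>\<^sup>+e. ennreal (exponential_density (1 + b) e) \<partial>lborel)"
    by (subst nn_integral_density) auto
  finally have 1: "(\<integral>\<^sup>+e. ennreal (exponential_density (1 + b) e) \<partial>lborel) = 1" ..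
  have "(\<integral>\<^sup>+e. ennreal (exp (- b * e)) \<partial>density lborel (exponential_density 1))
     = (\<integral>\<^sup>+e. ennreal (1 / (1 + b)) * ennreal (exponential_density (1 + b) e) \<partial>lborel)"
    using assms
    by (subst nn_integral_density)
       (auto intro!: nn_integral_cong simp: exponential_density_def ennreal_mult' [symmetric]
         exp_add [symmetric] field_simps simp flip: ennreal_mult)
  also have "\<dots> = ennreal (1 / (1 + b))"
    by (subst nn_integral_cmult) (auto simp: 1)
  finally show ?thesis .
qed

lemma nn_integral_exponential_memoryless:
  fixes a \<tau> :: real
  assumes [measurable]: "h \<in> borel_measurable borel" and "0 < a" "0 \<le> \<tau>"
  shows "(\<integral>\<^sup>+t. (if t < \<tau> then c else h (t - \<tau>)) \<partial>density lborel (exponential_density a))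
       = ennreal (1 - exp (- a * \<tau>)) * c
         + ennreal (exp (- a * \<tau>)) * (\<integral>\<^sup>+t. h t \<partial>density lborel (exponential_density a))"
proof -
  interpret E: prob_space "density lborel (exponential_density a)"
    by (rule prob_space_exponential_density) fact
  let ?d = "\<lambda>t. ennreal (exponential_density a t)"
  define p where "p = (\<integral>\<^sup>+t. ?d t * indicator {..<\<tau>} t \<partial>lborel)"
  have *: "(\<integral>\<^sup>+t. (if t < \<tau> then c else h (t - \<tau>)) \<partial>density lborel (exponential_density a))
       = p * c + ennreal (exp (- a * \<tau>)) * (\<integral>\<^sup>+t. h t \<partial>density lborel (exponential_density a))"
    if [measurable]: "h \<in> borel_measurable borel" for h :: "real \<Rightarrow> ennreal" and c
  proof -
    have "(\<integral>\<^sup>+t. (if t < \<tau> then c else h (t - \<tau>)) \<partial>density lborel (exponential_density a))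
       = (\<integral>\<^sup>+t. ?d t * indicator {..<\<tau>} t * c + ?d t * indicator {\<tau>..} t * h (t - \<tau>) \<partial>lborel)"
      by (subst nn_integral_density) (auto intro!: nn_integral_cong split: split_indicator)
    also have "\<dots> = p * c + (\<integral>\<^sup>+t. ?d t * indicator {\<tau>..} t * h (t - \<tau>) \<partial>lborel)"
      unfolding p_def by (subst nn_integral_add) (auto simp: nn_integral_multc)
    also have "(\<integral>\<^sup>+t. ?d t * indicator {\<tau>..} t * h (t - \<tau>) \<partial>lborel)
       = (\<integral>\<^sup>+t. ?d (\<tau> + t) * indicator {\<tau>..} (\<tau> + t) * h t \<partial>lborel)"
      by (subst nn_integral_real_affine[where c = 1 and t = \<tau>]) auto
    also have "\<dots> = (\<integral>\<^sup>+t. ennreal (exp (- a * \<tau>)) * (?d t * h t) \<partial>lborel)"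
    proof (rule nn_integral_cong)
      fix t
      have "exponential_density a (\<tau> + t) = exp (- a * \<tau>) * exponential_density a t" if "0 \<le> t"
        using that assms by (simp add: exponential_density_def exp_add [symmetric] field_simps)
      then show "?d (\<tau> + t) * indicator {\<tau>..} (\<tau> + t) * h t = ennreal (exp (- a * \<tau>)) * (?d t * h t)"
        by (cases "0 \<le> t")
           (auto simp: ennreal_mult' mult.assoc, simp add: exponential_density_def)
    qed
    also have "\<dots> = ennreal (exp (- a * \<tau>)) * (\<integral>\<^sup>+t. h t \<partial>density lborel (exponential_density a))"
      by (simp add: nn_integral_cmult nn_integral_density)
    finally show ?thesis .
  qed
  \<comment> \<open>The mass \<open>p\<close> of the times before \<open>\<tau>\<close> is read off
    from the identity itself, taken for constant functions.\<close>
  from *[of "\<lambda>_. 1" 1] have 1: "p + ennreal (exp (- a * \<tau>)) = 1"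
    using E.emeasure_space_1 by simp
  have "p = p + ennreal (exp (- a * \<tau>)) - ennreal (exp (- a * \<tau>))" by simp
  also have "\<dots> = ennreal (1 - exp (- a * \<tau>))"
    unfolding 1 by (subst ennreal_minus [symmetric]) auto
  finally show ?thesis using *[of h c] by simp
qed

section \<open>Measurability and non-explosion of the jump-chain construction\<close>

locale finite_chain =
  fixes S :: "'a::countable set" and R :: "'a \<Rightarrow> 'a \<Rightarrow> real"
  assumes finite_S: "finite S"
    and R_nonneg: "x \<in> S \<Longrightarrow> y \<in> S \<Longrightarrow> x \<noteq> y \<Longrightarrow> 0 \<le> R x y"
begin

abbreviation "hr \<equiv> holding_rate S R"
abbreviation "jumps \<equiv> Pi_pmf S undefined (jump_pmf S R)"
abbreviation "expo \<equiv> density lborel (exponential_density 1)"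
abbreviation "cpath \<equiv> chain_path S R"

sublocale expo: prob_space expo
  by (rule prob_space_exponential_density) simp

sublocale step: prob_space "measure_pmf jumps \<Otimes>\<^sub>M expo"
  by (intro prob_space_pair prob_space_measure_pmf prob_space_exponential_density) simp

sublocale noise: prob_space "chain_noise S R"
  unfolding chain_noise_def by (rule step.prob_space_stream_space)

sublocale pair: pair_sigma_finite "measure_pmf jumps" expo ..

lemma hr_nonneg: "x \<in> S \<Longrightarrow> 0 \<le> hr x"
  unfolding holding_rate_def by (auto intro!: sum_nonneg R_nonneg)

lemma hr_eq_0: "x \<in> S \<Longrightarrow> hr x = 0 \<Longrightarrow> y \<in> S \<Longrightarrow> y \<noteq> x \<Longrightarrow> R x y = 0"
  unfolding holding_rate_def using finite_S R_nonneg
  by (subst (asm) sum_nonneg_eq_0_iff) auto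

lemma pmf_jump_pmf:
  assumes "x \<in> S" "hr x \<noteq> 0"
  shows "pmf (jump_pmf S R x) y = (if y \<in> S - {x} then R x y / hr x else 0)"
proof -
  have "(\<integral>\<^sup>+y. ennreal (if y \<in> S - {x} then R x y / hr x else 0) \<partial>count_space UNIV)
      = (\<Sum>y\<in>S-{x}. ennreal (R x y / hr x))"
    by (subst nn_integral_count_space'[of "S - {x}"]) (use finite_S in auto)
  also have "\<dots> = ennreal (\<Sum>y\<in>S-{x}. R x y / hr x)"
    by (rule sum_ennreal) (use assms R_nonneg hr_nonneg in auto)
  also have "(\<Sum>y\<in>S-{x}. R x y / hr x) = 1"
    using assms by (simp add: sum_divide_distrib [symmetric] holding_rate_def)
  finally show ?thesis
    unfolding jump_pmf_def using assms R_nonneg hr_nonneg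
    by (subst if_not_P, simp, subst pmf_embed_pmf) auto
qed

lemma set_jump_pmf:
  assumes "x \<in> S" shows "set_pmf (jump_pmf S R x) \<subseteq> S"
proof (cases "hr x = 0")
  case True then show ?thesis using assms by (simp add: jump_pmf_def)
next
  case False then show ?thesis using pmf_jump_pmf[OF assms False]
    by (auto simp: set_pmf_eq split: if_splits)
qed

lemma measurable_jump_state [measurable]:
  "(\<lambda>\<omega>. jump_state x \<omega> k) \<in> measurable (chain_noise S R) (count_space UNIV)"
proof (induction k)
  case (Suc k)
  have "(\<lambda>\<omega>. fst (\<omega> !! k) i) \<in> measurable (chain_noise S R) (count_space UNIV)" for i
    by (rule measurable_compose[where g = "\<lambda>f. f i" and N = "measure_pmf jumps"])
       (simp_all add: chain_noise_def)
  from measurable_compose_countable[OF this Suc] show ?case by simp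
qed simp

lemma measurable_jump_time [measurable]:
  "(\<lambda>\<omega>. jump_time S R x \<omega> k) \<in> borel_measurable (chain_noise S R)"
proof -
  have [measurable]: "(\<lambda>\<omega>. snd (\<omega> !! i)) \<in> borel_measurable (chain_noise S R)" for i
    unfolding chain_noise_def by simp
  have [measurable]: "(\<lambda>\<omega>. hr (jump_state x \<omega> i)) \<in> borel_measurable (chain_noise S R)" for i
    by (rule measurable_compose[OF measurable_jump_state]) simp
  show ?thesis unfolding jump_time_def by measurable
qed

lemma measurable_path [measurable]:
  "(\<lambda>(\<omega>, t). cpath x \<omega> t) \<in> measurable (chain_noise S R \<Otimes>\<^sub>M borel) (count_space UNIV)"
proof -
  have [measurable]: "(\<lambda>z. jump_time S R x (fst z) k) \<in> borel_measurable (chain_noise S R \<Otimes>\<^sub>M borel)" for k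
    by measurable
  have [measurable]: "(\<lambda>z. LEAST k. ennreal (snd z) < jump_time S R x (fst z) (Suc k))
      \<in> measurable (chain_noise S R \<Otimes>\<^sub>M borel) (count_space UNIV)"
    by measurable
  have [measurable]: "(\<lambda>z. jump_state x (fst z) (LEAST k. ennreal (snd z) < jump_time S R x (fst z) (Suc k)))
      \<in> measurable (chain_noise S R \<Otimes>\<^sub>M borel) (count_space UNIV)"
    by (rule measurable_compose_countable) measurable
  show ?thesis unfolding chain_path_def case_prod_beta by measurable
qed

lemma measurable_path_fixed [measurable]:
  "(\<lambda>\<omega>. cpath x \<omega> t) \<in> measurable (chain_noise S R) (count_space UNIV)"
  using measurable_compose[OF _ measurable_path, of "\<lambda>\<omega>. (\<omega>, t)" "chain_noise S R" x] by simp

lemma pred_step [measurable]: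
  "Measurable.pred (measure_pmf jumps \<Otimes>\<^sub>M expo) (\<lambda>z. fst z \<in> S \<rightarrow> S \<and> 0 < snd z)"
proof -
  have [measurable]: "Measurable.pred (measure_pmf jumps) (\<lambda>f. f \<in> S \<rightarrow> S)" by simp
  show ?thesis by measurable
qed

lemma AE_step: "AE z in measure_pmf jumps \<Otimes>\<^sub>M expo. fst z \<in> S \<rightarrow> S \<and> 0 < snd z"
proof -
  have "AE f in measure_pmf jumps. f \<in> S \<rightarrow> S"
    using set_jump_pmf finite_S
    by (fastforce simp: AE_measure_pmf_iff set_Pi_pmf PiE_dflt_def)
  moreover have "AE e in expo. 0 < e"
  proof -
    have "AE e in lborel. e \<noteq> (0::real)" by (rule AE_lborel_singleton)
    then show ?thesis by (subst AE_density) (auto simp: exponential_density_def)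
  qed
  ultimately show ?thesis
    by (intro pair.AE_pair_measure) auto
qed

lemma AE_good:
  "AE \<omega> in chain_noise S R. \<forall>k. fst (\<omega> !! k) \<in> S \<rightarrow> S \<and> 0 < snd (\<omega> !! k)"
proof -
  have "AE \<omega> in stream_space (measure_pmf jumps \<Otimes>\<^sub>M expo).
      stream_all (\<lambda>z. fst z \<in> S \<rightarrow> S \<and> 0 < snd z) \<omega>"
    by (rule step.AE_stream_all[OF pred_step AE_step])
  then show ?thesis
    unfolding chain_noise_def by (rule eventually_mono) (simp add: stream_all_def)
qed

lemma jump_state_in:
  assumes "\<forall>k. fst (\<omega> !! k) \<in> S \<rightarrow> S" "x \<in> S"
  shows "jump_state x \<omega> k \<in> S"
  using assms by (induction k) (auto simp: Pi_iff)

text \<open>A tool for non-explosion: the integral tends to 0 with \<open>k\<close>, which makes the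
  sum of the clocks diverge almost surely. Each clock contributes the Laplace transform of a
  standard exponential at 1, namely 1/2.\<close>

lemma nn_integral_exp_clocks:
  "(\<integral>\<^sup>+\<omega>. ennreal (exp (- (\<Sum>i<k. snd (\<omega> !! i)))) \<partial>chain_noise S R) = ennreal ((1 / 2) ^ k)"
proof (induction k)
  case 0
  then show ?case using noise.emeasure_space_1 by simp
next
  case (Suc k)
  have [measurable]: "(\<lambda>\<omega>. snd (\<omega> !! i)) \<in> borel_measurable (stream_space (measure_pmf jumps \<Otimes>\<^sub>M expo))" for i
    by measurable
  have "(\<integral>\<^sup>+\<omega>. ennreal (exp (- (\<Sum>i<Suc k. snd (\<omega> !! i)))) \<partial>chain_noise S R)
     = (\<integral>\<^sup>+z. \<integral>\<^sup>+\<omega>. ennreal (exp (- snd z)) * ennreal (exp (- (\<Sum>i<k. snd (\<omega> !! i)))) \<partial>chain_noise S R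
          \<partial>(measure_pmf jumps \<Otimes>\<^sub>M expo))"
    unfolding chain_noise_def
    by (subst step.nn_integral_stream_space, measurable)
       (simp add: sum.lessThan_Suc_shift ennreal_mult' [symmetric] exp_add [symmetric] del: sum.lessThan_Suc)
  also have "\<dots> = (\<integral>\<^sup>+z. ennreal (exp (- snd z)) * ennreal ((1 / 2) ^ k) \<partial>(measure_pmf jumps \<Otimes>\<^sub>M expo))"
    by (subst nn_integral_cmult) (auto simp: Suc, simp add: chain_noise_def)
  also have "\<dots> = (\<integral>\<^sup>+z. ennreal (exp (- snd z)) \<partial>(measure_pmf jumps \<Otimes>\<^sub>M expo)) * ennreal ((1 / 2) ^ k)"
    by (rule nn_integral_multc) measurable
  also have "(\<integral>\<^sup>+z. ennreal (exp (- snd z)) \<partial>(measure_pmf jumps \<Otimes>\<^sub>M expo)) = ennreal (1 / 2)"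
    using nn_integral_exp_exponential_density[of 1]
    by (subst expo.nn_integral_fst [symmetric]) simp_all
  also have "ennreal (1 / 2) * ennreal ((1 / 2) ^ k) = ennreal ((1 / 2) ^ Suc k)"
    by (subst ennreal_mult' [symmetric]) auto
  finally show ?case .
qed

text \<open>The clocks have unbounded sums and the holding rates are bounded, so the jump times are
  unbounded. One null set serves all starting points, because the result is applied at the random
  state after the first jump.\<close>

lemma AE_nonexplosion:
  "AE \<omega> in chain_noise S R. \<forall>x\<in>S. \<forall>t. \<exists>k. ennreal t < jump_time S R x \<omega> (Suc k)"
proof -
  let ?f = "\<lambda>\<omega>. INF k. ennreal (exp (- (\<Sum>i<k. snd (\<omega> !! i))))"
  have [measurable]: "(\<lambda>\<omega>. snd (\<omega> !! i)) \<in> borel_measurable (chain_noise S R)" for i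
    unfolding chain_noise_def by measurable
  have "(\<integral>\<^sup>+\<omega>. ?f \<omega> \<partial>chain_noise S R) \<le> ennreal ((1 / 2) ^ k)" for k
    unfolding nn_integral_exp_clocks [symmetric]
    by (intro nn_integral_mono INF_lower) simp
  moreover have "(\<lambda>k. ennreal ((1 / 2) ^ k)) \<longlonglongrightarrow> ennreal 0"
    by (intro tendsto_ennrealI LIMSEQ_power_zero) simp
  ultimately have "(\<integral>\<^sup>+\<omega>. ?f \<omega> \<partial>chain_noise S R) \<le> 0"
    by (intro LIMSEQ_le_const) auto
  then have "AE \<omega> in chain_noise S R. ?f \<omega> = 0"
    by (subst nn_integral_0_iff_AE [symmetric]) auto
  with AE_good show ?thesis
  proof eventually_elim
    case (elim \<omega>)
    show ?case
    proof (intro ballI allI, rule ccontr)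
      fix x t assume x: "x \<in> S" and "\<nexists>k. ennreal t < jump_time S R x \<omega> (Suc k)"
      then have le: "jump_time S R x \<omega> (Suc k) \<le> ennreal t" for k by (auto simp: not_less)
      \<comment> \<open>A common bound of the holding rates; the summand 1 keeps it positive when
        they all vanish. Below, \<open>max t 0\<close> occurs because \<open>ennreal t\<close> is 0
        for negative \<open>t\<close>.\<close>
      define L where "L = (\<Sum>y\<in>S. hr y) + 1"
      have L: "0 < L" "\<And>y. y \<in> S \<Longrightarrow> hr y \<le> L"
        using finite_S hr_nonneg sum_nonneg[of S hr]
        by (auto simp: L_def intro: order_trans[OF member_le_sum[of _ S hr]])
      have st: "jump_state x \<omega> i \<in> S" for i using jump_state_in elim x by blast
      have "(\<Sum>i<k. snd (\<omega> !! i)) \<le> L * max t 0" for k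
      proof -
        have "ennreal ((\<Sum>i<k. snd (\<omega> !! i)) / L) = (\<Sum>i<k. ennreal (snd (\<omega> !! i) / L))"
          unfolding sum_divide_distrib using elim L
          by (intro sum_ennreal [symmetric]) (auto intro: less_imp_le)
        also have "\<dots> \<le> (\<Sum>i<k. ennreal (snd (\<omega> !! i)) / ennreal (hr (jump_state x \<omega> i)))"
        proof (rule sum_mono)
          fix i
          show "ennreal (snd (\<omega> !! i) / L) \<le> ennreal (snd (\<omega> !! i)) / ennreal (hr (jump_state x \<omega> i))"
          proof (cases "hr (jump_state x \<omega> i) = 0")
            case True
            then show ?thesis using elim(1)[rule_format, of i] by (simp add: ennreal_divide_zero)
          next
            case False
            then have "0 < hr (jump_state x \<omega> i)" using hr_nonneg[OF st, of i] by simp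
            moreover have "0 < snd (\<omega> !! i)" using elim(1) by blast
            ultimately show ?thesis using L(1) L(2)[OF st, of i]
              by (subst divide_ennreal) (auto intro!: ennreal_leI frac_le)
          qed
        qed
        also have "\<dots> \<le> jump_time S R x \<omega> (Suc k)" by (simp add: jump_time_def)
        also have "\<dots> \<le> ennreal t" by (rule le)
        also have "\<dots> \<le> ennreal (max t 0)" by (rule ennreal_leI) simp
        finally have "(\<Sum>i<k. snd (\<omega> !! i)) / L \<le> max t 0"
          by (subst (asm) ennreal_le_iff) auto
        then show ?thesis using L(1) by (simp only: pos_divide_le_eq mult.commute)
      qed
      then have "ennreal (exp (- (L * max t 0))) \<le> ?f \<omega>"
        by (intro INF_greatest ennreal_leI) simp
      with elim show False by (simp add: ennreal_eq_0_iff)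
    qed
  qed
qed

lemma jump_state_Stream: "jump_state x (z ## \<omega>) (Suc k) = jump_state (fst z x) \<omega> k"
  by (induction k) auto

lemma jump_time_Stream:
  "jump_time S R x (z ## \<omega>) (Suc k) = ennreal (snd z) / ennreal (hr x) + jump_time S R (fst z x) \<omega> k"
  unfolding jump_time_def
  by (simp add: sum.lessThan_Suc_shift jump_state_Stream del: sum.lessThan_Suc jump_state.simps(2))

text \<open>Renewal at the first jump. The last assumption excludes the explosion branch of
  \<open>chain_path\<close>, which would return \<open>x\<close> on the left but
  \<open>fst z x\<close> on the right.\<close>

lemma path_Stream:
  assumes "hr x > 0" "snd z > 0" "t \<ge> 0"
    and "\<exists>k. ennreal (t - snd z / hr x) < jump_time S R (fst z x) \<omega> (Suc k)"
  shows "cpath x (z ## \<omega>) t = (if t < snd z / hr x then x else cpath (fst z x) \<omega> (t - snd z / hr x))"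
proof -
  let ?\<tau> = "snd z / hr x"
  have \<tau>: "ennreal (snd z) / ennreal (hr x) = ennreal ?\<tau>" "0 < ?\<tau>"
    using assms by (auto simp: divide_ennreal)
  let ?P = "\<lambda>k. ennreal t < jump_time S R x (z ## \<omega>) (Suc k)"
  have 0: "?P 0 \<longleftrightarrow> t < ?\<tau>"
    using assms \<tau> by (simp add: jump_time_Stream del: One_nat_def) (simp add: jump_time_def ennreal_less_iff)
  show ?thesis
  proof (cases "t < ?\<tau>")
    case True
    with 0 have P0: "?P 0" by simp
    then have "(LEAST k. ?P k) = 0" by (intro Least_equality) auto
    then show ?thesis unfolding chain_path_def using P0 True by auto
  next
    case False
    let ?Q = "\<lambda>k. ennreal (t - ?\<tau>) < jump_time S R (fst z x) \<omega> (Suc k)"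
    have iff: "?P (Suc k) \<longleftrightarrow> ?Q k" for k
    proof -
      have "ennreal t = ennreal ?\<tau> + ennreal (t - ?\<tau>)"
        using False \<tau> by (subst ennreal_plus [symmetric]) auto
      then show ?thesis unfolding jump_time_Stream[of x z \<omega> "Suc k"] \<tau>
        by (simp add: ennreal_add_left_cancel_less)
    qed
    obtain k where k: "?Q k" using assms by blast
    then have "?P (Suc k)" using iff by blast
    then have "(LEAST k. ?P k) = Suc (LEAST k. ?P (Suc k))"
      by (rule Least_Suc) (use 0 False in simp)
    then have "(LEAST k. ?P k) = Suc (LEAST k. ?Q k)" using iff by simp
    then show ?thesis unfolding chain_path_def
      using False k \<open>?P (Suc k)\<close> by (auto simp: jump_state_Stream simp del: jump_state.simps(2))
  qed
qed

lemma path_absorbing: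
  assumes "hr x = 0" "snd z > 0"
  shows "cpath x (z ## \<omega>) t = x"
proof -
  have P0: "ennreal t < jump_time S R x (z ## \<omega>) (Suc 0)"
    using assms by (simp add: jump_time_Stream ennreal_divide_zero)
  then have "(LEAST k. ennreal t < jump_time S R x (z ## \<omega>) (Suc k)) = 0"
    by (intro Least_equality) auto
  then show ?thesis unfolding chain_path_def using P0 by auto
qed

lemma path_in:
  assumes "\<forall>k. fst (\<omega> !! k) \<in> S \<rightarrow> S" "x \<in> S"
  shows "cpath x \<omega> t \<in> S"
  unfolding chain_path_def using jump_state_in[OF assms] assms by auto

section \<open>The resolvent kernel and its equation\<close>

text \<open>The law of the chain at an independent exponential time of rate \<open>a\<close>, which
  is \<open>a\<close> times the resolvent kernel.\<close>

definition occ :: "real \<Rightarrow> 'a \<Rightarrow> 'a \<Rightarrow> real" where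
  "occ a x y = (\<integral>t. \<P>(\<omega> in chain_noise S R. cpath x \<omega> t = y) \<partial>density lborel (exponential_density a))"

text \<open>The same number with the path integral outermost and with values in
  \<open>ennreal\<close>: in this form the first element of the noise can be split off before
  integrability is discussed.\<close>

definition occ_nn :: "real \<Rightarrow> 'a \<Rightarrow> 'a \<Rightarrow> ennreal" where
  "occ_nn a x y = (\<integral>\<^sup>+\<omega>. \<integral>\<^sup>+t. indicator {y} (cpath x \<omega> t)
      \<partial>density lborel (exponential_density a) \<partial>chain_noise S R)"

lemma measurable_indicator_path [measurable]:
  "(\<lambda>(\<omega>, t). indicator {y} (cpath x \<omega> t) :: ennreal) \<in> borel_measurable (chain_noise S R \<Otimes>\<^sub>M borel)"
  using measurable_compose[OF measurable_path[of x], of "indicator {y} :: _ \<Rightarrow> ennreal" borel]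
  by (simp add: case_prod_beta)

lemma nn_integral_indicator_path:
  "(\<integral>\<^sup>+\<omega>. indicator {y} (cpath x \<omega> t) \<partial>chain_noise S R)
    = ennreal (\<P>(\<omega> in chain_noise S R. cpath x \<omega> t = y))"
proof -
  have "(\<integral>\<^sup>+\<omega>. indicator {y} (cpath x \<omega> t) \<partial>chain_noise S R)
     = (\<integral>\<^sup>+\<omega>. indicator {\<omega>\<in>space (chain_noise S R). cpath x \<omega> t = y} \<omega> \<partial>chain_noise S R)"
    by (intro nn_integral_cong) (auto split: split_indicator)
  also have "\<dots> = ennreal (\<P>(\<omega> in chain_noise S R. cpath x \<omega> t = y))"
    by (subst nn_integral_indicator) (auto simp: noise.emeasure_eq_measure)
  finally show ?thesis .
qed

lemma measurable_prob_path [measurable]: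
  "(\<lambda>t. \<P>(\<omega> in chain_noise S R. cpath x \<omega> t = y)) \<in> borel_measurable borel"
proof -
  have "(\<lambda>t. \<integral>\<^sup>+\<omega>. indicator {y} (cpath x \<omega> t) \<partial>chain_noise S R) \<in> borel_measurable borel"
    by measurable
  then show ?thesis by (simp add: nn_integral_indicator_path)
qed

lemma occ_nn_eq:
  assumes "a > 0" shows "occ_nn a x y = ennreal (occ a x y)"
proof -
  interpret E: prob_space "density lborel (exponential_density a)"
    by (rule prob_space_exponential_density) fact
  interpret P: pair_sigma_finite "chain_noise S R" "density lborel (exponential_density a)" ..
  have "occ_nn a x y = (\<integral>\<^sup>+t. \<integral>\<^sup>+\<omega>. indicator {y} (cpath x \<omega> t) \<partial>chain_noise S R
      \<partial>density lborel (exponential_density a))"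
    unfolding occ_nn_def
    by (rule P.Fubini' [symmetric]) simp
  also have "\<dots> = (\<integral>\<^sup>+t. ennreal (\<P>(\<omega> in chain_noise S R. cpath x \<omega> t = y))
      \<partial>density lborel (exponential_density a))"
    by (simp only: nn_integral_indicator_path)
  also have "\<dots> = ennreal (occ a x y)"
    unfolding occ_def
    by (rule nn_integral_eq_integral) (auto intro!: E.integrable_const_bound[where B = 1])
  finally show ?thesis .
qed

text \<open>First-step analysis. The observation clock of rate \<open>a\<close> competes with the
  holding time of rate \<open>hr x\<close>. It rings first with probability
  \<open>a / (hr x + a)\<close> and finds the chain at \<open>x\<close>; otherwise lack of memory
  restarts the clock at the state after the jump.\<close>

lemma occ_nn_step:
  assumes "a > 0" "x \<in> S" "y \<in> S"
  shows "occ_nn a x y = ennreal (a / (hr x + a)) * indicator {y} x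
    + ennreal (hr x / (hr x + a)) * (\<Sum>z\<in>S. occ_nn a z y * ennreal (pmf (jump_pmf S R x) z))"
proof -
  let ?E = "density lborel (exponential_density a)"
  interpret E: prob_space ?E by (rule prob_space_exponential_density) fact
  let ?F = "\<lambda>x \<omega>. \<integral>\<^sup>+t. indicator {y} (cpath x \<omega> t) \<partial>?E"
  have [measurable]: "?F x \<in> borel_measurable (chain_noise S R)" for x
    by measurable
  have unf: "occ_nn a x y = (\<integral>\<^sup>+z. \<integral>\<^sup>+\<omega>. ?F x (z ## \<omega>) \<partial>chain_noise S R \<partial>(measure_pmf jumps \<Otimes>\<^sub>M expo))"
    unfolding occ_nn_def chain_noise_def
    by (rule step.nn_integral_stream_space) (simp flip: chain_noise_def)
  have E0: "AE t in ?E. 0 \<le> t"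
    by (subst AE_density) (auto simp: exponential_density_def)
  show ?thesis
  proof (cases "hr x = 0")
    case True
    have "occ_nn a x y = (\<integral>\<^sup>+z. indicator {y} x \<partial>(measure_pmf jumps \<Otimes>\<^sub>M expo))"
      unfolding unf
    proof (rule nn_integral_cong_AE, use AE_step in eventually_elim)
      case (elim z)
      have "(\<integral>\<^sup>+\<omega>. ?F x (z ## \<omega>) \<partial>chain_noise S R) = (\<integral>\<^sup>+\<omega>. indicator {y} x \<partial>chain_noise S R)"
        using True elim by (simp add: path_absorbing E.emeasure_space_1 [simplified])
      then show ?case using noise.emeasure_space_1 by simp
    qed
    then show ?thesis using True assms step.emeasure_space_1 by simp
  next
    case False
    then have hx: "hr x > 0" using hr_nonneg[OF \<open>x \<in> S\<close>] by simp
    define \<tau> where "\<tau> e = e / hr x" for e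
    have [measurable]: "\<tau> \<in> borel_measurable borel" unfolding \<tau>_def by measurable
    have "occ_nn a x y = (\<integral>\<^sup>+z. ennreal (1 - exp (- a * \<tau> (snd z))) * indicator {y} x
        + ennreal (exp (- a * \<tau> (snd z))) * occ_nn a (fst z x) y \<partial>(measure_pmf jumps \<Otimes>\<^sub>M expo))"
      unfolding unf
    proof (rule nn_integral_cong_AE, use AE_step in eventually_elim)
      case (elim z)
      have \<tau>z: "\<tau> (snd z) \<ge> 0" using elim hx by (simp add: \<tau>_def)
      have fz: "fst z x \<in> S" using elim assms by auto
      have "(\<integral>\<^sup>+\<omega>. ?F x (z ## \<omega>) \<partial>chain_noise S R)
         = (\<integral>\<^sup>+\<omega>. ennreal (1 - exp (- a * \<tau> (snd z))) * indicator {y} x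
             + ennreal (exp (- a * \<tau> (snd z))) * ?F (fst z x) \<omega> \<partial>chain_noise S R)"
      proof (rule nn_integral_cong_AE, use AE_nonexplosion in eventually_elim)
        case (elim \<omega>)
        have "?F x (z ## \<omega>) = (\<integral>\<^sup>+t. (if t < \<tau> (snd z) then indicator {y} x
             else indicator {y} (cpath (fst z x) \<omega> (t - \<tau> (snd z)))) \<partial>?E)"
          using E0
        proof (intro nn_integral_cong_AE, eventually_elim)
          case (elim t)
          have "\<exists>k. ennreal (t - snd z / hr x) < jump_time S R (fst z x) \<omega> (Suc k)"
            using \<open>\<forall>x\<in>S. _\<close> fz by blast
          then show ?case using path_Stream[OF hx, of z t \<omega>] \<open>0 \<le> t\<close> \<open>fst z \<in> S \<rightarrow> S \<and> 0 < snd z\<close>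
            by (simp add: \<tau>_def)
        qed
        also have "\<dots> = ennreal (1 - exp (- a * \<tau> (snd z))) * indicator {y} x
             + ennreal (exp (- a * \<tau> (snd z))) * ?F (fst z x) \<omega>"
        proof (rule nn_integral_exponential_memoryless[OF _ \<open>a > 0\<close> \<tau>z])
          have "(\<lambda>t. (\<omega>, t)) \<in> borel \<rightarrow>\<^sub>M (chain_noise S R \<Otimes>\<^sub>M borel)"
            by (rule measurable_Pair) (auto simp: chain_noise_def space_stream_space space_pair_measure)
          from measurable_compose[OF this measurable_indicator_path]
          show "(\<lambda>t. indicator {y} (cpath (fst z x) \<omega> t) :: ennreal) \<in> borel_measurable borel" by simp
        qed
        finally show ?case .
      qed
      also have "\<dots> = ennreal (1 - exp (- a * \<tau> (snd z))) * indicator {y} x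
        + ennreal (exp (- a * \<tau> (snd z))) * occ_nn a (fst z x) y"
        unfolding occ_nn_def using noise.emeasure_space_1
        by (subst nn_integral_add) (auto simp: nn_integral_cmult)
      finally show ?case .
    qed
    also have "\<dots> = (\<integral>\<^sup>+f. \<integral>\<^sup>+e. ennreal (1 - exp (- a * \<tau> e)) * indicator {y} x
        + ennreal (exp (- a * \<tau> e)) * occ_nn a (f x) y \<partial>expo \<partial>measure_pmf jumps)"
    proof -
      have [measurable]: "(\<lambda>f. occ_nn a (f x) y) \<in> borel_measurable (measure_pmf jumps)" by simp
      show ?thesis by (subst expo.nn_integral_fst [symmetric]) auto
    qed
    also have "\<dots> = (\<integral>\<^sup>+f. ennreal (a / (hr x + a)) * indicator {y} x
        + ennreal (hr x / (hr x + a)) * occ_nn a (f x) y \<partial>measure_pmf jumps)"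
    proof (rule nn_integral_cong)
      fix f
      have q: "(\<integral>\<^sup>+e. ennreal (exp (- a * \<tau> e)) \<partial>expo) = ennreal (hr x / (hr x + a))"
        using nn_integral_exp_exponential_density[of "a / hr x"] hx \<open>a > 0\<close>
        by (simp add: \<tau>_def field_simps)
      \<comment> \<open>Obtained as the complement of \<open>q\<close>: the integrands add up to 1,
        and a finite term may be cancelled in \<open>ennreal\<close>.\<close>
      have p: "(\<integral>\<^sup>+e. ennreal (1 - exp (- a * \<tau> e)) \<partial>expo) = ennreal (a / (hr x + a))"
      proof -
        have "(\<integral>\<^sup>+e. ennreal (1 - exp (- a * \<tau> e)) \<partial>expo) + ennreal (hr x / (hr x + a))
           = (\<integral>\<^sup>+e. ennreal (1 - exp (- a * \<tau> e)) + ennreal (exp (- a * \<tau> e)) \<partial>expo)"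
          by (subst nn_integral_add, measurable) (simp only: q)
        also have "\<dots> = (\<integral>\<^sup>+e. 1 \<partial>expo)"
        proof (rule nn_integral_cong_AE)
          have "AE e in expo. 0 \<le> e" by (subst AE_density) (auto simp: exponential_density_def)
          then show "AE e in expo. ennreal (1 - exp (- a * \<tau> e)) + ennreal (exp (- a * \<tau> e)) = 1"
          proof eventually_elim
            case (elim e)
            then have "0 \<le> a * \<tau> e" using hx \<open>a > 0\<close> by (simp add: \<tau>_def)
            then show ?case by (subst ennreal_plus [symmetric]) auto
          qed
        qed
        also have "\<dots> = 1" using expo.emeasure_space_1 by simp
        also have "\<dots> = ennreal (a / (hr x + a) + hr x / (hr x + a))"
          using hx \<open>a > 0\<close> by (simp only: add_divide_distrib [symmetric]) simp
        also have "\<dots> = ennreal (a / (hr x + a)) + ennreal (hr x / (hr x + a))"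
          using hx \<open>a > 0\<close> by (intro ennreal_plus) auto
        finally have "(\<integral>\<^sup>+e. ennreal (1 - exp (- a * \<tau> e)) \<partial>expo) + ennreal (hr x / (hr x + a))
          = ennreal (a / (hr x + a)) + ennreal (hr x / (hr x + a))" .
        from this [unfolded add.commute [of _ "ennreal (hr x / (hr x + a))"] ennreal_add_left_cancel]
        show ?thesis by (rule disjE) (simp_all only: infinity_ennreal_def ennreal_neq_top)
      qed
      show "(\<integral>\<^sup>+e. ennreal (1 - exp (- a * \<tau> e)) * indicator {y} x
        + ennreal (exp (- a * \<tau> e)) * occ_nn a (f x) y \<partial>expo) = ennreal (a / (hr x + a)) * indicator {y} x
        + ennreal (hr x / (hr x + a)) * occ_nn a (f x) y"
        by (subst nn_integral_add, measurable, subst nn_integral_multc, measurable,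
            subst nn_integral_multc, measurable) (simp only: p q)
    qed
    also have "\<dots> = ennreal (a / (hr x + a)) * indicator {y} x
        + ennreal (hr x / (hr x + a)) * (\<integral>\<^sup>+f. occ_nn a (f x) y \<partial>measure_pmf jumps)"
      by (subst nn_integral_add) (auto simp: nn_integral_cmult measure_pmf.emeasure_space_1 [simplified])
    also have "(\<integral>\<^sup>+f. occ_nn a (f x) y \<partial>measure_pmf jumps) = (\<integral>\<^sup>+z. occ_nn a z y \<partial>measure_pmf (jump_pmf S R x))"
    proof -
      have "jump_pmf S R x = map_pmf (\<lambda>f. f x) jumps"
        using Pi_pmf_component[OF finite_S, of x undefined "jump_pmf S R"] assms by simp
      then show ?thesis by (simp only: nn_integral_map_pmf)
    qed
    also have "\<dots> = (\<Sum>z\<in>S. occ_nn a z y * ennreal (pmf (jump_pmf S R x) z))"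
      by (rule nn_integral_measure_pmf_support) (use finite_S set_jump_pmf[OF \<open>x \<in> S\<close>] in auto)
    finally show ?thesis .
  qed
qed

lemma occ_nonneg: "a > 0 \<Longrightarrow> 0 \<le> occ a x y"
  unfolding occ_def by (intro integral_nonneg_AE) auto

text \<open>The first-step identity multiplied by \<open>hr x + a\<close>; the sum over the jump
  targets becomes the off-diagonal part of the generator.\<close>

lemma occ_resolvent:
  assumes "a > 0" "x \<in> S" "y \<in> S"
  shows "a * occ a x y - generator S R (\<lambda>z. occ a z y) x = a * indicator {y} x"
proof -
  have "ennreal (occ a x y) = ennreal (a / (hr x + a)) * ennreal (indicator {y} x)
    + ennreal (hr x / (hr x + a)) * (\<Sum>z\<in>S. ennreal (occ a z y) * ennreal (pmf (jump_pmf S R x) z))"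
    using occ_nn_step[OF assms] assms by (simp add: occ_nn_eq ennreal_indicator)
  also have "(\<Sum>z\<in>S. ennreal (occ a z y) * ennreal (pmf (jump_pmf S R x) z))
      = ennreal (\<Sum>z\<in>S. occ a z y * pmf (jump_pmf S R x) z)"
    using assms by (simp add: ennreal_mult' [symmetric] occ_nonneg sum_ennreal)
  also have "ennreal (a / (hr x + a)) * ennreal (indicator {y} x)
    + ennreal (hr x / (hr x + a)) * \<dots> = ennreal (a / (hr x + a) * indicator {y} x
    + hr x / (hr x + a) * (\<Sum>z\<in>S. occ a z y * pmf (jump_pmf S R x) z))"
    using assms hr_nonneg[of x]
    by (simp add: ennreal_mult' [symmetric] ennreal_plus [symmetric] occ_nonneg sum_nonneg del: ennreal_plus)
  finally have eq: "occ a x y = a / (hr x + a) * indicator {y} x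
    + hr x / (hr x + a) * (\<Sum>z\<in>S. occ a z y * pmf (jump_pmf S R x) z)"
    using assms hr_nonneg[of x] by (subst (asm) ennreal_inj) (auto simp: occ_nonneg sum_nonneg)
  have "hr x * (\<Sum>z\<in>S. occ a z y * pmf (jump_pmf S R x) z) = (\<Sum>z\<in>S-{x}. R x z * occ a z y)"
  proof (cases "hr x = 0")
    case True
    then show ?thesis using hr_eq_0[OF \<open>x \<in> S\<close>] by (auto intro!: sum.neutral [symmetric])
  next
    case False
    have "(\<Sum>z\<in>S. occ a z y * pmf (jump_pmf S R x) z) = (\<Sum>z\<in>S-{x}. occ a z y * (R x z / hr x))"
      using finite_S pmf_jump_pmf[OF \<open>x \<in> S\<close> False] by (intro sum.mono_neutral_cong_right) auto
    also have "hr x * \<dots> = (\<Sum>z\<in>S-{x}. R x z * occ a z y)"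
      using False by (simp add: sum_distrib_left mult.commute)
    finally show ?thesis .
  qed
  moreover have "generator S R (\<lambda>z. occ a z y) x = (\<Sum>z\<in>S-{x}. R x z * occ a z y) - hr x * occ a x y"
    using finite_S \<open>x \<in> S\<close>
    by (simp add: generator_def sum.remove[of S x] right_diff_distrib sum_subtractf
        holding_rate_def sum_distrib_right)
  moreover have "(hr x + a) * occ a x y = a * indicator {y} x
    + hr x * (\<Sum>z\<in>S. occ a z y * pmf (jump_pmf S R x) z)"
  proof -
    have "hr x + a \<noteq> 0" using assms hr_nonneg[of x] by simp
    then show ?thesis unfolding eq distrib_left by simp
  qed
  ultimately show ?thesis by (simp add: algebra_simps)
qed

lemma occ_outside:
  assumes "x \<in> S" "y \<notin> S" shows "occ a x y = 0"
proof -
  have "\<P>(\<omega> in chain_noise S R. cpath x \<omega> t = y) = 0" for t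
  proof -
    have "AE \<omega> in chain_noise S R. cpath x \<omega> t \<noteq> y"
      using AE_good by eventually_elim (use path_in assms in blast)
    then show ?thesis by (subst noise.prob_eq_0) auto
  qed
  then show ?thesis unfolding occ_def by simp
qed

lemma occ_scale:
  assumes "0 < \<theta>" "0 < l"
  shows "occ (l / \<theta>) x y
    = (\<integral>t. \<P>(\<omega> in chain_noise S R. cpath x \<omega> (t * \<theta>) = y) \<partial>density lborel (exponential_density l))"
proof -
  let ?P = "\<lambda>t. \<P>(\<omega> in chain_noise S R. cpath x \<omega> t = y)"
  have "occ (l / \<theta>) x y = (\<integral>t. exponential_density (l / \<theta>) t * ?P t \<partial>lborel)"
    unfolding occ_def using assms
    by (subst integral_density) auto
  also have "\<dots> = \<theta> * (\<integral>t. exponential_density (l / \<theta>) (\<theta> * t) * ?P (\<theta> * t) \<partial>lborel)"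
    using assms lborel_integral_real_affine[of \<theta> "\<lambda>t. exponential_density (l / \<theta>) t * ?P t" 0] by simp
  also have "\<dots> = (\<integral>t. exponential_density l t * ?P (t * \<theta>) \<partial>lborel)"
    unfolding integral_mult_right_zero [symmetric]
    by (rule Bochner_Integration.integral_cong)
       (use assms in \<open>auto simp: exponential_density_def mult.commute mult_less_0_iff\<close>)
  also have "\<dots> = (\<integral>t. ?P (t * \<theta>) \<partial>density lborel (exponential_density l))"
    using assms by (subst integral_density) auto
  finally show ?thesis .
qed

lemma generator_sum:
  "finite A \<Longrightarrow> generator S R (\<lambda>x. \<Sum>y\<in>A. c y * f y x) x = (\<Sum>y\<in>A. c y * generator S R (f y) x)"
  unfolding generator_def
  by (subst sum_distrib_left, subst sum.swap)
     (simp add: sum_subtractf [symmetric] sum_distrib_left algebra_simps)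

text \<open>Superposition of the columns of the kernel. Multiplied by \<open>\<theta>\<close>, the
  equation of \<open>occ (l / \<theta>)\<close> has \<open>l\<close> times an indicator on its
  right-hand side, hence the division by \<open>l\<close> in \<open>G\<close>.\<close>

lemma resolvent_occ:
  fixes g :: "'a \<Rightarrow> real"
  assumes "0 < \<theta>" "0 < l" "x \<in> S"
  defines "G \<equiv> \<lambda>x. \<Sum>y\<in>S. g y / l * occ (l / \<theta>) x y"
  shows "l * G x - \<theta> * generator S R G x = g x"
proof -
  let ?a = "l / \<theta>"
  have "l * G x - \<theta> * generator S R G x
      = (\<Sum>y\<in>S. g y / ?a * (?a * occ ?a x y - generator S R (\<lambda>z. occ ?a z y) x))"
    unfolding G_def generator_sum[OF finite_S] sum_distrib_left sum_subtractf [symmetric]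
    using assms by (intro sum.cong) (auto simp: field_simps)
  also have "\<dots> = (\<Sum>y\<in>S. g y * indicator {y} x)"
    using assms by (intro sum.cong refl, subst occ_resolvent) auto
  also have "\<dots> = g x"
    using finite_S \<open>x \<in> S\<close> by (simp add: indicator_def sum.delta)
  finally show ?thesis .
qed

text \<open>At a minimiser of \<open>G\<close> the generator is nonnegative, so the bound passes to
  \<open>l * G\<close> there, and from there to all states.\<close>

lemma maximum_principle:
  assumes "0 < l" "0 \<le> \<theta>" "\<And>x. x \<in> S \<Longrightarrow> c \<le> l * G x - \<theta> * generator S R G x" "x \<in> S"
  shows "c \<le> l * G x"
proof -
  define z where "z = arg_min_on G S"
  have z: "z \<in> S" "\<And>y. y \<in> S \<Longrightarrow> G z \<le> G y"
    using finite_S \<open>x \<in> S\<close> unfolding z_def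
    by (auto intro: arg_min_least arg_min_if_finite)
  have "0 \<le> generator S R G z"
    unfolding generator_def
  proof (rule sum_nonneg)
    fix y assume "y \<in> S"
    then show "0 \<le> R z y * (G y - G z)" using z R_nonneg[of z y] by (cases "y = z") auto
  qed
  then have "0 \<le> \<theta> * generator S R G z" using assms by simp
  then have "c \<le> l * G z" using assms(3)[OF z(1)] by simp
  also have "\<dots> \<le> l * G x" using z(2)[OF \<open>x \<in> S\<close>] assms by simp
  finally show ?thesis .
qed

lemma resolvent_unique:
  assumes "0 < l" "\<And>x. x \<in> S \<Longrightarrow> l * F x - generator S R F x = l * G x - generator S R G x" "x \<in> S"
  shows "F x = G x"
proof -
  have gen: "generator S R (\<lambda>x. F x - G x) x = generator S R F x - generator S R G x" for F G x
    unfolding generator_def by (simp add: sum_subtractf [symmetric] algebra_simps)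
  have "0 \<le> l * (F x - G x)"
    using assms by (intro maximum_principle[where \<theta> = 1]) (auto simp: gen algebra_simps)
  moreover have "0 \<le> l * (G x - F x)"
    using assms by (intro maximum_principle[where \<theta> = 1]) (auto simp: gen algebra_simps)
  ultimately show ?thesis using \<open>0 < l\<close> by (simp add: zero_le_mult_iff)
qed

end

section \<open>Convergence of the resolvents\<close>

text \<open>In units of \<open>\<theta> n\<close> the exponential time has the fixed rate
  \<open>l\<close>, so convergence at fixed times passes through its law by dominated
  convergence.\<close>

lemma occ_tendsto:
  fixes R :: "nat \<Rightarrow> 'v::finite \<Rightarrow> 'v \<Rightarrow> real" and r :: "nat \<Rightarrow> nat \<Rightarrow> real"
  assumes R: "\<And>n. n \<ge> 1 \<Longrightarrow> finite_chain UNIV (R n)"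
    and r: "finite_chain J r" and l: "0 < l" and \<theta>: "\<And>n. n \<ge> 1 \<Longrightarrow> 0 < \<theta> n"
    and lim: "\<And>t. t \<ge> 0 \<Longrightarrow>
      (\<lambda>n. \<P>(\<omega> in chain_noise UNIV (R n). pr (chain_path UNIV (R n) x \<omega> (t * \<theta> n)) = i))
        \<longlonglongrightarrow> \<P>(\<omega> in chain_noise J r. chain_path J r j \<omega> t = i)"
  shows "(\<lambda>n. \<Sum>y | pr y = i. finite_chain.occ UNIV (R n) (l / \<theta> n) x y) \<longlonglongrightarrow> finite_chain.occ J r l j i"
proof -
  let ?E = "density lborel (exponential_density l)"
  interpret E: prob_space ?E by (rule prob_space_exponential_density) fact
  interpret r: finite_chain J r by fact
  let ?P = "\<lambda>n t. \<P>(\<omega> in chain_noise UNIV (R n). pr (chain_path UNIV (R n) x \<omega> (t * \<theta> n)) = i)"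
  have P: "(\<integral>t. ?P n t \<partial>?E) = (\<Sum>y | pr y = i. finite_chain.occ UNIV (R n) (l / \<theta> n) x y)
      \<and> ?P n \<in> borel_measurable ?E \<and> (\<forall>t. norm (?P n t) \<le> 1)"
    if n: "n \<ge> 1" for n
  proof -
    interpret c: finite_chain UNIV "R n" using R n .
    let ?Q = "\<lambda>y t. \<P>(\<omega> in chain_noise UNIV (R n). chain_path UNIV (R n) x \<omega> (t * \<theta> n) = y)"
    have Q [measurable]: "?Q y \<in> borel_measurable borel" for y
      using measurable_compose[OF _ c.measurable_prob_path, of "\<lambda>t. t * \<theta> n" borel x y] by simp
    have eq: "?P n t = (\<Sum>y | pr y = i. ?Q y t)" for t
    proof -
      have "{\<omega>\<in>space (chain_noise UNIV (R n)). pr (chain_path UNIV (R n) x \<omega> (t * \<theta> n)) = i}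
        = (\<Union>y\<in>{y. pr y = i}. {\<omega>\<in>space (chain_noise UNIV (R n)). chain_path UNIV (R n) x \<omega> (t * \<theta> n) = y})"
        by auto
      then show ?thesis
        by (simp only:) (rule c.noise.finite_measure_finite_Union, auto simp: disjoint_family_on_def)
    qed
    have "integrable ?E (?Q y)" for y
      by (rule E.integrable_const_bound[where B = 1]) auto
    then have "(\<integral>t. ?P n t \<partial>?E) = (\<Sum>y | pr y = i. finite_chain.occ UNIV (R n) (l / \<theta> n) x y)"
      unfolding eq using \<theta>[OF n] l by (simp add: c.occ_scale)
    moreover have "?P n \<in> borel_measurable ?E"
      unfolding eq by measurable
    ultimately show ?thesis by auto
  qed
  \<comment> \<open>The shift drops the index 0, at which \<open>R\<close> and
    \<open>\<theta>\<close> are unconstrained.\<close>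
  have "(\<lambda>n. \<integral>t. ?P (Suc n) t \<partial>?E) \<longlonglongrightarrow> (\<integral>t. \<P>(\<omega> in chain_noise J r. chain_path J r j \<omega> t = i) \<partial>?E)"
  proof (rule integral_dominated_convergence[where w = "\<lambda>_. 1"])
    have "AE t in ?E. 0 \<le> t"
      by (subst AE_density) (auto simp: exponential_density_def)
    then show "AE t in ?E. (\<lambda>n. ?P (Suc n) t) \<longlonglongrightarrow> \<P>(\<omega> in chain_noise J r. chain_path J r j \<omega> t = i)"
      by eventually_elim (use lim in \<open>auto intro: LIMSEQ_Suc\<close>)
  qed (use P in \<open>auto intro: E.integrable_const\<close>)
  then have "(\<lambda>n. \<Sum>y | pr y = i. finite_chain.occ UNIV (R (Suc n)) (l / \<theta> (Suc n)) x y)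
      \<longlonglongrightarrow> finite_chain.occ J r l j i"
    using P by (simp add: r.occ_def)
  then show ?thesis by (rule LIMSEQ_imp_Suc)
qed

text \<open>The right-hand side depends on a state through its label only, so \<open>G\<close>
  averages it over the law of the projected process at an exponential time, and these laws converge.
  The limit solves the resolvent equation of the limit chain that \<open>u\<close> solves, and
  solutions are unique.\<close>

lemma resolvent_tendsto:
  fixes R :: "nat \<Rightarrow> 'v::finite \<Rightarrow> 'v \<Rightarrow> real" and r :: "nat \<Rightarrow> nat \<Rightarrow> real"
    and pr :: "'v \<Rightarrow> nat" and u :: "nat \<Rightarrow> real"
  assumes R: "\<And>n. n \<ge> 1 \<Longrightarrow> finite_chain UNIV (R n)"
    and r: "finite_chain J r" and l: "0 < l" and \<theta>: "\<And>n. n \<ge> 1 \<Longrightarrow> 0 < \<theta> n"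
    and J: "J \<subseteq> range pr"
    and lim: "\<And>t x i. t \<ge> 0 \<Longrightarrow> pr x \<in> J \<Longrightarrow>
      (\<lambda>n. \<P>(\<omega> in chain_noise UNIV (R n). pr (chain_path UNIV (R n) x \<omega> (t * \<theta> n)) = i))
        \<longlonglongrightarrow> \<P>(\<omega> in chain_noise J r. chain_path J r (pr x) \<omega> t = i)"
  obtains G where
    "\<And>n x. n \<ge> 1 \<Longrightarrow> l * G n x - \<theta> n * generator UNIV (R n) (G n) x
        = (if pr x \<in> J then l * u (pr x) - generator J r u (pr x) else c)"
    "\<And>x. pr x \<in> J \<Longrightarrow> (\<lambda>n. G n x) \<longlonglongrightarrow> u (pr x)"
proof
  interpret r: finite_chain J r by fact
  define g where "g j = (if j \<in> J then l * u j - generator J r u j else c)" for j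
  define G where "G n x = (\<Sum>y\<in>UNIV. g (pr y) / l * finite_chain.occ UNIV (R n) (l / \<theta> n) x y)" for n x
  show "l * G n x - \<theta> n * generator UNIV (R n) (G n) x
        = (if pr x \<in> J then l * u (pr x) - generator J r u (pr x) else c)" if "n \<ge> 1" for n x
    using finite_chain.resolvent_occ[OF R[OF that] \<theta>[OF that] l, of x "\<lambda>y. g (pr y)"]
    unfolding G_def g_def by simp
  show "(\<lambda>n. G n x) \<longlonglongrightarrow> u (pr x)" if x: "pr x \<in> J" for x
  proof -
    have "G n x = (\<Sum>i\<in>range pr. g i / l * (\<Sum>y | pr y = i. finite_chain.occ UNIV (R n) (l / \<theta> n) x y))" for n
      unfolding G_def sum_distrib_left
      by (subst sum.image_gen[of UNIV _ pr]) (auto intro!: sum.cong)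
    moreover have "(\<lambda>n. \<Sum>i\<in>range pr. g i / l * (\<Sum>y | pr y = i. finite_chain.occ UNIV (R n) (l / \<theta> n) x y))
        \<longlonglongrightarrow> (\<Sum>i\<in>range pr. g i / l * r.occ l (pr x) i)"
      by (intro tendsto_intros occ_tendsto[OF R r l \<theta>] lim x)
    \<comment> \<open>The limit chain never leaves \<open>J\<close>, so the labels outside
      \<open>J\<close> drop out in the limit; this is what leaves the constant \<open>c\<close>
      free.\<close>
    moreover have "(\<Sum>i\<in>range pr. g i / l * r.occ l (pr x) i) = (\<Sum>i\<in>J. g i / l * r.occ l (pr x) i)"
      using J x by (intro sum.mono_neutral_right) (auto simp: r.occ_outside)
    moreover have "(\<Sum>i\<in>J. g i / l * r.occ l (pr x) i) = u (pr x)"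
      using r.resolvent_occ[of 1 l _ g] l x
      by (intro r.resolvent_unique[OF l _ x, where F = "\<lambda>j. \<Sum>i\<in>J. g i / l * r.occ l j i"]) (simp add: g_def)
    ultimately show ?thesis by simp
  qed
qed

section \<open>Donsker-Varadhan functionals of finite chains\<close>

text \<open>The expression under the supremum in \<open>ld_functional\<close> at \<open>H = h\<close>.\<close>

definition ld_at :: "'a set \<Rightarrow> ('a \<Rightarrow> 'a \<Rightarrow> real) \<Rightarrow> ('a \<Rightarrow> real) \<Rightarrow> ('a \<Rightarrow> real) \<Rightarrow> real" where
  "ld_at S R m h = (\<Sum>x\<in>S. m x * (\<Sum>y\<in>S. R x y * (1 - exp (h y - h x))))"

text \<open>Stationarity of \<open>m\<close> under the rates \<open>K\<close>. The diagonal terms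
  occur on both sides and cancel; \<open>m\<close> may be any real function, so that differences of
  stationary measures are covered.\<close>

definition balanced :: "'a set \<Rightarrow> ('a \<Rightarrow> 'a \<Rightarrow> real) \<Rightarrow> ('a \<Rightarrow> real) \<Rightarrow> bool" where
  "balanced S K m \<longleftrightarrow> (\<forall>y\<in>S. (\<Sum>x\<in>S. m x * K x y) = m y * (\<Sum>x\<in>S. K y x))"

text \<open>With \<open>K x y = m x * R x y\<close> this is the part of \<open>ld_at\<close> that
  depends on \<open>h\<close>, up to its sign: maximising \<open>ld_at\<close> means minimising this
  convex function.\<close>

definition energy :: "'a set \<Rightarrow> ('a \<Rightarrow> 'a \<Rightarrow> real) \<Rightarrow> ('a \<Rightarrow> real) \<Rightarrow> real" where
  "energy S K h = (\<Sum>x\<in>S. \<Sum>y\<in>S. K x y * exp (h y - h x))"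

definition communicates :: "'a set \<Rightarrow> ('a \<Rightarrow> 'a \<Rightarrow> real) \<Rightarrow> 'a \<Rightarrow> 'a \<Rightarrow> bool" where
  "communicates S R x y \<longleftrightarrow> (x, y) \<in> (rate_graph S R)\<^sup>* \<and> (y, x) \<in> (rate_graph S R)\<^sup>*"

text \<open>
  The limit of \<open>ld_at\<close> along \<open>h + M \<rho>\<close> as \<open>M\<close> tends to infinity, where \<open>\<rho>\<close> decreases strictly along the jumps
  between distinct communicating classes.
\<close>

definition ld_comm :: "'a set \<Rightarrow> ('a \<Rightarrow> 'a \<Rightarrow> real) \<Rightarrow> ('a \<Rightarrow> real) \<Rightarrow> ('a \<Rightarrow> real) \<Rightarrow> real" where
  "ld_comm S R m h =
     (\<Sum>x\<in>S. m x * (\<Sum>y\<in>S. R x y * (1 - (if communicates S R x y then exp (h y - h x) else 0))))"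

lemma ld_functional_eq_SUP: "ld_functional S R \<mu> = (SUP h. ereal (ld_at S R (pmf \<mu>) h))"
proof -
  have "- (\<Sum>x\<in>S. pmf \<mu> x * (exp (- h x) * generator S R (\<lambda>y. exp (h y)) x)) = ld_at S R (pmf \<mu>) h" for h
    unfolding ld_at_def generator_def sum_negf [symmetric]
    by (intro sum.cong refl)
       (simp add: sum_distrib_left sum_negf [symmetric], intro sum.cong refl,
        simp add: exp_diff exp_minus field_simps)
  then show ?thesis unfolding ld_functional_def by simp
qed

lemma ld_at_le_ld_functional: "ereal (ld_at S R (pmf \<mu>) h) \<le> ld_functional S R \<mu>"
  unfolding ld_functional_eq_SUP by (rule SUP_upper) simp

lemma ld_functional_le_iff: "ld_functional S R \<mu> \<le> ereal c \<longleftrightarrow> (\<forall>h. ld_at S R (pmf \<mu>) h \<le> c)"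
  unfolding ld_functional_eq_SUP by (auto simp: SUP_le_iff)

lemma ld_functional_nonneg: "0 \<le> ld_functional S R \<mu>"
  using ld_at_le_ld_functional[of S R \<mu> "\<lambda>_. 0"] by (simp add: ld_at_def zero_ereal_def)

lemma ld_at_eq_energy: "ld_at S R m h = (\<Sum>x\<in>S. \<Sum>y\<in>S. m x * R x y) - energy S (\<lambda>x y. m x * R x y) h"
  unfolding ld_at_def energy_def by (simp add: sum_distrib_left sum_subtractf right_diff_distrib mult.assoc)

text \<open>
  The flow \<open>m x * R x y * G y / G x\<close> has zero divergence, so that its pairing with the gradient of
  \<open>h - ln G\<close> vanishes; the rest is \<open>1 + t \<le> exp t\<close>.
\<close>

lemma ld_at_transform_le:
  assumes "finite S" "A \<subseteq> S"
    and R: "\<And>x y. x \<in> S \<Longrightarrow> y \<in> S \<Longrightarrow> x \<noteq> y \<Longrightarrow> 0 \<le> R x y"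
    and G: "\<And>x. x \<in> A \<Longrightarrow> 0 < G x" "\<And>x. x \<in> S - A \<Longrightarrow> G x \<le> 0"
    and m: "\<And>x. x \<in> A \<Longrightarrow> 0 \<le> m x" "\<And>x. x \<in> S - A \<Longrightarrow> m x = 0"
    and bal: "balanced A (\<lambda>x y. R x y * G y / G x) m"
  shows "ld_at S R m h \<le> (\<Sum>x\<in>A. m x * (- generator S R G x / G x))"
proof -
  have finA: "finite A" using finite_subset[OF assms(2,1)] .
  define Q where "Q x y = m x * (R x y * G y / G x)" for x y
  define k where "k x = h x - ln (G x)" for x
  have gen: "- generator S R G x / G x = (\<Sum>y\<in>S. R x y * (1 - G y / G x))" if "x \<in> A" for x
    unfolding generator_def sum_negf [symmetric] sum_divide_distrib
    using G(1)[OF that] by (intro sum.cong) (auto simp: field_simps)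
  have ld_at: "ld_at S R m h = (\<Sum>x\<in>A. m x * (\<Sum>y\<in>S. R x y * (1 - exp (h y - h x))))"
    unfolding ld_at_def using assms by (intro sum.mono_neutral_right) auto
  have tm: "m x * (R x y * (1 - exp (h y - h x)))
      \<le> m x * (R x y * (1 - G y / G x)) + (if y \<in> A then Q x y * k x - Q x y * k y else 0)"
    if x: "x \<in> A" and y: "y \<in> S" for x y
  proof (cases "y = x")
    case True
    then show ?thesis using G(1)[OF x] by simp
  next
    case False
    then have mR: "0 \<le> m x * R x y" using R[of x y] m(1)[OF x] x y \<open>A \<subseteq> S\<close> by auto
    show ?thesis
    proof (cases "y \<in> A")
      case True
      have pos: "0 < G y / G x" using G True x by simp
      have "exp (k y - k x) = exp (h y - h x) * (G x / G y)"
        using G(1)[OF x] G(1)[OF True] by (simp add: k_def exp_diff exp_add field_simps)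
      then have "exp (h y - h x) = G y / G x * exp (k y - k x)"
        using G(1)[OF x] G(1)[OF True] by (simp add: field_simps)
      also have "\<dots> \<ge> G y / G x * (1 + (k y - k x))"
        using pos by (intro mult_left_mono exp_ge_add_one_self) auto
      finally have "m x * R x y * (G y / G x * (1 + (k y - k x))) \<le> m x * R x y * exp (h y - h x)"
        using mR by (rule mult_left_mono)
      note le = this
      have Q: "Q x y = m x * R x y * (G y / G x)" by (simp add: Q_def)
      have "a * (1 - e) \<le> a * (1 - q) + (a * q * k x - a * q * k y)"
        if "a * (q * (1 + (k y - k x))) \<le> a * e" for a q e :: real
        using that by (simp add: algebra_simps)
      from this[OF le] show ?thesis using True by (simp only: Q if_True mult.assoc)
    next
      case False
      \<comment> \<open>A jump out of \<open>A\<close> needs no flow term: the left-hand factor is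
        below 1, and \<open>1 - G y / G x\<close> is at least 1.\<close>
      then have "G y / G x \<le> 0" using G y x by (simp add: divide_le_0_iff less_imp_le)
      then have "1 - exp (h y - h x) \<le> 1 - G y / G x"
        using exp_gt_zero[of "h y - h x"] by linarith
      then have "m x * R x y * (1 - exp (h y - h x)) \<le> m x * R x y * (1 - G y / G x)"
        using mR by (rule mult_left_mono)
      then show ?thesis using False by (simp add: mult.assoc)
    qed
  qed
  have "ld_at S R m h \<le> (\<Sum>x\<in>A. \<Sum>y\<in>S. m x * (R x y * (1 - G y / G x)) + (if y \<in> A then Q x y * k x - Q x y * k y else 0))"
    unfolding ld_at sum_distrib_left by (intro sum_mono tm)
  also have "\<dots> = (\<Sum>x\<in>A. m x * (- generator S R G x / G x)) + (\<Sum>x\<in>A. \<Sum>y\<in>A. Q x y * k x - Q x y * k y)"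
  proof -
    have "(\<Sum>y\<in>S. if y \<in> A then Q x y * k x - Q x y * k y else 0) = (\<Sum>y\<in>A. Q x y * k x - Q x y * k y)" for x
      using assms by (simp add: sum.If_cases Int_absorb1)
    moreover have "(\<Sum>x\<in>A. m x * (- generator S R G x / G x)) = (\<Sum>x\<in>A. \<Sum>y\<in>S. m x * (R x y * (1 - G y / G x)))"
      by (intro sum.cong refl) (simp only: gen sum_distrib_left)
    ultimately show ?thesis by (simp only: sum.distrib)
  qed
  also have "(\<Sum>x\<in>A. \<Sum>y\<in>A. Q x y * k x - Q x y * k y)
      = (\<Sum>x\<in>A. k x * (\<Sum>y\<in>A. Q x y)) - (\<Sum>y\<in>A. k y * (\<Sum>x\<in>A. Q x y))"
    by (simp add: sum_subtractf sum_distrib_left mult.commute) (rule sum.swap)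
  also have "\<dots> = 0"
    using bal by (simp add: balanced_def Q_def sum_distrib_left)
  finally show ?thesis by simp
qed

text \<open>The induction eliminates a state by passing to the trace of the chain on the remaining ones.\<close>

lemma exists_balanced:
  assumes "finite A" "A \<noteq> {}" "\<And>x y. x \<in> A \<Longrightarrow> y \<in> A \<Longrightarrow> x \<noteq> y \<Longrightarrow> 0 \<le> Q x y"
  shows "\<exists>m. (\<forall>x\<in>A. 0 \<le> m x) \<and> sum m A = 1 \<and> balanced A Q (m :: 'a \<Rightarrow> real)"
  using assms
proof (induction A arbitrary: Q rule: finite_ne_induct)
  case (singleton x)
  then show ?case by (intro exI[of _ "\<lambda>_. 1"]) (simp add: balanced_def)
next
  case (insert z F)
  define L where "L = (\<Sum>x\<in>F. Q z x)"
  have Qnn: "0 \<le> Q z x" "0 \<le> Q x z" if "x \<in> F" for x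
    using insert that by auto
  have Lnn: "0 \<le> L" unfolding L_def by (intro sum_nonneg Qnn)
  show ?case
  proof (cases "L = 0")
    case True
    \<comment> \<open>Without exits from \<open>z\<close> the point mass at \<open>z\<close> is
      balanced.\<close>
    then have 0: "Q z x = 0" if "x \<in> F" for x
      unfolding L_def using insert.hyps that Qnn by (subst (asm) sum_nonneg_eq_0_iff) auto
    have "(\<Sum>x\<in>F. if x = z then 1 else 0) = (0 :: real)" "(\<Sum>x\<in>F. (if x = z then 1 else 0) * Q x y) = 0" for y
      using insert.hyps by (auto intro!: sum.neutral split: if_splits)
    moreover have "(\<Sum>x\<in>F. Q z x) = 0" using 0 by simp
    ultimately show ?thesis using insert.hyps 0
      by (intro exI[of _ "\<lambda>x. if x = z then 1 else 0"]) (auto simp: balanced_def)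
  next
    case False
    with Lnn have L: "0 < L" by simp
    \<comment> \<open>From \<open>x\<close> to \<open>y\<close> directly, or through
      \<open>z\<close>, whose next state is \<open>y\<close> with probability
      \<open>Q z y / L\<close>.\<close>
    define Q' where "Q' x y = Q x y + Q x z * Q z y / L" for x y
    have "\<exists>m. (\<forall>x\<in>F. 0 \<le> m x) \<and> sum m F = 1 \<and> balanced F Q' m"
      by (rule insert.IH) (use insert.prems Qnn L in \<open>auto simp: Q'_def intro!: add_nonneg_nonneg\<close>)
    then obtain m where m: "\<forall>x\<in>F. 0 \<le> m x" "sum m F = 1" "balanced F Q' m" by blast
    \<comment> \<open>The mass at \<open>z\<close> for which the outflow \<open>mz * L\<close>
      equals the inflow from \<open>F\<close>; dividing by \<open>1 + mz\<close> then restores total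
      mass 1.\<close>
    define mz where "mz = (\<Sum>x\<in>F. m x * Q x z) / L"
    have mz: "0 \<le> mz" unfolding mz_def using m Qnn L by (auto intro!: divide_nonneg_pos sum_nonneg)
    define m' where "m' x = (if x = z then mz else m x) / (1 + mz)" for x
    have F: "(\<Sum>x\<in>F. m' x * Q x y) = (\<Sum>x\<in>F. m x * Q x y) / (1 + mz)" for y
      unfolding m'_def sum_divide_distrib using insert.hyps by (intro sum.cong) auto
    have "sum m' (insert z F) = 1"
    proof -
      have "sum m' F = sum m F / (1 + mz)"
        unfolding m'_def sum_divide_distrib using insert.hyps by (intro sum.cong) auto
      then show ?thesis using insert.hyps m mz by (simp add: m'_def add_divide_distrib [symmetric])
    qed
    moreover have "balanced (insert z F) Q m'"
      unfolding balanced_def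
    proof
      fix y assume "y \<in> insert z F"
      then consider "y = z" | "y \<in> F" "y \<noteq> z" using insert.hyps by blast
      then show "(\<Sum>x\<in>insert z F. m' x * Q x y) = m' y * (\<Sum>x\<in>insert z F. Q y x)"
      proof cases
        case 1
        have "(\<Sum>x\<in>F. m x * Q x z) = mz * L" using L by (simp add: mz_def)
        then show ?thesis using 1 insert.hyps unfolding sum.insert[OF insert.hyps(1,3)] F
          by (simp add: m'_def L_def [symmetric] field_simps add_divide_distrib)
      next
        case 2
        have "(\<Sum>x\<in>F. m x * Q' x y) = (\<Sum>x\<in>F. m x * Q x y) + mz * Q z y"
          unfolding Q'_def mz_def
          by (simp add: distrib_left sum.distrib sum_distrib_right sum_divide_distrib mult.assoc)
        moreover have "(\<Sum>x\<in>F. Q' y x) = (\<Sum>x\<in>F. Q y x) + Q y z"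
        proof -
          have "(\<Sum>x\<in>F. Q y z * Q z x / L) = Q y z * L / L"
            by (simp add: L_def sum_divide_distrib sum_distrib_left)
          then show ?thesis using L by (simp add: Q'_def sum.distrib)
        qed
        ultimately have "(\<Sum>x\<in>F. m x * Q x y) + mz * Q z y = m y * ((\<Sum>x\<in>F. Q y x) + Q y z)"
          using m(3) 2 by (simp add: balanced_def)
        then show ?thesis using 2 unfolding sum.insert[OF insert.hyps(1,3)] F
          by (simp add: m'_def add_divide_distrib [symmetric] algebra_simps)
      qed
    qed
    moreover have "\<forall>x\<in>insert z F. 0 \<le> m' x" using m mz by (auto simp: m'_def)
    ultimately show ?thesis by blast
  qed
qed

section \<open>Balanced measures and energy minimisers\<close>

lemma balanced_scale_sub:
  "balanced D K m \<Longrightarrow> balanced D K m' \<Longrightarrow> balanced D K (\<lambda>x. m' x - c * m x)"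
  by (simp add: balanced_def left_diff_distrib sum_subtractf mult.assoc sum_distrib_left [symmetric])

text \<open>The outflow of \<open>y\<close> is 0, hence so is its inflow, whose terms are
  nonnegative. Zeros of \<open>d\<close> thus spread backwards along the edges.\<close>

lemma balanced_zero_back:
  assumes "finite D" "balanced D K d"
    and K: "\<And>x y. x \<in> D \<Longrightarrow> y \<in> D \<Longrightarrow> x \<noteq> y \<Longrightarrow> 0 \<le> K x y"
    and d: "\<And>x. x \<in> D \<Longrightarrow> 0 \<le> d x"
    and e: "(x, y) \<in> rate_graph D K" "d y = 0"
  shows "d x = 0"
proof -
  have xy: "x \<in> D" "y \<in> D" "x \<noteq> y" "K x y > 0" using e by (auto simp: rate_graph_def)
  have "(\<Sum>x\<in>D. d x * K x y) = 0" using assms xy by (simp add: balanced_def)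
  moreover have "0 \<le> d x * K x y" if "x \<in> D" for x
    using that e xy d[of x] K[of x y] by (cases "x = y") auto
  ultimately have "\<forall>x\<in>D. d x * K x y = 0"
    using \<open>finite D\<close> by (subst (asm) sum_nonneg_eq_0_iff) auto
  then show ?thesis using xy by auto
qed

text \<open>Subtracting from \<open>m'\<close> the largest multiple of \<open>m\<close> that stays
  below it leaves a nonnegative balanced function with a zero, and the zero spreads over the
  connected set \<open>D\<close>.\<close>

lemma balanced_proportional:
  assumes "finite D" "balanced D K m" "balanced D K m'"
    and K: "\<And>x y. x \<in> D \<Longrightarrow> y \<in> D \<Longrightarrow> x \<noteq> y \<Longrightarrow> 0 \<le> K x y"
    and conn: "\<And>x y. x \<in> D \<Longrightarrow> y \<in> D \<Longrightarrow> (x, y) \<in> (rate_graph D K)\<^sup>*"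
    and m: "\<And>x. x \<in> D \<Longrightarrow> 0 < m x"
    and sum: "sum m D = 1" and x: "x \<in> D"
  shows "m' x = sum m' D * m x"
proof -
  define x0 where "x0 = arg_min_on (\<lambda>x. m' x / m x) D"
  have x0: "x0 \<in> D" "\<And>y. y \<in> D \<Longrightarrow> m' x0 / m x0 \<le> m' y / m y"
    using \<open>finite D\<close> x unfolding x0_def by (auto intro: arg_min_least arg_min_if_finite)
  define c where "c = m' x0 / m x0"
  define d where "d x = m' x - c * m x" for x
  have bal: "balanced D K d" unfolding d_def using assms by (intro balanced_scale_sub)
  have d: "0 \<le> d y" if "y \<in> D" for y
    using x0(2)[OF that] m[OF that] by (simp add: d_def c_def [symmetric] pos_le_divide_eq)
  have d0: "d x0 = 0" using m[OF x0(1)] by (simp add: d_def c_def)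
  have all0: "d y = 0" if "y \<in> D" for y
    using conn[OF that x0(1)]
  proof (induction rule: converse_rtrancl_induct)
    case base then show ?case using d0 .
  next
    case (step a b)
    then show ?case using balanced_zero_back[OF \<open>finite D\<close> bal K d] by blast
  qed
  then have eq: "m' y = c * m y" if "y \<in> D" for y using that by (simp add: d_def)
  then have "sum m' D = c" using sum by (simp add: sum_distrib_left [symmetric])
  then show ?thesis using eq x by simp
qed

lemma deriv_exp_min:
  fixes a b :: real
  assumes "\<And>s. a + b \<le> a * exp s + b * exp (- s)"
  shows "a = b"
proof -
  have "((\<lambda>s. a * exp s + b * exp (- s)) has_real_derivative (a - b)) (at 0)"
    by (auto intro!: derivative_eq_intros)
  from DERIV_local_min[OF this, of 1] assms show ?thesis by simp
qed

text \<open>The Euler-Lagrange equation: shifting \<open>h\<close> by \<open>s\<close> at the single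
  site \<open>y\<close> multiplies the inflow of \<open>y\<close> by \<open>exp s\<close> and its
  outflow by \<open>exp (- s)\<close>.\<close>

lemma energy_minimiser_balanced:
  assumes "finite S" and min: "\<And>h'. energy S K h \<le> energy S K h'" and y: "y \<in> S"
  shows "(\<Sum>x\<in>S. K x y * exp (h y - h x)) = (\<Sum>x\<in>S. K y x * exp (h x - h y))"
proof -
  let ?T = "S - {y}"
  define a where "a = (\<Sum>x\<in>?T. K x y * exp (h y - h x))"
  define b where "b = (\<Sum>x\<in>?T. K y x * exp (h x - h y))"
  define c where "c = K y y + (\<Sum>x\<in>?T. \<Sum>z\<in>?T. K x z * exp (h z - h x))"
  have split: "energy S K f = K y y + (\<Sum>z\<in>?T. K y z * exp (f z - f y))
     + ((\<Sum>x\<in>?T. K x y * exp (f y - f x)) + (\<Sum>x\<in>?T. \<Sum>z\<in>?T. K x z * exp (f z - f x)))" for f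
    unfolding energy_def using assms by (simp add: sum.remove[of S y] sum.distrib)
  have "energy S K (h(y := h y + s)) = c + a * exp s + b * exp (- s)" for s
    unfolding split a_def b_def c_def sum_distrib_right
    by (simp add: exp_add exp_diff exp_minus field_simps)
  moreover have "energy S K h = c + a + b"
    unfolding split a_def b_def c_def by simp
  ultimately have "a + b \<le> a * exp s + b * exp (- s)" for s
    using min[of "h(y := h y + s)"] by (simp add: algebra_simps)
  then have "a = b" by (rule deriv_exp_min)
  then show ?thesis using assms by (simp add: a_def b_def sum.remove[of S y])
qed

lemma stationary_state_iff_balanced:
  assumes "finite S"
  shows "stationary_state S R \<mu> \<longleftrightarrow> set_pmf \<mu> \<subseteq> S \<and> balanced S R (pmf \<mu>)"
  unfolding stationary_state_def balanced_def holding_rate_def using assms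
  by (intro conj_cong ball_cong refl) (simp add: sum.remove[of S] distrib_left)

text \<open>If the supremum is at most 0, it is attained at the zero function, where the
  Euler-Lagrange equation is stationarity. By contraposition, weights that are not stationary have a
  strictly positive cost, which the next time scale blows up.\<close>

lemma stationary_if_ld_functional_le_0:
  assumes "finite S" "set_pmf \<mu> \<subseteq> S" "ld_functional S R \<mu> \<le> 0"
  shows "stationary_state S R \<mu>"
proof -
  have "ld_at S R (pmf \<mu>) h \<le> 0" for h
    using assms(3) ld_functional_le_iff[of S R \<mu> 0] by (simp add: zero_ereal_def)
  moreover have "ld_at S R (pmf \<mu>) (\<lambda>_. 0) = 0" by (simp add: ld_at_def)
  ultimately have "energy S (\<lambda>x y. pmf \<mu> x * R x y) (\<lambda>_. 0) \<le> energy S (\<lambda>x y. pmf \<mu> x * R x y) h" for h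
    unfolding ld_at_eq_energy by (smt (verit))
  from energy_minimiser_balanced[OF \<open>finite S\<close> this] show ?thesis
    unfolding stationary_state_iff_balanced[OF \<open>finite S\<close>] balanced_def
    using assms by (simp add: sum_distrib_left)
qed

lemma energy_shift: "energy S K (\<lambda>x. h x - c) = energy S K h"
  by (simp add: energy_def)

lemma finite_bounded_subseq:
  fixes f :: "nat \<Rightarrow> 'a \<Rightarrow> real"
  assumes "finite S" "\<And>x n. x \<in> S \<Longrightarrow> \<bar>f n x\<bar> \<le> B x"
  shows "\<exists>s l. strict_mono s \<and> (\<forall>x\<in>S. (\<lambda>n. f (s n) x) \<longlonglongrightarrow> l x)"
  using assms
proof (induction S rule: finite_induct)
  case empty
  then show ?case by (auto intro: strict_mono_id)
next
  case (insert x F)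
  then obtain s l where s: "strict_mono s" "\<forall>x\<in>F. (\<lambda>n. f (s n) x) \<longlonglongrightarrow> l x"
    by blast
  have "f (s n) x \<in> {- B x..B x}" for n
    using insert.prems[of x "s n"] by (auto simp: abs_le_iff)
  then obtain l' t where t: "strict_mono t" "((\<lambda>n. f (s n) x) \<circ> t) \<longlonglongrightarrow> l'"
    using seq_compactE[OF compact_imp_seq_compact[OF compact_Icc, of "- B x" "B x"], of "\<lambda>n. f (s n) x"]
    by metis
  have "(\<lambda>n. f ((s \<circ> t) n) y) \<longlonglongrightarrow> (l(x := l')) y" if "y \<in> insert x F" for y
  proof (cases "y = x")
    case True
    then show ?thesis using t by (simp add: o_def)
  next
    case False
    then have "(\<lambda>n. f (s n) y) \<longlonglongrightarrow> l y" using that s by blast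
    from LIMSEQ_subseq_LIMSEQ[OF this t(1)] False show ?thesis by (simp add: o_def)
  qed
  moreover have "strict_mono (s \<circ> t)" using s t by (intro strict_mono_o)
  ultimately show ?case by blast
qed

text \<open>Coercivity up to additive constants: on a sublevel set each edge of positive weight
  bounds the increment of \<open>h\<close> along it, and connectedness chains these bounds. As
  constants do not change the energy, a minimising sequence can be pinned at
  \<open>x0\<close>.\<close>

lemma exists_energy_minimiser:
  fixes K :: "'a \<Rightarrow> 'a \<Rightarrow> real"
  assumes fin: "finite S" and K: "\<And>x y. x \<in> S \<Longrightarrow> y \<in> S \<Longrightarrow> 0 \<le> K x y"
    and conn: "\<And>x y. x \<in> S \<Longrightarrow> y \<in> S \<Longrightarrow> (x, y) \<in> (rate_graph S K)\<^sup>*"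
  shows "\<exists>h. \<forall>h'. energy S K h \<le> energy S K h'"
proof (cases "S = {}")
  case True
  then show ?thesis by (simp add: energy_def)
next
  case False
  then obtain x0 where x0: "x0 \<in> S" by blast
  define I where "I = Inf (range (energy S K))"
  have nn: "0 \<le> energy S K h" for h unfolding energy_def by (intro sum_nonneg mult_nonneg_nonneg K) auto
  have I: "I \<le> energy S K h" for h
    unfolding I_def by (rule cInf_lower) (auto intro!: bdd_belowI2[where m = 0] nn)
  have step: "\<exists>B. \<forall>h. energy S K h \<le> I + 1 \<longrightarrow> h y - h x \<le> B"
    if "(x, y) \<in> (rate_graph S K)\<^sup>*" for x y
    using that
  proof (induction rule: rtrancl_induct)
    case base
    show ?case by (auto intro!: exI[of _ 0])
  next
    case (step y z)
    then obtain B where B: "\<And>h. energy S K h \<le> I + 1 \<Longrightarrow> h y - h x \<le> B" by blast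
    have yz: "y \<in> S" "z \<in> S" "0 < K y z" using step by (auto simp: rate_graph_def)
    have "h z - h x \<le> B + (I + 1) / K y z" if h: "energy S K h \<le> I + 1" for h
    proof -
      have "K y z * exp (h z - h y) \<le> (\<Sum>z\<in>S. K y z * exp (h z - h y))"
        by (rule member_le_sum) (use fin yz K in auto)
      also have "\<dots> \<le> energy S K h"
        unfolding energy_def
        by (rule member_le_sum[where f = "\<lambda>y. \<Sum>z\<in>S. K y z * exp (h z - h y)"])
           (use fin yz K in \<open>auto intro!: sum_nonneg\<close>)
      finally have "exp (h z - h y) \<le> (I + 1) / K y z"
        using h yz by (simp add: pos_le_divide_eq mult.commute)
      with exp_ge_add_one_self[of "h z - h y"] B[OF h] show ?thesis by linarith
    qed
    then show ?case by blast
  qed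
  then have "\<forall>x y. \<exists>B. x \<in> S \<longrightarrow> y \<in> S \<longrightarrow> (\<forall>h. energy S K h \<le> I + 1 \<longrightarrow> h y - h x \<le> B)"
    using conn by blast
  then obtain B where B: "\<And>x y h. x \<in> S \<Longrightarrow> y \<in> S \<Longrightarrow> energy S K h \<le> I + 1 \<Longrightarrow> h y - h x \<le> B x y"
    by metis
  have "\<exists>h. energy S K h < I + 1 / real (Suc n)" for n
  proof -
    have "Inf (range (energy S K)) < I + 1 / real (Suc n)" by (simp add: I_def)
    from cInf_lessD[OF _ this] show ?thesis by auto
  qed
  then obtain h where h: "\<And>n. energy S K (h n) < I + 1 / real (Suc n)" by metis
  define f where "f n x = h n x - h n x0" for n x
  have f: "energy S K (f n) < I + 1 / real (Suc n)" for n
    using h[of n] unfolding f_def energy_shift .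
  have f1: "energy S K (f n) \<le> I + 1" for n
    by (rule order_trans[OF less_imp_le[OF f[of n]]]) simp
  have "\<bar>f n x\<bar> \<le> \<bar>B x0 x\<bar> + \<bar>B x x0\<bar>" if "x \<in> S" for n x
    using B[OF x0 that f1, of n] B[OF that x0 f1, of n] by (simp add: f_def)
  then have "\<exists>s l. strict_mono s \<and> (\<forall>x\<in>S. (\<lambda>n. f (s n) x) \<longlonglongrightarrow> l x)"
    by (rule finite_bounded_subseq[OF fin, of f "\<lambda>x. \<bar>B x0 x\<bar> + \<bar>B x x0\<bar>"])
  then
  obtain s l where "strict_mono s \<and> (\<forall>x\<in>S. (\<lambda>n. f (s n) x) \<longlonglongrightarrow> l x)" by blast
  then have s: "strict_mono s" "\<And>x. x \<in> S \<Longrightarrow> (\<lambda>n. f (s n) x) \<longlonglongrightarrow> l x" by simp_all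
  have "(\<lambda>n. energy S K (f (s n))) \<longlonglongrightarrow> energy S K l"
    unfolding energy_def by (intro tendsto_intros s) 
  moreover have "(\<lambda>n. I + 1 / real (Suc (s n))) \<longlonglongrightarrow> I + 0"
    using LIMSEQ_subseq_LIMSEQ[OF lim_inverse_n'[THEN LIMSEQ_Suc] s(1)]
    by (intro tendsto_intros) (simp add: o_def)
  ultimately have "energy S K l \<le> I + 0"
    by (rule LIMSEQ_le) (use f in \<open>auto intro: less_imp_le\<close>)
  then show ?thesis using I by (intro exI[of _ l]) (auto intro: order_trans)
qed

section \<open>Splitting into communicating classes\<close>

lemma communicates_refl [simp]: "communicates S R x x" by (simp add: communicates_def)
lemma communicates_sym: "communicates S R x y \<Longrightarrow> communicates S R y x" by (simp add: communicates_def)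
lemma communicates_trans: "communicates S R x y \<Longrightarrow> communicates S R y z \<Longrightarrow> communicates S R x z"
  by (auto simp: communicates_def)

lemma ld_comm_eq_energy:
  "ld_comm S R m h = (\<Sum>x\<in>S. \<Sum>y\<in>S. m x * R x y) - energy S (\<lambda>x y. if communicates S R x y then m x * R x y else 0) h"
  unfolding ld_comm_def energy_def sum_subtractf [symmetric] sum_distrib_left
  by (intro sum.cong refl) (auto simp: algebra_simps)

lemma ld_comm_le_ld_functional:
  assumes fin: "finite S" and R: "\<And>x y. x \<in> S \<Longrightarrow> y \<in> S \<Longrightarrow> x \<noteq> y \<Longrightarrow> 0 \<le> R x y"
  shows "ereal (ld_comm S R (pmf \<mu>) h) \<le> ld_functional S R \<mu>"
proof -
  let ?G = "rate_graph S R"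
  \<comment> \<open>The number of reachable states is constant on a communicating class and strictly
    smaller behind an edge that leaves it.\<close>
  define \<rho> where "\<rho> x = card {z. (x, z) \<in> ?G\<^sup>*}" for x
  have finr: "finite {z. (x, z) \<in> ?G\<^sup>*}" for x
  proof (rule finite_subset)
    show "{z. (x, z) \<in> ?G\<^sup>*} \<subseteq> insert x S"
      by (auto elim!: rtranclE simp: rate_graph_def)
  qed (use fin in simp)
  define H where "H M y = h y + real M * real (\<rho> y)" for M :: nat and y
  have "(\<lambda>M. R x y * (1 - exp (H M y - H M x)))
      \<longlonglongrightarrow> R x y * (1 - (if communicates S R x y then exp (h y - h x) else 0))"
    if xy: "x \<in> S" "y \<in> S" for x y
  proof -
    consider "x = y" | "x \<noteq> y" "R x y = 0" | "(x, y) \<in> ?G"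
      using R[OF xy] xy by (fastforce simp: rate_graph_def)
    then show ?thesis
    proof cases
      case 3
      then have sub: "{z. (y, z) \<in> ?G\<^sup>*} \<subseteq> {z. (x, z) \<in> ?G\<^sup>*}"
        by (auto intro: converse_rtrancl_into_rtrancl)
      show ?thesis
      proof (cases "communicates S R x y")
        case True
        then have "{z. (y, z) \<in> ?G\<^sup>*} = {z. (x, z) \<in> ?G\<^sup>*}"
          by (auto simp: communicates_def)
        then have "\<rho> x = \<rho> y" by (simp add: \<rho>_def)
        then show ?thesis using True by (simp add: H_def)
      next
        case False
        with 3 have "(y, x) \<notin> ?G\<^sup>*" by (auto simp: communicates_def)
        then have "{z. (y, z) \<in> ?G\<^sup>*} \<subset> {z. (x, z) \<in> ?G\<^sup>*}" using sub by auto
        then have lt: "\<rho> y < \<rho> x" unfolding \<rho>_def by (rule psubset_card_mono[OF finr])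
        let ?q = "exp (real (\<rho> y) - real (\<rho> x))"
        have "exp (H M y - H M x) = exp (h y - h x) * ?q ^ M" for M
          by (simp add: H_def exp_of_nat_mult [symmetric] exp_add [symmetric] algebra_simps)
        moreover have "(\<lambda>M. exp (h y - h x) * ?q ^ M) \<longlonglongrightarrow> exp (h y - h x) * 0"
          using lt by (intro tendsto_intros LIMSEQ_power_zero) simp
        ultimately have "(\<lambda>M. exp (H M y - H M x)) \<longlonglongrightarrow> 0" by simp
        then have "(\<lambda>M. R x y * (1 - exp (H M y - H M x))) \<longlonglongrightarrow> R x y * (1 - 0)"
          by (intro tendsto_intros)
        then show ?thesis using False by simp
      qed
    qed simp_all
  qed
  then have "(\<lambda>M. ld_at S R (pmf \<mu>) (H M)) \<longlonglongrightarrow> ld_comm S R (pmf \<mu>) h"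
    unfolding ld_at_def ld_comm_def by (intro tendsto_sum tendsto_mult_left[where c = "pmf \<mu> _"]) blast
  then have "(\<lambda>M. ereal (ld_at S R (pmf \<mu>) (H M))) \<longlonglongrightarrow> ereal (ld_comm S R (pmf \<mu>) h)"
    by simp
  then show ?thesis by (rule Lim_bounded) (use ld_at_le_ld_functional in blast)
qed

text \<open>All states on a path from \<open>x\<close> to \<open>y\<close> are reachable from
  \<open>x\<close> and lead to \<open>y\<close>, so the path stays in the class.\<close>

lemma communicates_class_connected:
  assumes "i \<in> S" and xy: "communicates S R i x" "communicates S R i y"
  defines "D \<equiv> {x\<in>S. communicates S R i x}"
  shows "(x, y) \<in> (rate_graph D R)\<^sup>*"
proof -
  have "(z, y) \<in> (rate_graph S R)\<^sup>* \<Longrightarrow> (x, z) \<in> (rate_graph D R)\<^sup>*"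
    if "(x, z) \<in> (rate_graph S R)\<^sup>*" for z
    using that
  proof (induction rule: rtrancl_induct)
    case base
    show ?case by simp
  next
    case (step z w)
    then have zy: "(z, y) \<in> (rate_graph S R)\<^sup>*" by (auto intro: converse_rtrancl_into_rtrancl)
    have "communicates S R i z" "communicates S R i w"
      using xy step zy unfolding communicates_def by (meson rtrancl_trans rtrancl.rtrancl_into_rtrancl)+
    then have "(z, w) \<in> rate_graph D R" using step(2) by (auto simp: rate_graph_def D_def)
    with step zy show ?case by (auto intro: rtrancl.rtrancl_into_rtrancl)
  qed
  moreover have "(x, y) \<in> (rate_graph S R)\<^sup>*" using xy by (auto simp: communicates_def intro: rtrancl_trans)
  ultimately show ?thesis by simp
qed

text \<open>On each class the tilt is an energy minimiser; it exists because positivity of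
  \<open>m\<close> lets the weights connect the class. Only differences of \<open>h\<close> within a
  class matter, so the minimisers can be glued.\<close>

lemma exists_tilt:
  assumes fin: "finite S" and R: "\<And>x y. x \<in> S \<Longrightarrow> y \<in> S \<Longrightarrow> x \<noteq> y \<Longrightarrow> 0 \<le> R x y"
    and m: "\<And>x. x \<in> S \<Longrightarrow> 0 < m x"
  shows "\<exists>h. \<forall>i\<in>S. balanced {x\<in>S. communicates S R i x} (\<lambda>x y. R x y * exp (h y - h x)) m"
proof -
  have "\<exists>h. balanced {x\<in>S. communicates S R i x} (\<lambda>x y. R x y * exp (h y - h x)) m" if i: "i \<in> S" for i
  proof -
    define D where "D = {x\<in>S. communicates S R i x}"
    \<comment> \<open>The diagonal of \<open>R\<close> has no prescribed sign and cancels in the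
      balance; setting it to 0 makes the weights nonnegative.\<close>
    define K where "K x y = (if x = y then 0 else m x * R x y)" for x y
    have D: "finite D" "D \<subseteq> S" using fin by (auto simp: D_def)
    have "rate_graph D K = rate_graph D R"
      using D m by (force simp: rate_graph_def K_def zero_less_mult_iff)
    then have "\<exists>h. \<forall>h'. energy D K h \<le> energy D K h'"
    proof (intro exists_energy_minimiser D)
      show "0 \<le> K x y" if "x \<in> D" "y \<in> D" for x y
        using less_imp_le[OF m, of x] R[of x y] subsetD[OF D(2) that(1)] subsetD[OF D(2) that(2)]
        by (auto simp: K_def)
    qed (use communicates_class_connected[OF i] in \<open>auto simp: D_def\<close>)
    then obtain h where h: "\<And>h'. energy D K h \<le> energy D K h'" by blast
    have "balanced D (\<lambda>x y. R x y * exp (h y - h x)) m"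
      unfolding balanced_def
    proof
      fix y assume y: "y \<in> D"
      have "(\<Sum>x\<in>D - {y}. K x y * exp (h y - h x)) = (\<Sum>x\<in>D - {y}. K y x * exp (h x - h y))"
        using energy_minimiser_balanced[OF D(1) h y] D(1) y by (simp add: sum.remove[of D y])
      then have "(\<Sum>x\<in>D - {y}. m x * (R x y * exp (h y - h x))) = (\<Sum>x\<in>D - {y}. m y * (R y x * exp (h x - h y)))"
        by (simp add: K_def mult.assoc eq_commute[of y])
      then show "(\<Sum>x\<in>D. m x * (R x y * exp (h y - h x))) = m y * (\<Sum>x\<in>D. R y x * exp (h x - h y))"
        using D(1) y by (simp add: sum.remove[of D y] sum_distrib_left distrib_left)
    qed
    then show ?thesis unfolding D_def by blast
  qed
  \<comment> \<open>The choice is made per class, as a set, so that all states of a class share one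
    tilt.\<close>
  then have "\<forall>D\<in>(\<lambda>i. {x\<in>S. communicates S R i x}) ` S. \<exists>h. balanced D (\<lambda>x y. R x y * exp (h y - h x)) m"
    by blast
  from bchoice[OF this] obtain H where "\<forall>D\<in>(\<lambda>i. {x\<in>S. communicates S R i x}) ` S.
      balanced D (\<lambda>x y. R x y * exp (H D y - H D x)) m" ..
  then have H: "\<And>i. i \<in> S \<Longrightarrow> balanced {x\<in>S. communicates S R i x}
      (\<lambda>x y. R x y * exp (H {x\<in>S. communicates S R i x} y - H {x\<in>S. communicates S R i x} x)) m"
    by simp
  define h where "h y = H {x\<in>S. communicates S R y x} y" for y
  have "balanced {x\<in>S. communicates S R i x} (\<lambda>x y. R x y * exp (h y - h x)) m" if "i \<in> S" for i
  proof -
    have "communicates S R y x \<longleftrightarrow> communicates S R i x" if "communicates S R i y" for x y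
      using communicates_trans[OF that, of x] communicates_trans[OF communicates_sym[OF that], of x] by blast
    note eq = this
    have hi: "h y = H {x\<in>S. communicates S R i x} y" if "communicates S R i y" for y
      by (simp only: h_def eq[OF that])
    show ?thesis
      unfolding balanced_def
    proof
      let ?D = "{x\<in>S. communicates S R i x}"
      fix y assume y: "y \<in> ?D"
      have "(\<Sum>x\<in>?D. m x * (R x y * exp (h y - h x))) = (\<Sum>x\<in>?D. m x * (R x y * exp (H ?D y - H ?D x)))"
        "(\<Sum>x\<in>?D. R y x * exp (h x - h y)) = (\<Sum>x\<in>?D. R y x * exp (H ?D x - H ?D y))"
        using y by (auto intro!: sum.cong simp: hi)
      then show "(\<Sum>x\<in>?D. m x * (R x y * exp (h y - h x))) = m y * (\<Sum>x\<in>?D. R y x * exp (h x - h y))"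
        using H[OF \<open>i \<in> S\<close>] y by (simp only: balanced_def)
    qed
  qed
  then show ?thesis by blast
qed

text \<open>The weights in \<open>ld_comm\<close> vanish between distinct classes, so the
  Euler-Lagrange equation of a maximiser is a balance inside each class.\<close>

lemma ld_comm_maximiser_balanced:
  assumes fin: "finite S" and max: "\<And>h'. ld_comm S R m h' \<le> ld_comm S R m h" and "i \<in> S"
  shows "balanced {x\<in>S. communicates S R i x} (\<lambda>x y. R x y * exp (h y - h x)) m"
  unfolding balanced_def
proof
  let ?K = "\<lambda>x y. if communicates S R x y then m x * R x y else 0"
  fix y assume y: "y \<in> {x\<in>S. communicates S R i x}"
  have "energy S ?K h \<le> energy S ?K h'" for h' using max[of h'] by (simp add: ld_comm_eq_energy)
  from energy_minimiser_balanced[OF fin this, of y] y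
  have "(\<Sum>x\<in>S. ?K x y * exp (h y - h x)) = (\<Sum>x\<in>S. ?K y x * exp (h x - h y))" by simp
  moreover have "communicates S R x y \<longleftrightarrow> communicates S R i x" "communicates S R y x \<longleftrightarrow> communicates S R i x" for x
    using y by (metis communicates_sym communicates_trans mem_Collect_eq)+
  ultimately show "(\<Sum>x | x \<in> S \<and> communicates S R i x. m x * (R x y * exp (h y - h x)))
      = m y * (\<Sum>x | x \<in> S \<and> communicates S R i x. R y x * exp (h x - h y))"
    using fin by (simp add: sum.inter_filter sum_distrib_left if_distrib[of "\<lambda>a. a * b" for b]
        if_distrib[of "(*) b" for b] mult.assoc cong: if_cong)
qed

section \<open>Stationary measures and closed irreducible classes\<close>

lemma closed_irreducible_reach:
  assumes "closed_irreducible_class S R D" "x \<in> D" "(x, y) \<in> (rate_graph S R)\<^sup>*"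
  shows "y \<in> D \<and> (x, y) \<in> (rate_graph D R)\<^sup>*"
  using assms(3)
proof (induction rule: rtrancl_induct)
  case base
  then show ?case using assms by simp
next
  case (step y z)
  then have "z \<in> D" using assms by (auto simp: closed_irreducible_class_def)
  moreover have "(y, z) \<in> rate_graph D R" using step \<open>z \<in> D\<close> by (auto simp: rate_graph_def)
  ultimately show ?case using step by auto
qed

lemma closed_irreducible_disjoint:
  assumes "closed_irreducible_class S R D" "closed_irreducible_class S R D'" "x \<in> D" "x \<in> D'"
  shows "D = D'"
proof -
  have "D \<subseteq> D'" if "closed_irreducible_class S R D" "closed_irreducible_class S R D'" "x \<in> D" "x \<in> D'" for D D'
  proof
    fix z assume "z \<in> D"
    then have "(x, z) \<in> (rate_graph S R)\<^sup>*"
      using that(1,3) unfolding closed_irreducible_class_def by simp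
    from closed_irreducible_reach[OF that(2,4) this] show "z \<in> D'" by simp
  qed
  then show ?thesis using assms by (intro equalityI) blast+
qed

text \<open>Stationary measures charge recurrent states only. Let \<open>B\<close> consist of the
  states reachable from \<open>i\<close> that do not lead back to \<open>i\<close>. Nothing leaves
  \<open>B\<close>, so by the balance summed over \<open>B\<close> nothing flows in. But every state
  reachable from \<open>i\<close> has positive mass, so an edge on a path from \<open>i\<close> into
  \<open>B\<close> would carry flow.\<close>

lemma balanced_support_closed_irreducible:
  assumes fin: "finite S" and R: "\<And>x y. x \<in> S \<Longrightarrow> y \<in> S \<Longrightarrow> x \<noteq> y \<Longrightarrow> 0 \<le> R x y"
    and bal: "balanced S R m" and m: "\<And>x. x \<in> S \<Longrightarrow> 0 \<le> m x" and i: "i \<in> S" "0 < m i"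
  shows "closed_irreducible_class S R {j. (i, j) \<in> (rate_graph S R)\<^sup>*}"
proof -
  let ?G = "rate_graph S R"
  define D where "D = {j. (i, j) \<in> ?G\<^sup>*}"
  define B where "B = {x\<in>D. (x, i) \<notin> ?G\<^sup>*}"
  have DS: "D \<subseteq> S" using i by (auto simp: D_def rate_graph_def elim: rtranclE)
  have finB: "finite B" "B \<subseteq> S" using DS fin finite_subset[of B S] by (auto simp: B_def)
  have pos: "0 < m z" if "(i, z) \<in> ?G\<^sup>*" for z
    using that
  proof (induction rule: rtrancl_induct)
    case base show ?case using i by simp
  next
    case (step y z)
    have "m z \<noteq> 0" using balanced_zero_back[OF fin bal R m step(2)] step(3) by auto
    moreover have "z \<in> S" using step by (auto simp: rate_graph_def)
    ultimately show ?case using m[of z] by simp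
  qed
  have out: "R y x = 0" if "y \<in> B" "x \<in> S - B" for x y
  proof (rule ccontr)
    assume "R y x \<noteq> 0"
    then have e: "(y, x) \<in> ?G" using that R[of y x] finB by (fastforce simp: rate_graph_def)
    then have "x \<in> D" using that by (auto simp: B_def D_def intro: rtrancl_into_rtrancl)
    then have "(y, i) \<in> ?G\<^sup>*" using that e by (auto simp: B_def intro: converse_rtrancl_into_rtrancl)
    then show False using that by (simp add: B_def)
  qed
  have splitS: "sum f S = sum f B + sum f (S - B)" for f :: "'a \<Rightarrow> real"
    using sum.subset_diff[OF finB(2) fin, of f] by simp
  have "(\<Sum>y\<in>B. \<Sum>x\<in>S. m x * R x y) = (\<Sum>y\<in>B. m y * (\<Sum>x\<in>S. R y x))"
    using bal finB by (intro sum.cong) (auto simp: balanced_def)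
  also have "\<dots> = (\<Sum>y\<in>B. \<Sum>x\<in>B. m y * R y x)"
    unfolding splitS using out by (intro sum.cong) (auto simp: sum_distrib_left)
  also have "\<dots> = (\<Sum>y\<in>B. \<Sum>x\<in>B. m x * R x y)" by (rule sum.swap)
  finally have "(\<Sum>y\<in>B. \<Sum>x\<in>S - B. m x * R x y) = 0" by (simp add: splitS sum.distrib)
  moreover have nn: "0 \<le> m x * R x y" if "y \<in> B" "x \<in> S - B" for x y
    using that finB m R by (auto intro!: mult_nonneg_nonneg)
  ultimately have "\<forall>y\<in>B. (\<Sum>x\<in>S - B. m x * R x y) = 0"
    using finB by (subst (asm) sum_nonneg_eq_0_iff) (auto intro!: sum_nonneg)
  then have inB: "m x * R x y = 0" if "y \<in> B" "x \<in> S - B" for x y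
    using sum_nonneg_eq_0_iff[of "S - B" "\<lambda>x. m x * R x y"] nn that fin by simp
  have "z \<notin> B" if "(i, z) \<in> ?G\<^sup>*" for z
    using that
  proof (induction rule: rtrancl_induct)
    case base show ?case by (simp add: B_def)
  next
    case (step y z)
    then show ?case using inB[of z y] pos[of y] by (auto simp: rate_graph_def)
  qed
  then have "(x, i) \<in> ?G\<^sup>*" if "x \<in> D" for x using that by (auto simp: B_def D_def)
  then have "\<forall>x\<in>D. \<forall>y\<in>D. (x, y) \<in> ?G\<^sup>*" by (auto simp: D_def intro: rtrancl_trans)
  moreover have "\<forall>x\<in>D. \<forall>y. (x, y) \<in> ?G \<longrightarrow> y \<in> D" by (auto simp: D_def)
  moreover have "i \<in> D" by (simp add: D_def)
  ultimately show ?thesis using DS unfolding closed_irreducible_class_def D_def by blast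
qed

text \<open>A charged state outside \<open>D\<close> with a jump into \<open>D\<close> would be
  recurrent, hence reachable from \<open>D\<close>, against closedness. So \<open>D\<close>
  exchanges no flow with its complement.\<close>

lemma balanced_restrict_closed_class:
  assumes fin: "finite S" and R: "\<And>x y. x \<in> S \<Longrightarrow> y \<in> S \<Longrightarrow> x \<noteq> y \<Longrightarrow> 0 \<le> R x y"
    and bal: "balanced S R m" and m: "\<And>x. x \<in> S \<Longrightarrow> 0 \<le> m x"
    and D: "closed_irreducible_class S R D"
  shows "balanced D R m"
  unfolding balanced_def
proof
  fix y assume y: "y \<in> D"
  have DS: "D \<subseteq> S" using D by (simp add: closed_irreducible_class_def)
  have "(\<Sum>x\<in>D. m x * R x y) = (\<Sum>x\<in>S. m x * R x y)"
  proof (rule sum.mono_neutral_left[OF fin DS], intro ballI, rule ccontr)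
    fix x assume x: "x \<in> S - D" and "m x * R x y \<noteq> 0"
    then have mx: "0 < m x" and xy: "(x, y) \<in> rate_graph S R"
      using y DS m[of x] R[of x y] by (fastforce simp: rate_graph_def)+
    have "closed_irreducible_class S R {j. (x, j) \<in> (rate_graph S R)\<^sup>*}"
    proof (rule balanced_support_closed_irreducible[OF fin _ bal _ _ mx])
      show "x \<in> S" using x by blast
    qed (fact R, fact m)
    then have "\<forall>a\<in>{j. (x, j) \<in> (rate_graph S R)\<^sup>*}. \<forall>b\<in>{j. (x, j) \<in> (rate_graph S R)\<^sup>*}.
        (a, b) \<in> (rate_graph S R)\<^sup>*"
      unfolding closed_irreducible_class_def by (elim conjE)
    from bspec[OF bspec[OF this, of y], of x] xy
    have "(y, x) \<in> (rate_graph S R)\<^sup>*" by blast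
    with closed_irreducible_reach[OF D y] x show False by blast
  qed
  moreover have "(\<Sum>x\<in>D. R y x) = (\<Sum>x\<in>S. R y x)"
  proof (rule sum.mono_neutral_left[OF fin DS], intro ballI, rule ccontr)
    fix x assume x: "x \<in> S - D" and "R y x \<noteq> 0"
    then have "(y, x) \<in> rate_graph S R" using y DS R[of y x] by (fastforce simp: rate_graph_def)
    then show False using D x y by (auto simp: closed_irreducible_class_def)
  qed
  ultimately show "(\<Sum>x\<in>D. m x * R x y) = m y * (\<Sum>x\<in>D. R y x)"
    using bal y DS by (auto simp: balanced_def)
qed

lemma exists_pmf:
  assumes "finite A" "\<And>x. x \<in> A \<Longrightarrow> 0 \<le> f x" "sum f A = 1"
  obtains p where "set_pmf p \<subseteq> A" "\<And>x. pmf p x = (if x \<in> A then f x else 0)"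
proof
  let ?f = "\<lambda>x. if x \<in> A then f x else 0"
  have "(\<integral>\<^sup>+x. ennreal (?f x) \<partial>count_space UNIV) = (\<Sum>x\<in>A. ennreal (f x))"
    by (subst nn_integral_count_space'[of A]) (use assms in auto)
  also have "\<dots> = 1" using assms by (simp add: sum_ennreal)
  finally show *: "pmf (embed_pmf ?f) x = ?f x" for x
    using assms by (subst pmf_embed_pmf) auto
  show "set_pmf (embed_pmf ?f) \<subseteq> A" using * by (auto simp: set_pmf_eq split: if_splits)
qed

text \<open>The weights are the masses of the closed classes. These carry all the mass, and on each
  of them the measure is balanced, hence proportional to the stationary state of the class.\<close>

lemma stationary_is_mixture:
  fixes C :: "nat \<Rightarrow> 'a set"
  assumes fin: "finite S" and R: "\<And>x y. x \<in> S \<Longrightarrow> y \<in> S \<Longrightarrow> x \<noteq> y \<Longrightarrow> 0 \<le> R x y"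
    and C: "bij_betw C J {D. closed_irreducible_class S R D}" and J: "finite J"
    and M: "\<And>k. k \<in> J \<Longrightarrow> stationary_state S R (M k) \<and> set_pmf (M k) = C k"
    and st: "stationary_state S R \<mu>"
  shows "\<exists>\<omega>. is_mixture J \<omega> M \<mu>"
proof -
  have cl: "closed_irreducible_class S R (C k)" if "k \<in> J" for k
    using C that by (auto simp: bij_betw_def)
  then have CS: "finite (C k)" "C k \<subseteq> S" if "k \<in> J" for k
    using that finite_subset[OF _ fin, of "C k"] by (auto simp: closed_irreducible_class_def)
  have disj: "k = l" if "k \<in> J" "l \<in> J" "x \<in> C k" "x \<in> C l" for k l x
    using closed_irreducible_disjoint[OF cl cl] that C by (metis bij_betw_imp_inj_on inj_onD)
  have bal: "balanced S R (pmf \<mu>)" "set_pmf \<mu> \<subseteq> S"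
    using st stationary_state_iff_balanced[OF fin] by auto
  have supp: "\<exists>k\<in>J. x \<in> C k" if "x \<in> set_pmf \<mu>" for x
  proof -
    have "closed_irreducible_class S R {j. (x, j) \<in> (rate_graph S R)\<^sup>*}"
      using that bal by (intro balanced_support_closed_irreducible[OF fin R bal(1)]) (auto simp: pmf_positive)
    then obtain k where "k \<in> J" "C k = {j. (x, j) \<in> (rate_graph S R)\<^sup>*}"
      using C by (metis (mono_tags, lifting) bij_betw_imp_surj_on imageE mem_Collect_eq)
    then show ?thesis by auto
  qed
  have scaled: "pmf \<mu> x = sum (pmf \<mu>) (C k) * pmf (M k) x" if k: "k \<in> J" and x: "x \<in> C k" for k x
  proof (rule balanced_proportional[OF CS(1)[OF k] _ _ _ _ _ _ x, where K = R])
    show "balanced (C k) R (pmf \<mu>)"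
      by (rule balanced_restrict_closed_class[OF fin R bal(1) _ cl[OF k]]) auto
    show "balanced (C k) R (pmf (M k))"
      by (rule balanced_restrict_closed_class[OF fin R _ _ cl[OF k]])
         (use M[OF k] stationary_state_iff_balanced[OF fin] in auto)
    show "0 \<le> R x y" if "x \<in> C k" "y \<in> C k" "x \<noteq> y" for x y using that R CS[OF k] by auto
    show "(x, y) \<in> (rate_graph (C k) R)\<^sup>*" if "x \<in> C k" "y \<in> C k" for x y
    proof -
      have "(x, y) \<in> (rate_graph S R)\<^sup>*"
        using that cl[OF k] unfolding closed_irreducible_class_def by simp
      from closed_irreducible_reach[OF cl[OF k] that(1) this] show ?thesis by simp
    qed
    show "0 < pmf (M k) x" if "x \<in> C k" for x using that M[OF k] by (simp add: pmf_positive)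
    show "sum (pmf (M k)) (C k) = 1" using M[OF k] CS[OF k] by (intro sum_pmf_eq_1) auto
  qed
  have "(\<Sum>k\<in>J. sum (pmf \<mu>) (C k)) = sum (pmf \<mu>) (\<Union>k\<in>J. C k)"
    using J CS disj by (intro sum.UNION_disjoint [symmetric]) auto
  also have "\<dots> = 1" using supp J CS by (intro sum_pmf_eq_1) auto
  finally obtain \<omega> where \<omega>: "set_pmf \<omega> \<subseteq> J" "\<And>k. pmf \<omega> k = (if k \<in> J then sum (pmf \<mu>) (C k) else 0)"
    using exists_pmf[OF J, of "\<lambda>k. sum (pmf \<mu>) (C k)"] by (metis sum_nonneg pmf_nonneg)
  have "pmf \<mu> x = (\<Sum>k\<in>J. pmf \<omega> k * pmf (M k) x)" for x
  proof (cases "\<exists>k\<in>J. x \<in> C k")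
    case True
    then obtain k where k: "k \<in> J" "x \<in> C k" by blast
    have "(\<Sum>l\<in>J. pmf \<omega> l * pmf (M l) x) = (\<Sum>l\<in>J. if l = k then pmf \<omega> k * pmf (M k) x else 0)"
    proof (rule sum.cong)
      fix l assume "l \<in> J"
      then show "pmf \<omega> l * pmf (M l) x = (if l = k then pmf \<omega> k * pmf (M k) x else 0)"
      proof (cases "l = k")
        case False
        then have "x \<notin> C l" using disj k \<open>l \<in> J\<close> by blast
        then have "x \<notin> set_pmf (M l)" using M[OF \<open>l \<in> J\<close>] by simp
        then show ?thesis using False by (simp add: set_pmf_iff)
      qed simp
    qed simp
    then show ?thesis using scaled[OF k] \<omega> k J by simp
  next
    case False
    then have "x \<notin> set_pmf \<mu>" using supp by blast
    then have "pmf \<mu> x = 0" by (simp add: set_pmf_iff)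
    moreover have "pmf (M k) x = 0" if "k \<in> J" for k
    proof -
      have "x \<notin> set_pmf (M k)" using that False M[OF that] by blast
      then show ?thesis by (simp add: set_pmf_iff)
    qed
    ultimately show ?thesis by simp
  qed
  then show ?thesis using \<omega> unfolding is_mixture_def by blast
qed

lemma balanced_cong:
  "(\<And>x y. x \<in> D \<Longrightarrow> y \<in> D \<Longrightarrow> K x y = K' x y) \<Longrightarrow> (\<And>x. x \<in> D \<Longrightarrow> m x = m' x) \<Longrightarrow>
    balanced D K m \<longleftrightarrow> balanced D K' m'"
  unfolding balanced_def by (intro ball_cong refl arg_cong2[where f = "(=)"] arg_cong2[where f = "(*)"] sum.cong) auto

section \<open>Asymptotic bounds\<close>

lemma limitin_weak_topology_iff:
  fixes s :: "nat \<Rightarrow> ('v :: finite) pmf"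
  shows "limitin weak_topology s \<mu> sequentially \<longleftrightarrow> (\<forall>v. (\<lambda>n. pmf (s n) v) \<longlonglongrightarrow> pmf \<mu> v)"
proof
  have expect: "measure_pmf.expectation \<rho> f = (\<Sum>x\<in>UNIV. f x * pmf \<rho> x)" for \<rho> :: "'v pmf" and f :: "'v \<Rightarrow> real"
    by (rule integral_measure_pmf_real) auto
  let ?B = "{{\<mu>. measure_pmf.expectation \<mu> f \<in> U} | (f :: 'v \<Rightarrow> real) U. open U}"
  have weak: "weak_topology = topology_generated_by ?B" by (simp add: weak_topology_def)
  {
    assume lim: "limitin weak_topology s \<mu> sequentially"
    show "\<forall>v. (\<lambda>n. pmf (s n) v) \<longlonglongrightarrow> pmf \<mu> v"
    proof
      fix v
      show "(\<lambda>n. pmf (s n) v) \<longlonglongrightarrow> pmf \<mu> v"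
      proof (rule topological_tendstoI)
        fix U :: "real set" assume U: "open U" "pmf \<mu> v \<in> U"
        let ?f = "indicator {v} :: 'v \<Rightarrow> real"
        have f: "measure_pmf.expectation \<rho> ?f = pmf \<rho> v" for \<rho>
          by (simp add: measure_pmf_single)
        have "openin weak_topology {\<mu>. measure_pmf.expectation \<mu> ?f \<in> U}"
          unfolding weak by (rule topology_generated_by_Basis) (use U in blast)
        with lim U f show "\<forall>\<^sub>F n in sequentially. pmf (s n) v \<in> U"
          unfolding limitin_def by auto
      qed
    qed
  }
  {
    assume lim: "\<forall>v. (\<lambda>n. pmf (s n) v) \<longlonglongrightarrow> pmf \<mu> v"
    have top: "topspace (weak_topology :: 'v pmf topology) = UNIV"
    proof -
      have "UNIV \<in> ?B" by (auto intro!: exI[of _ "\<lambda>_. 0"] exI[of _ UNIV])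
      then show ?thesis unfolding weak topology_generated_by_topspace by blast
    qed
    show "limitin weak_topology s \<mu> sequentially"
      unfolding limitin_def top
    proof (intro conjI allI impI; (elim conjE)?)
      fix U assume U: "openin weak_topology U" "\<mu> \<in> U"
      have "generate_topology_on ?B U"
        using U(1) unfolding weak openin_topology_generated_by_iff .
      then show "\<forall>\<^sub>F n in sequentially. s n \<in> U" using U(2)
      proof (induction rule: generate_topology_on.induct)
        case (Int a b)
        then show ?case by (auto intro: eventually_conj)
      next
        case (UN K)
        then obtain k where "k \<in> K" "\<forall>\<^sub>F n in sequentially. s n \<in> k" by blast
        then show ?case by (auto elim!: eventually_mono)
      next
        case (Basis A)
        then obtain f :: "'v \<Rightarrow> real" and U where A: "A = {\<mu>. measure_pmf.expectation \<mu> f \<in> U}" "open U"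
          by blast
        have "(\<lambda>n. measure_pmf.expectation (s n) f) \<longlonglongrightarrow> measure_pmf.expectation \<mu> f"
          unfolding expect using lim by (intro tendsto_intros) auto
        then show ?case using A Basis by (auto dest: topological_tendstoD)
      qed simp
    qed simp
  }
qed

lemma topspace_weak_topology: "topspace (weak_topology :: ('v :: finite) pmf topology) = UNIV"
proof -
  have "\<mu> \<in> topspace weak_topology" for \<mu> :: "'v pmf"
    using limitin_weak_topology_iff[of "\<lambda>_. \<mu>" \<mu>] by (simp add: limitin_def)
  then show ?thesis by blast
qed

text \<open>Compactness turns uniqueness of the subsequential limits into convergence.\<close>

lemma bounded_unique_limit_tendsto:
  fixes f :: "nat \<Rightarrow> 'a::finite \<Rightarrow> real"
  assumes bound: "\<And>n x. \<bar>f n x\<bar> \<le> B"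
    and uniq: "\<And>s l. strict_mono s \<Longrightarrow> (\<And>x. (\<lambda>n. f (s n) x) \<longlonglongrightarrow> l x) \<Longrightarrow> l = m"
  shows "(\<lambda>n. f n x) \<longlonglongrightarrow> m x"
proof (rule ccontr)
  assume "\<not> (\<lambda>n. f n x) \<longlonglongrightarrow> m x"
  then obtain e where e: "e > 0" "\<not> (\<forall>\<^sub>F n in sequentially. dist (f n x) (m x) < e)"
    by (auto simp: tendsto_iff)
  then have "infinite {n. \<not> dist (f n x) (m x) < e}"
    by (simp add: eventually_sequentially_Suc eventually_cofinite flip: cofinite_eq_sequentially)
  then obtain t :: "nat \<Rightarrow> nat" where t: "strict_mono t" "\<And>k. t k \<in> {n. \<not> dist (f n x) (m x) < e}"
    by (meson infinite_enumerate)
  have "\<exists>s l. strict_mono s \<and> (\<forall>x\<in>UNIV. (\<lambda>n. f (t (s n)) x) \<longlonglongrightarrow> l x)"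
    by (rule finite_bounded_subseq[where f = "\<lambda>n. f (t n)" and B = "\<lambda>_. B"]) (use bound in auto)
  then obtain s l where s: "strict_mono s" "\<And>x. (\<lambda>n. f (t (s n)) x) \<longlonglongrightarrow> l x" by blast
  have "l = m" using uniq[OF strict_mono_o[OF t(1) s(1)], of l] s(2) by (simp add: o_def)
  then have "\<forall>\<^sub>F n in sequentially. dist (f (t (s n)) x) (m x) < e"
    using s(2)[of x] e(1) by (simp add: tendsto_iff)
  then obtain n where "dist (f (t (s n)) x) (m x) < e" by (auto simp: eventually_sequentially)
  then show False using t(2)[of "s n"] by simp
qed

text \<open>
  \<open>lower_bound R \<theta> c \<mu>\<close>: the \<open>\<Gamma>\<close>-lower limit at \<open>\<mu>\<close> is at least \<open>c\<close>, along every subsequence \<open>t\<close>.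
  \<open>recoverable R \<theta> m c\<close>: the \<open>\<Gamma>\<close>-upper limit at \<open>m\<close> is at most \<open>c\<close>.
\<close>

definition lower_bound :: "(nat \<Rightarrow> 'v::finite \<Rightarrow> 'v \<Rightarrow> real) \<Rightarrow> (nat \<Rightarrow> real) \<Rightarrow> real \<Rightarrow> 'v pmf \<Rightarrow> bool" where
  "lower_bound R \<theta> c \<mu> \<longleftrightarrow> (\<forall>t s. filterlim t at_top sequentially \<longrightarrow>
     (\<forall>x. (\<lambda>k. pmf (s k) x) \<longlonglongrightarrow> pmf \<mu> x) \<longrightarrow>
     (\<forall>c'<c. \<forall>\<^sub>F k in sequentially. \<exists>h. c' < \<theta> (t k) * ld_at UNIV (R (t k)) (pmf (s k)) h))"

definition recoverable :: "(nat \<Rightarrow> 'v::finite \<Rightarrow> 'v \<Rightarrow> real) \<Rightarrow> (nat \<Rightarrow> real) \<Rightarrow> ('v \<Rightarrow> real) \<Rightarrow> real \<Rightarrow> bool" where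
  "recoverable R \<theta> m c \<longleftrightarrow> (\<forall>\<epsilon>>0. \<forall>\<^sub>F n in sequentially. \<exists>\<rho>.
     (\<forall>x. \<bar>pmf \<rho> x - m x\<bar> < \<epsilon>) \<and> (\<forall>h. \<theta> n * ld_at UNIV (R n) (pmf \<rho>) h \<le> c + \<epsilon>))"

section \<open>Rules for lower bounds and for recovery\<close>

text \<open>Passing to the scale \<open>\<theta>'\<close> multiplies a strictly positive bound by a
  diverging ratio, so every constant \<open>c''\<close> becomes a lower bound.\<close>

lemma lower_bound_rescale:
  assumes lb: "lower_bound R \<theta> c \<mu>" and c: "0 < c" and prec: "prec \<theta> \<theta>'"
    and pos: "\<And>n. n \<ge> 1 \<Longrightarrow> 0 < \<theta> n" "\<And>n. n \<ge> 1 \<Longrightarrow> 0 < \<theta>' n"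
  shows "lower_bound R \<theta>' c'' \<mu>"
  unfolding lower_bound_def
proof (intro allI impI)
  fix t :: "nat \<Rightarrow> nat" and s and c' :: real
  assume t: "filterlim t at_top sequentially" and s: "\<forall>x. (\<lambda>k. pmf (s k) x) \<longlonglongrightarrow> pmf \<mu> x"
  have "\<forall>\<^sub>F k in sequentially. \<exists>h. c / 2 < \<theta> (t k) * ld_at UNIV (R (t k)) (pmf (s k)) h"
    using lb[unfolded lower_bound_def, rule_format, OF t, of s "c / 2"] s c by simp
  \<comment> \<open>The threshold that turns the bound \<open>c / 2\<close> on the scale
    \<open>\<theta>\<close> into \<open>\<bar>c'\<bar> + 1\<close> on the scale
    \<open>\<theta>'\<close>.\<close>
  moreover have "\<forall>\<^sub>F k in sequentially. \<theta> (t k) / \<theta>' (t k) < c / (2 * (\<bar>c'\<bar> + 1))"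
  proof -
    have "(\<lambda>k. \<theta> (t k) / \<theta>' (t k)) \<longlonglongrightarrow> 0"
      using filterlim_compose[OF prec[unfolded prec_def] t] .
    then show ?thesis using c by (intro order_tendstoD(2)) auto
  qed
  moreover have "\<forall>\<^sub>F k in sequentially. 1 \<le> t k"
    using t by (simp add: filterlim_at_top)
  ultimately show "\<forall>\<^sub>F k in sequentially. \<exists>h. c' < \<theta>' (t k) * ld_at UNIV (R (t k)) (pmf (s k)) h"
  proof eventually_elim
    case (elim k)
    then obtain h where h: "c / 2 < \<theta> (t k) * ld_at UNIV (R (t k)) (pmf (s k)) h" by blast
    let ?d = "ld_at UNIV (R (t k)) (pmf (s k)) h"
    have p: "0 < \<theta> (t k)" "0 < \<theta>' (t k)" using pos elim by auto
    then have "0 < ?d" using h c by (smt (verit) zero_less_mult_pos half_gt_zero)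
    have "2 * (\<bar>c'\<bar> + 1) * \<theta> (t k) < c * \<theta>' (t k)"
      using elim(2) p by (simp add: field_simps)
    then have "(\<bar>c'\<bar> + 1) * (\<theta> (t k) * ?d) < c / 2 * (\<theta>' (t k) * ?d)"
      using mult_strict_right_mono[OF _ \<open>0 < ?d\<close>] by (fastforce simp: algebra_simps)
    moreover have "(\<bar>c'\<bar> + 1) * (c / 2) < (\<bar>c'\<bar> + 1) * (\<theta> (t k) * ?d)"
      using h by (intro mult_strict_left_mono) auto
    ultimately have "c / 2 * (\<bar>c'\<bar> + 1) < c / 2 * (\<theta>' (t k) * ?d)" by (simp add: mult.commute)
    then have "\<bar>c'\<bar> + 1 < \<theta>' (t k) * ?d" using c by (simp only: mult_less_cancel_left_pos half_gt_zero)
    then show ?case by (intro exI[of _ h]) linarith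
  qed
qed

lemma ld_at_ln:
  assumes "\<And>x. x \<in> S \<Longrightarrow> 0 < G x"
  shows "ld_at S R m (\<lambda>x. ln (G x)) = (\<Sum>x\<in>S. m x * (- generator S R G x / G x))"
  unfolding ld_at_def generator_def sum_negf [symmetric] sum_divide_distrib
proof (intro sum.cong refl arg_cong2[where f = "(*)"])
  fix x y assume "x \<in> S" "y \<in> S"
  then have "0 < G x" "0 < G y" using assms by auto
  then show "R x y * (1 - exp (ln (G y) - ln (G x))) = - (R x y * (G y - G x)) / G x"
    by (simp add: exp_diff field_simps)
qed

lemma ld_at_le_rates:
  assumes "\<And>x. x \<in> S \<Longrightarrow> 0 \<le> m x" "\<And>x y. x \<in> S \<Longrightarrow> y \<in> S \<Longrightarrow> x \<noteq> y \<Longrightarrow> 0 \<le> R x y"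
  shows "ld_at S R m h \<le> (\<Sum>x\<in>S. m x * (\<Sum>y\<in>S. \<bar>R x y\<bar>))"
  unfolding ld_at_def
proof (intro sum_mono mult_left_mono assms)
  fix x y assume xy: "x \<in> S" "y \<in> S"
  show "R x y * (1 - exp (h y - h x)) \<le> \<bar>R x y\<bar>"
  proof (cases "x = y")
    case False
    then have "R x y * (1 - exp (h y - h x)) \<le> R x y * 1"
      using assms(2)[OF xy] by (intro mult_left_mono) auto
    then show ?thesis by linarith
  qed simp
qed

lemma recoverable_mono: "recoverable R \<theta> m c \<Longrightarrow> c \<le> c' \<Longrightarrow> recoverable R \<theta> m c'"
  unfolding recoverable_def
  by (elim all_forward imp_forward eventually_mono ex_forward conj_forward) (auto intro: order_trans)

text \<open>Closedness in the masses and in the cost jointly; it allows the passage from positive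
  weights to arbitrary ones.\<close>

lemma recoverable_limit:
  assumes "\<And>\<epsilon>. 0 < \<epsilon> \<Longrightarrow> \<exists>m' c'. recoverable R \<theta> m' c' \<and> (\<forall>x. \<bar>m' x - m x\<bar> < \<epsilon>) \<and> c' \<le> c + \<epsilon>"
  shows "recoverable R \<theta> m c"
  unfolding recoverable_def
proof (intro allI impI)
  fix \<epsilon> :: real assume \<epsilon>: "0 < \<epsilon>"
  then obtain m' c' where m': "recoverable R \<theta> m' c'" "\<And>x. \<bar>m' x - m x\<bar> < \<epsilon> / 2" "c' \<le> c + \<epsilon> / 2"
    using assms[of "\<epsilon> / 2"] by auto
  from m'(1) \<epsilon> have "\<forall>\<^sub>F n in sequentially. \<exists>\<rho>. (\<forall>x. \<bar>pmf \<rho> x - m' x\<bar> < \<epsilon> / 2) \<and>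
      (\<forall>h. \<theta> n * ld_at UNIV (R n) (pmf \<rho>) h \<le> c' + \<epsilon> / 2)"
    unfolding recoverable_def by (meson half_gt_zero)
  then show "\<forall>\<^sub>F n in sequentially. \<exists>\<rho>. (\<forall>x. \<bar>pmf \<rho> x - m x\<bar> < \<epsilon>) \<and>
      (\<forall>h. \<theta> n * ld_at UNIV (R n) (pmf \<rho>) h \<le> c + \<epsilon>)"
  proof (rule eventually_mono, elim exE conjE)
    fix n \<rho>
    assume \<rho>: "\<forall>x. \<bar>pmf \<rho> x - m' x\<bar> < \<epsilon> / 2" "\<forall>h. \<theta> n * ld_at UNIV (R n) (pmf \<rho>) h \<le> c' + \<epsilon> / 2"
    have "\<bar>pmf \<rho> x - m x\<bar> < \<epsilon>" for x using \<rho>(1)[rule_format, of x] m'(2)[of x] by linarith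
    moreover have "\<theta> n * ld_at UNIV (R n) (pmf \<rho>) h \<le> c + \<epsilon>" for h
      using \<rho>(2)[rule_format, of h] m'(3) by linarith
    ultimately show "\<exists>\<rho>. (\<forall>x. \<bar>pmf \<rho> x - m x\<bar> < \<epsilon>) \<and> (\<forall>h. \<theta> n * ld_at UNIV (R n) (pmf \<rho>) h \<le> c + \<epsilon>)"
      by blast
  qed
qed

lemma ld_at_sum: "ld_at S R (\<lambda>x. \<Sum>k\<in>K. a k * m k x) h = (\<Sum>k\<in>K. a k * ld_at S R (m k) h)"
proof -
  have "(\<Sum>x\<in>S. (\<Sum>k\<in>K. a k * m k x) * C x) = (\<Sum>k\<in>K. a k * (\<Sum>x\<in>S. m k x * C x))" for C
    by (simp add: sum_distrib_left sum_distrib_right mult.assoc) (rule sum.swap)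
  then show ?thesis unfolding ld_at_def .
qed

text \<open>\<open>ld_at\<close> is linear in the measure, so a mixture of recovering measures
  satisfies the averaged bound for every \<open>h\<close>.\<close>

lemma recoverable_convex:
  assumes K: "finite K" "\<And>k. k \<in> K \<Longrightarrow> 0 \<le> a k" "sum a K = 1"
    and rec: "\<And>k. k \<in> K \<Longrightarrow> recoverable R \<theta> (m k) (c k)"
  shows "recoverable R \<theta> (\<lambda>x. \<Sum>k\<in>K. a k * m k x) (\<Sum>k\<in>K. a k * c k)"
  unfolding recoverable_def
proof (intro allI impI)
  fix \<epsilon> :: real assume \<epsilon>: "0 < \<epsilon>"
  have "\<forall>\<^sub>F n in sequentially. \<forall>k\<in>K. \<exists>\<rho>. (\<forall>x. \<bar>pmf \<rho> x - m k x\<bar> < \<epsilon> / 2) \<and>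
      (\<forall>h. \<theta> n * ld_at UNIV (R n) (pmf \<rho>) h \<le> c k + \<epsilon> / 2)"
  proof (rule eventually_ball_finite[OF K(1)], intro ballI)
    fix k assume k: "k \<in> K"
    show "\<forall>\<^sub>F n in sequentially. \<exists>\<rho>. (\<forall>x. \<bar>pmf \<rho> x - m k x\<bar> < \<epsilon> / 2) \<and>
        (\<forall>h. \<theta> n * ld_at UNIV (R n) (pmf \<rho>) h \<le> c k + \<epsilon> / 2)"
      by (rule rec[OF k, unfolded recoverable_def, THEN spec, THEN mp]) (use \<epsilon> in simp)
  qed
  then show "\<forall>\<^sub>F n in sequentially. \<exists>\<rho>. (\<forall>x. \<bar>pmf \<rho> x - (\<Sum>k\<in>K. a k * m k x)\<bar> < \<epsilon>) \<and>
      (\<forall>h. \<theta> n * ld_at UNIV (R n) (pmf \<rho>) h \<le> (\<Sum>k\<in>K. a k * c k) + \<epsilon>)"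
  proof eventually_elim
    case (elim n)
    from bchoice[OF this] obtain \<rho> where \<rho>: "\<And>k x. k \<in> K \<Longrightarrow> \<bar>pmf (\<rho> k) x - m k x\<bar> < \<epsilon> / 2"
      "\<And>k h. k \<in> K \<Longrightarrow> \<theta> n * ld_at UNIV (R n) (pmf (\<rho> k)) h \<le> c k + \<epsilon> / 2" by blast
    let ?f = "\<lambda>x. \<Sum>k\<in>K. a k * pmf (\<rho> k) x"
    have "sum ?f UNIV = (\<Sum>k\<in>K. a k * (\<Sum>x\<in>UNIV. pmf (\<rho> k) x))"
      unfolding sum_distrib_left by (rule sum.swap)
    also have "\<dots> = 1" using K by (simp add: sum_pmf_eq_1)
    finally have sum1: "sum ?f UNIV = 1" .
    have "0 \<le> ?f x" for x using K by (intro sum_nonneg) auto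
    from exists_pmf[OF finite this sum1] obtain \<sigma> where "\<And>x. pmf \<sigma> x = ?f x" by auto
    then have \<sigma>: "pmf \<sigma> = ?f" by auto
    have avg: "(\<Sum>k\<in>K. a k * b) = b" for b using K by (simp add: sum_distrib_right [symmetric])
    have "\<bar>pmf \<sigma> x - (\<Sum>k\<in>K. a k * m k x)\<bar> < \<epsilon>" for x
    proof -
      have "\<bar>pmf \<sigma> x - (\<Sum>k\<in>K. a k * m k x)\<bar> = \<bar>\<Sum>k\<in>K. a k * (pmf (\<rho> k) x - m k x)\<bar>"
        by (simp add: \<sigma> right_diff_distrib sum_subtractf)
      also have "\<dots> \<le> (\<Sum>k\<in>K. \<bar>a k * (pmf (\<rho> k) x - m k x)\<bar>)" by (rule sum_abs)
      also have "\<dots> \<le> (\<Sum>k\<in>K. a k * (\<epsilon> / 2))"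
      proof (rule sum_mono)
        fix k assume k: "k \<in> K"
        show "\<bar>a k * (pmf (\<rho> k) x - m k x)\<bar> \<le> a k * (\<epsilon> / 2)"
          using K(2)[OF k] mult_left_mono[OF less_imp_le[OF \<rho>(1)[OF k, of x]] K(2)[OF k]]
          by (simp add: abs_mult)
      qed
      also have "\<dots> < \<epsilon>" using \<epsilon> by (simp only: avg)
      finally show ?thesis .
    qed
    moreover have "\<theta> n * ld_at UNIV (R n) (pmf \<sigma>) h \<le> (\<Sum>k\<in>K. a k * c k) + \<epsilon>" for h
    proof -
      have "\<theta> n * ld_at UNIV (R n) (pmf \<sigma>) h = (\<Sum>k\<in>K. a k * (\<theta> n * ld_at UNIV (R n) (pmf (\<rho> k)) h))"
        by (simp add: \<sigma> ld_at_sum sum_distrib_left mult.left_commute)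
      also have "\<dots> \<le> (\<Sum>k\<in>K. a k * (c k + \<epsilon> / 2))"
        using K \<rho> by (intro sum_mono mult_left_mono) auto
      also have "\<dots> = (\<Sum>k\<in>K. a k * c k) + \<epsilon> / 2"
        by (simp only: distrib_left sum.distrib avg)
      finally show ?thesis using \<epsilon> by linarith
    qed
    ultimately show ?case by blast
  qed
qed

text \<open>Diagonal argument: index \<open>n\<close> uses the best attainable accuracy
  \<open>1 / (k + 1)\<close> with \<open>k\<close> at most \<open>n\<close>, a bound that makes
  \<open>A n\<close> finite.\<close>

lemma recoverable_sequence:
  assumes "recoverable R \<theta> (pmf \<mu>) c"
  shows "\<exists>s. (\<forall>x. (\<lambda>n. pmf (s n) x) \<longlonglongrightarrow> pmf \<mu> x) \<and>
    (\<forall>\<epsilon>>0. \<forall>\<^sub>F n in sequentially. \<forall>h. \<theta> n * ld_at UNIV (R n) (pmf (s n)) h \<le> c + \<epsilon>)"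
proof -
  define good where "good n \<epsilon> \<rho> \<longleftrightarrow> (\<forall>x. \<bar>pmf \<rho> x - pmf \<mu> x\<bar> < \<epsilon>) \<and>
    (\<forall>h. \<theta> n * ld_at UNIV (R n) (pmf \<rho>) h \<le> c + \<epsilon>)" for n \<epsilon> \<rho>
  have good_mono: "good n \<epsilon>' \<rho>" if "good n \<epsilon> \<rho>" "\<epsilon> \<le> \<epsilon>'" for n \<epsilon> \<epsilon>' \<rho>
    using that unfolding good_def by (meson add_left_mono le_less_trans less_le_trans order_trans)
  have ev: "\<forall>\<^sub>F n in sequentially. \<exists>\<rho>. good n \<epsilon> \<rho>" if "0 < \<epsilon>" for \<epsilon>
    using assms that unfolding recoverable_def good_def by blast
  define A where "A n = {k. k \<le> n \<and> (\<exists>\<rho>. good n (1 / real (Suc k)) \<rho>)}" for n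
  define s where "s n = (SOME \<rho>. good n (1 / real (Suc (Max (A n)))) \<rho>)" for n
  have s: "\<forall>\<^sub>F n in sequentially. good n \<epsilon> (s n)" if \<epsilon>: "0 < \<epsilon>" for \<epsilon>
  proof -
    obtain k where k: "1 / real (Suc k) < \<epsilon>" using nat_approx_posE[OF \<epsilon>] by blast
    have "\<forall>\<^sub>F n in sequentially. \<exists>\<rho>. good n (1 / real (Suc k)) \<rho>" by (rule ev) simp
    with eventually_ge_at_top[of k] show ?thesis
    proof eventually_elim
      case (elim n)
      have fin: "finite (A n)" unfolding A_def by simp
      have kA: "k \<in> A n" using elim by (simp add: A_def)
      then have "Max (A n) \<in> A n" using fin by (intro Max_in) auto
      then have "\<exists>\<rho>. good n (1 / real (Suc (Max (A n)))) \<rho>" by (simp add: A_def)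
      then have "good n (1 / real (Suc (Max (A n)))) (s n)" unfolding s_def by (rule someI_ex)
      moreover have "1 / real (Suc (Max (A n))) \<le> \<epsilon>"
      proof -
        have "1 / real (Suc (Max (A n))) \<le> 1 / real (Suc k)"
          using Max_ge[OF fin kA] by (intro divide_left_mono) auto
        then show ?thesis using k by linarith
      qed
      ultimately show ?case by (rule good_mono)
    qed
  qed
  show ?thesis
  proof (intro exI[of _ s] conjI allI impI)
    fix x
    show "(\<lambda>n. pmf (s n) x) \<longlonglongrightarrow> pmf \<mu> x"
      unfolding tendsto_iff dist_real_def
    proof (intro allI impI)
      fix e :: real assume "0 < e"
      from s[OF this] show "\<forall>\<^sub>F n in sequentially. \<bar>pmf (s n) x - pmf \<mu> x\<bar> < e"
        by (rule eventually_mono) (simp add: good_def)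
    qed
  next
    fix \<epsilon> :: real assume "0 < \<epsilon>"
    from s[OF this] show "\<forall>\<^sub>F n in sequentially. \<forall>h. \<theta> n * ld_at UNIV (R n) (pmf (s n)) h \<le> c + \<epsilon>"
      by (rule eventually_mono) (simp add: good_def)
  qed
qed

section \<open>One level of the hierarchy\<close>

text \<open>The input of one level. The wells are the fibres of \<open>pr\<close> over
  \<open>J\<close>, and the remaining states have labels outside \<open>J\<close>. The last
  assumption, divergence off the mixtures, is what the induction over the levels supplies.\<close>

locale metastable_level =
  fixes R :: "nat \<Rightarrow> 'v::finite \<Rightarrow> 'v \<Rightarrow> real"
    and J :: "nat set" and r :: "nat \<Rightarrow> nat \<Rightarrow> real"
    and pr :: "'v \<Rightarrow> nat" and \<nu> :: "nat \<Rightarrow> 'v pmf" and \<theta> :: "nat \<Rightarrow> real"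
  assumes chain: "n \<ge> 1 \<Longrightarrow> finite_chain UNIV (R n)"
    and limit_chain: "finite_chain J r"
    and \<theta>_pos: "n \<ge> 1 \<Longrightarrow> 0 < \<theta> n"
    and supp: "j \<in> J \<Longrightarrow> set_pmf (\<nu> j) = {x. pr x = j}"
    and marginals: "t \<ge> 0 \<Longrightarrow> pr x \<in> J \<Longrightarrow>
      (\<lambda>n. \<P>(\<omega> in chain_noise UNIV (R n). pr (chain_path UNIV (R n) x \<omega> (t * \<theta> n)) = i))
        \<longlonglongrightarrow> \<P>(\<omega> in chain_noise J r. chain_path J r (pr x) \<omega> t = i)"
    and lower_bound_non_mixture: "\<nexists>\<omega>. is_mixture J \<omega> \<nu> \<mu> \<Longrightarrow> lower_bound R \<theta> c \<mu>"
begin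

sublocale lim: finite_chain J r by (rule limit_chain)

lemma range_pr: "J \<subseteq> range pr"
proof
  fix j assume "j \<in> J"
  then obtain x where "pr x = j" using supp set_pmf_not_empty[of "\<nu> j"] by auto
  then show "j \<in> range pr" by auto
qed

lemma sum_component:
  assumes "j \<in> J" shows "(\<Sum>x\<in>UNIV. pmf (\<nu> j) x * f (pr x)) = f j"
proof -
  have "(\<Sum>x\<in>UNIV. pmf (\<nu> j) x * f (pr x)) = (\<Sum>x\<in>UNIV. pmf (\<nu> j) x * f j)"
    using supp[OF assms] by (intro sum.cong refl) (metis (mono_tags) mem_Collect_eq mult_zero_left set_pmf_iff)
  also have "\<dots> = f j" by (simp add: sum_distrib_right [symmetric] sum_pmf_eq_1)
  finally show ?thesis .
qed

lemma sum_mixture: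
  assumes "K \<subseteq> J"
  shows "(\<Sum>x\<in>UNIV. (\<Sum>j\<in>K. w j * pmf (\<nu> j) x) * f (pr x)) = (\<Sum>j\<in>K. w j * f j)"
proof -
  have "(\<Sum>x\<in>UNIV. (\<Sum>j\<in>K. w j * pmf (\<nu> j) x) * f (pr x))
      = (\<Sum>j\<in>K. w j * (\<Sum>x\<in>UNIV. pmf (\<nu> j) x * f (pr x)))"
    by (simp add: sum_distrib_left sum_distrib_right mult.assoc) (rule sum.swap)
  also have "\<dots> = (\<Sum>j\<in>K. w j * f j)" using assms by (intro sum.cong refl) (auto simp: sum_component)
  finally show ?thesis .
qed

lemma sum_is_mixture:
  assumes "is_mixture J \<omega> \<nu> \<mu>"
  shows "(\<Sum>x\<in>UNIV. pmf \<mu> x * f (pr x)) = (\<Sum>j\<in>J. pmf \<omega> j * f j)"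
  using assms sum_mixture[of J "pmf \<omega>" f] by (simp add: is_mixture_def)

text \<open>The components live on distinct fibres of \<open>pr\<close>, so a weight is the integral
  of the indicator of a fibre. This gives sense to the description operator in
  \<open>level_functional\<close>.\<close>

lemma is_mixture_unique:
  assumes "is_mixture J \<omega> \<nu> \<mu>" "is_mixture J \<omega>' \<nu> \<mu>"
  shows "\<omega> = \<omega>'"
proof (rule pmf_eqI)
  fix i
  show "pmf \<omega> i = pmf \<omega>' i"
  proof (cases "i \<in> J")
    case True
    then have "pmf w i = (\<Sum>j\<in>J. pmf w j * (if j = i then 1 else 0))" for w
      using lim.finite_S by (simp add: if_distrib[of "(*) b" for b] cong: if_cong)
    then show ?thesis
      using sum_is_mixture[OF assms(1), of "\<lambda>j. if j = i then 1 else 0"]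
        sum_is_mixture[OF assms(2), of "\<lambda>j. if j = i then 1 else 0"] by simp
  next
    case False
    then show ?thesis using assms by (metis is_mixture_def set_pmf_iff subsetD)
  qed
qed

lemma level_functional_mixture:
  assumes "is_mixture J \<omega> \<nu> \<mu>"
  shows "level_functional J r \<nu> \<mu> = ld_functional J r \<omega>"
proof -
  have "(THE \<omega>. is_mixture J \<omega> \<nu> \<mu>) = \<omega>"
    using assms is_mixture_unique by (intro the_equality) auto
  then show ?thesis using assms unfolding level_functional_def by auto
qed

lemma resolvent:
  assumes "0 < l"
  obtains G where
    "\<And>n x. n \<ge> 1 \<Longrightarrow> l * G n x - \<theta> n * generator UNIV (R n) (G n) x
        = (if pr x \<in> J then l * u (pr x) - generator J r u (pr x) else c)"
    "\<And>x. pr x \<in> J \<Longrightarrow> (\<lambda>n. G n x) \<longlonglongrightarrow> u (pr x)"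
  using resolvent_tendsto[OF chain limit_chain assms \<theta>_pos range_pr marginals, where u = u and c = c]
  by blast

section \<open>Lower bound at mixtures\<close>

lemma lower_bound_mixture:
  assumes mix: "is_mixture J \<omega> \<nu> \<mu>"
  shows "lower_bound R \<theta> (ld_at J r (pmf \<omega>) h) \<mu>"
proof -
  define u where "u j = exp (h j)" for j
  \<comment> \<open>Each term of \<open>generator J r u j\<close> is at most
    \<open>\<bar>r j i\<bar> * (exp (h i - h j) + 1) * u j\<close>, so \<open>l * u j\<close>
    dominates their sum; the final 1 makes \<open>g\<close> strictly positive.\<close>
  define l where "l = (\<Sum>j\<in>J. \<Sum>i\<in>J. \<bar>r j i\<bar> * (exp (h i - h j) + 1)) + 1"
  define g where "g j = l * u j - generator J r u j" for j
  have l: "0 < l" unfolding l_def by (intro add_nonneg_pos sum_nonneg) auto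
  have gu: "g j / u j - l = - generator J r u j / u j" for j
    by (simp add: g_def u_def field_simps)
  have g: "0 < g j" if j: "j \<in> J" for j
  proof -
    have "generator J r u j \<le> (\<Sum>i\<in>J. \<bar>r j i\<bar> * (exp (h i - h j) + 1) * u j)"
      unfolding generator_def
    proof (rule sum_mono)
      fix i
      have "r j i * (u i - u j) \<le> \<bar>r j i\<bar> * \<bar>u i - u j\<bar>"
        by (metis abs_ge_self abs_mult)
      also have "\<dots> \<le> \<bar>r j i\<bar> * (u i + u j)" by (intro mult_left_mono) (auto simp: u_def abs_le_iff)
      also have "u i + u j = (exp (h i - h j) + 1) * u j" by (simp add: u_def exp_diff field_simps)
      finally show "r j i * (u i - u j) \<le> \<bar>r j i\<bar> * (exp (h i - h j) + 1) * u j" by (simp add: mult.assoc)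
    qed
    also have "\<dots> = (\<Sum>i\<in>J. \<bar>r j i\<bar> * (exp (h i - h j) + 1)) * u j" by (rule sum_distrib_right [symmetric])
    also have "\<dots> \<le> (\<Sum>j\<in>J. \<Sum>i\<in>J. \<bar>r j i\<bar> * (exp (h i - h j) + 1)) * u j"
      by (intro mult_right_mono member_le_sum[OF j, where f = "\<lambda>j. \<Sum>i\<in>J. \<bar>r j i\<bar> * (exp (h i - h j) + 1)"] sum_nonneg)
         (auto simp: u_def lim.finite_S)
    also have "\<dots> < l * u j" by (simp add: l_def u_def)
    finally show ?thesis by (simp add: g_def)
  qed
  \<comment> \<open>The inserted 1 is the right-hand side off the wells.\<close>
  define a where "a = Min (insert 1 (g ` J))"
  have a: "0 < a" "a \<le> 1" "\<And>j. j \<in> J \<Longrightarrow> a \<le> g j"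
    unfolding a_def using lim.finite_S g by auto
  obtain G where G: "\<And>n x. n \<ge> 1 \<Longrightarrow> l * G n x - \<theta> n * generator UNIV (R n) (G n) x
        = (if pr x \<in> J then g (pr x) else 1)"
    and Glim: "\<And>x. pr x \<in> J \<Longrightarrow> (\<lambda>n. G n x) \<longlonglongrightarrow> u (pr x)"
    using resolvent[OF l, of u 1] unfolding g_def by metis
  have Glow: "a / l \<le> G n x" if n: "n \<ge> 1" for n x
  proof -
    have "a \<le> l * G n x"
      using a G[OF n] less_imp_le[OF \<theta>_pos[OF n]]
      by (intro finite_chain.maximum_principle[OF chain[OF n] l]) auto
    then show ?thesis using l by (simp add: pos_divide_le_eq mult.commute)
  qed
  have al: "0 < a / l" using a l by simp
  have Gpos: "0 < G n x" if "n \<ge> 1" for n x using Glow[OF that, of x] al by linarith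
  \<comment> \<open>By the resolvent equation this is
    \<open>- \<theta> n * generator UNIV (R n) (G n) x / G n x\<close>.\<close>
  define F where "F n x = (if pr x \<in> J then g (pr x) else 1) / G n x - l" for n x
  have dvF: "\<theta> n * ld_at UNIV (R n) m (\<lambda>x. ln (G n x)) = (\<Sum>x\<in>UNIV. m x * F n x)" if n: "n \<ge> 1" for n m
    unfolding ld_at_ln[OF Gpos[OF n]] sum_distrib_left
  proof (intro sum.cong refl)
    fix x
    show "\<theta> n * (m x * (- generator UNIV (R n) (G n) x / G n x)) = m x * F n x"
    proof -
      have "- (\<theta> n * generator UNIV (R n) (G n) x) = (if pr x \<in> J then g (pr x) else 1) - l * G n x"
        using G[OF n, of x] by simp
      then have "- (\<theta> n * generator UNIV (R n) (G n) x) / G n x = F n x"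
        using Gpos[OF n, of x] by (simp only: F_def diff_divide_distrib) simp
      from this [symmetric] show ?thesis by (simp only:) (simp add: mult.left_commute)
    qed
  qed
  show ?thesis
    unfolding lower_bound_def
  proof (intro allI impI)
    fix t :: "nat \<Rightarrow> nat" and s c'
    assume t: "filterlim t at_top sequentially" and s: "\<forall>x. (\<lambda>k. pmf (s k) x) \<longlonglongrightarrow> pmf \<mu> x"
      and c': "c' < ld_at J r (pmf \<omega>) h"
    have t1: "\<forall>\<^sub>F k in sequentially. 1 \<le> t k" using t by (simp add: filterlim_at_top)
    have "(\<lambda>k. \<Sum>x\<in>UNIV. pmf (s k) x * F (t k) x)
       \<longlonglongrightarrow> (\<Sum>x\<in>UNIV. pmf \<mu> x * (if pr x \<in> J then g (pr x) / u (pr x) - l else 0))"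
    proof (rule tendsto_sum)
      fix x
      show "(\<lambda>k. pmf (s k) x * F (t k) x) \<longlonglongrightarrow> pmf \<mu> x * (if pr x \<in> J then g (pr x) / u (pr x) - l else 0)"
      proof (cases "pr x \<in> J")
        case True
        have "(\<lambda>k. G (t k) x) \<longlonglongrightarrow> u (pr x)" using filterlim_compose[OF Glim[OF True] t] .
        then show ?thesis using True s unfolding F_def
          by (auto intro!: tendsto_intros simp: u_def)
      next
        case False
        \<comment> \<open>Off the wells \<open>F\<close> need not converge; it is bounded, and the
          mass it multiplies tends to 0.\<close>
        have "pmf \<mu> x = 0"
        proof -
          have "pmf (\<nu> j) x = 0" if "j \<in> J" for j using supp[OF that] False that by (auto simp: set_pmf_iff)
          then show ?thesis using mix by (simp add: is_mixture_def)
        qed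
        then have "(\<lambda>k. pmf (s k) x) \<longlonglongrightarrow> 0" using s by metis
        moreover have "Bfun (\<lambda>k. F (t k) x) sequentially"
        proof (rule BfunI)
          show "\<forall>\<^sub>F k in sequentially. norm (F (t k) x) \<le> l / a + l"
            using t1
          proof eventually_elim
            case (elim k)
            have "1 / G (t k) x \<le> 1 / (a / l)" using Glow[OF elim, of x] al by (intro frac_le) auto
            moreover have "0 < 1 / G (t k) x" using Gpos[OF elim] by simp
            moreover have "1 / (a / l) = l / a" "0 < l / a" using a l by auto
            ultimately have "\<bar>1 / G (t k) x - l\<bar> \<le> l / a + l" using l by linarith
            then show ?case using False by (simp add: F_def)
          qed
        qed
        ultimately have "(\<lambda>k. pmf (s k) x * F (t k) x) \<longlonglongrightarrow> 0"
          using bounded_bilinear.Zfun_prod_Bfun[OF bounded_bilinear_mult] by (simp add: tendsto_Zfun_iff)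
        then show ?thesis using False by simp
      qed
    qed
    moreover have "(\<Sum>x\<in>UNIV. pmf \<mu> x * (if pr x \<in> J then g (pr x) / u (pr x) - l else 0)) = ld_at J r (pmf \<omega>) h"
    proof -
      have "(\<Sum>x\<in>UNIV. pmf \<mu> x * (if pr x \<in> J then g (pr x) / u (pr x) - l else 0))
         = (\<Sum>j\<in>J. pmf \<omega> j * (if j \<in> J then g j / u j - l else 0))"
        by (rule sum_is_mixture[OF mix])
      also have "\<dots> = ld_at J r (pmf \<omega>) (\<lambda>j. ln (u j))"
        by (subst ld_at_ln, simp add: u_def, intro sum.cong refl) (simp add: gu)
      finally show ?thesis by (simp add: u_def)
    qed
    ultimately have "\<forall>\<^sub>F k in sequentially. c' < (\<Sum>x\<in>UNIV. pmf (s k) x * F (t k) x)"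
      using c' by (auto intro: order_tendstoD(1))
    with t1 show "\<forall>\<^sub>F k in sequentially. \<exists>h. c' < \<theta> (t k) * ld_at UNIV (R (t k)) (pmf (s k)) h"
      by eventually_elim (metis dvF)
  qed
qed

section \<open>Recovery sequences\<close>

abbreviation class_of :: "nat \<Rightarrow> nat set" where
  "class_of i \<equiv> {j\<in>J. communicates J r i j}"

text \<open>The coefficient of \<open>m j\<close> in \<open>ld_comm\<close>. For \<open>j\<close> in
  a class \<open>D\<close> it equals \<open>- generator J r u j / u j\<close>, where
  \<open>u\<close> is \<open>exp h\<close> on \<open>D\<close> and 0 elsewhere.\<close>

definition cost :: "(nat \<Rightarrow> real) \<Rightarrow> nat \<Rightarrow> real" where
  "cost h j = (\<Sum>k\<in>J. r j k * (1 - (if communicates J r j k then exp (h k - h j) else 0)))"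

lemma ld_comm_eq_cost: "ld_comm J r m h = (\<Sum>j\<in>J. m j * cost h j)"
  by (simp add: ld_comm_def cost_def)

lemma class_of_communicates:
  assumes "j \<in> class_of i" "k \<in> J" shows "communicates J r j k \<longleftrightarrow> k \<in> class_of i"
proof -
  have "communicates J r i j" using assms by simp
  from communicates_trans[OF this, of k] communicates_trans[OF communicates_sym[OF this], of k] assms(2)
  show ?thesis by blast
qed

text \<open>A squeeze: no lower bound at the limit point can exceed the limit of the costs. This
  excludes non-mixtures and mass off \<open>D\<close>, and it leaves equality on \<open>D\<close>.
  Hence \<open>h\<close> is optimal for the limit weights, which are then balanced under the same
  tilt as \<open>w\<close> and equal to \<open>w\<close> by uniqueness.\<close>

lemma limit_of_bounded_cost:
  assumes i: "i \<in> J"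
  defines "D \<equiv> class_of i"
  assumes w: "\<And>j. j \<in> D \<Longrightarrow> 0 < w j" "sum w D = 1"
    and bal: "balanced D (\<lambda>j k. r j k * exp (h k - h j)) w"
    and s: "strict_mono s" "\<And>x. (\<lambda>n. pmf (\<rho> (s n)) x) \<longlonglongrightarrow> l x"
    and bound: "\<forall>\<^sub>F n in sequentially. \<forall>f. \<theta> n * ld_at UNIV (R n) (pmf (\<rho> n)) f \<le> e n"
    and e: "(\<lambda>n. e (s n)) \<longlonglongrightarrow> (\<Sum>x\<in>UNIV. l x * (if pr x \<in> D then cost h (pr x) else - 1))"
  shows "l x = (\<Sum>j\<in>D. w j * pmf (\<nu> j) x)"
proof -
  let ?a = "\<lambda>j. if j \<in> D then cost h j else - 1"
  have DJ: "D \<subseteq> J" "finite D" using lim.finite_S by (auto simp: D_def)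
  have t: "filterlim s at_top sequentially" by (rule filterlim_subseq[OF s(1)])
  have l0: "0 \<le> l x" for x by (rule LIMSEQ_le_const[OF s(2)]) auto
  have "(\<lambda>n. \<Sum>x\<in>UNIV. pmf (\<rho> (s n)) x) \<longlonglongrightarrow> sum l UNIV" by (intro tendsto_sum s(2))
  moreover have "(\<Sum>x\<in>UNIV. pmf (\<rho> (s n)) x) = 1" for n by (rule sum_pmf_eq_1) auto
  ultimately have "sum l UNIV = 1" by (simp add: LIMSEQ_const_iff)
  then obtain \<mu> where "\<And>x. pmf \<mu> x = l x" using exists_pmf[of UNIV l] l0 by auto
  then have \<mu>: "l = pmf \<mu>" by auto
  define eb where "eb = (\<Sum>x\<in>UNIV. l x * ?a (pr x))"
  have bound': "\<forall>\<^sub>F n in sequentially. \<forall>f. \<theta> (s n) * ld_at UNIV (R (s n)) (pmf (\<rho> (s n))) f \<le> e (s n)"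
    using eventually_compose_filterlim[OF bound t] .
  have lb: "c \<le> eb" if "lower_bound R \<theta> c \<mu>" for c
  proof (rule ccontr)
    assume "\<not> c \<le> eb"
    then have c: "(c + eb) / 2 < c" "eb < (c + eb) / 2" by auto
    have "\<forall>\<^sub>F k in sequentially. \<exists>h. (c + eb) / 2 < \<theta> (s k) * ld_at UNIV (R (s k)) (pmf (\<rho> (s k))) h"
      by (rule that[unfolded lower_bound_def, rule_format, OF t]) (use s(2) c(1) \<mu> in auto)
    moreover have "\<forall>\<^sub>F k in sequentially. e (s k) < (c + eb) / 2"
      using e c by (intro order_tendstoD(2)) (auto simp: eb_def)
    ultimately have "\<forall>\<^sub>F k in sequentially. False"
      using bound' by eventually_elim (meson less_le_trans order_less_asym)
    then show False by simp
  qed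
  \<comment> \<open>At a non-mixture even \<open>eb + 1\<close> would be a lower bound.\<close>
  obtain \<omega> where mix: "is_mixture J \<omega> \<nu> \<mu>"
    using lower_bound_non_mixture[of \<mu> "eb + 1"] lb[of "eb + 1"] by auto
  have eb: "eb = (\<Sum>j\<in>J. pmf \<omega> j * ?a j)" unfolding eb_def \<mu> by (rule sum_is_mixture[OF mix])
  have ld: "ld_functional J r \<omega> \<le> ereal eb"
    unfolding ld_functional_le_iff using lb lower_bound_mixture[OF mix] by blast
  have ld_comm: "ld_comm J r (pmf \<omega>) f \<le> eb" for f
  proof -
    have "ereal (ld_comm J r (pmf \<omega>) f) \<le> ld_functional J r \<omega>"
      by (rule ld_comm_le_ld_functional[OF lim.finite_S lim.R_nonneg])
    also note ld
    finally have "ereal (ld_comm J r (pmf \<omega>) f) \<le> ereal eb" .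
    then show ?thesis by simp
  qed
  \<comment> \<open>The extension by 0 makes the exponentials within any other class equal to 1, so
    states off \<open>D\<close> have nonnegative cost.\<close>
  define h0 where "h0 j = (if j \<in> D then h j else 0)" for j
  have cost0: "cost h0 j = cost h j" if "j \<in> D" for j
    unfolding cost_def
  proof (intro sum.cong refl)
    fix k assume "k \<in> J"
    then show "r j k * (1 - (if communicates J r j k then exp (h0 k - h0 j) else 0))
        = r j k * (1 - (if communicates J r j k then exp (h k - h j) else 0))"
      using class_of_communicates[of j i k] that by (auto simp: h0_def D_def)
  qed
  have cost_off: "0 \<le> cost h0 j" if j: "j \<in> J" "j \<notin> D" for j
    unfolding cost_def
  proof (rule sum_nonneg)
    fix k assume k: "k \<in> J"
    have "k \<notin> D" if "communicates J r j k"
      using communicates_sym[OF that] class_of_communicates[of k i j] j k by (auto simp: D_def)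
    then show "0 \<le> r j k * (1 - (if communicates J r j k then exp (h0 k - h0 j) else 0))"
      using lim.R_nonneg[OF j(1) k] j by (cases "j = k") (auto simp: h0_def)
  qed
  \<comment> \<open>The terms are 0 on \<open>D\<close> and at least \<open>pmf \<omega> j\<close>
    off \<open>D\<close>. All of them therefore vanish: there is no mass off \<open>D\<close>, and
    \<open>h0\<close> attains the bound \<open>eb\<close>.\<close>
  have "(\<Sum>j\<in>J. pmf \<omega> j * (cost h0 j - ?a j)) \<le> 0"
    using ld_comm[of h0] by (simp add: ld_comm_eq_cost eb right_diff_distrib sum_subtractf)
  moreover have nn: "0 \<le> pmf \<omega> j * (cost h0 j - ?a j)" if "j \<in> J" for j
    using cost0[of j] cost_off[OF that] by auto
  ultimately have "(\<Sum>j\<in>J. pmf \<omega> j * (cost h0 j - ?a j)) = 0"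
    by (intro antisym sum_nonneg)
  then have z: "\<forall>j\<in>J. pmf \<omega> j * (cost h0 j - ?a j) = 0"
    using lim.finite_S nn by (subst (asm) sum_nonneg_eq_0_iff) auto
  have off: "pmf \<omega> j = 0" if "j \<in> J" "j \<notin> D" for j
    using z[rule_format, OF that(1)] cost_off[OF that] that by auto
  have suppJ: "set_pmf \<omega> \<subseteq> J" using mix by (simp add: is_mixture_def)
  then have suppD: "set_pmf \<omega> \<subseteq> D" using off by (metis set_pmf_iff subsetD subsetI)
  have "ld_comm J r (pmf \<omega>) h0 = eb"
    unfolding ld_comm_eq_cost eb using z by (intro sum.cong refl) (auto simp: algebra_simps)
  with ld_comm have "balanced D (\<lambda>x y. r x y * exp (h0 y - h0 x)) (pmf \<omega>)"
    unfolding D_def by (intro ld_comm_maximiser_balanced[OF lim.finite_S _ i]) auto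
  also have "balanced D (\<lambda>x y. r x y * exp (h0 y - h0 x)) (pmf \<omega>)
      \<longleftrightarrow> balanced D (\<lambda>x y. r x y * exp (h y - h x)) (pmf \<omega>)"
    by (rule balanced_cong) (auto simp: h0_def)
  finally have bal\<omega>: "balanced D (\<lambda>x y. r x y * exp (h y - h x)) (pmf \<omega>)" .
  have eq: "pmf \<omega> j = w j" if j: "j \<in> D" for j
  proof -
    have "pmf \<omega> j = sum (pmf \<omega>) D * w j"
    proof (rule balanced_proportional[OF DJ(2) bal bal\<omega> _ _ w j])
      show "0 \<le> r x y * exp (h y - h x)" if "x \<in> D" "y \<in> D" "x \<noteq> y" for x y
        using that DJ(1) by (intro mult_nonneg_nonneg lim.R_nonneg) auto
      have "rate_graph D (\<lambda>x y. r x y * exp (h y - h x)) = rate_graph D r"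
        by (simp add: rate_graph_def zero_less_mult_iff)
      then show "(x, y) \<in> (rate_graph D (\<lambda>x y. r x y * exp (h y - h x)))\<^sup>*" if "x \<in> D" "y \<in> D" for x y
        using communicates_class_connected[OF i, of r x y] that by (simp add: D_def)
    qed
    moreover have "sum (pmf \<omega>) D = 1" using suppD DJ by (intro sum_pmf_eq_1) auto
    ultimately show ?thesis by simp
  qed
  have "l x = (\<Sum>j\<in>J. pmf \<omega> j * pmf (\<nu> j) x)" using mix by (simp add: \<mu> is_mixture_def)
  also have "\<dots> = (\<Sum>j\<in>D. pmf \<omega> j * pmf (\<nu> j) x)"
    using DJ lim.finite_S off by (intro sum.mono_neutral_right) auto
  also have "\<dots> = (\<Sum>j\<in>D. w j * pmf (\<nu> j) x)" using eq by simp
  finally show ?thesis .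
qed

lemma recoverable_class:
  assumes i: "i \<in> J"
  defines "D \<equiv> class_of i"
  assumes w: "\<And>j. j \<in> D \<Longrightarrow> 0 < w j" "sum w D = 1"
    and bal: "balanced D (\<lambda>j k. r j k * exp (h k - h j)) w"
  shows "recoverable R \<theta> (\<lambda>x. \<Sum>j\<in>D. w j * pmf (\<nu> j) x) (\<Sum>j\<in>D. w j * cost h j)"
proof -
  let ?m = "\<lambda>x. \<Sum>j\<in>D. w j * pmf (\<nu> j) x"
  have DJ: "D \<subseteq> J" "finite D" "i \<in> D" using lim.finite_S i by (auto simp: D_def)
  define u where "u j = (if j \<in> D then exp (h j) else 0)" for j
  define g where "g j = u j - generator J r u j" for j
  have g_in: "g j / u j - 1 = cost h j" if j: "j \<in> D" for j
  proof -
    have "g j / u j - 1 = - generator J r u j / u j"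
      using j by (simp add: g_def u_def field_simps)
    also have "\<dots> = cost h j"
      unfolding generator_def cost_def sum_negf [symmetric] sum_divide_distrib
    proof (intro sum.cong refl)
      fix k assume "k \<in> J"
      then have "communicates J r j k \<longleftrightarrow> k \<in> D" using class_of_communicates[of j i k] j by (simp add: D_def)
      then show "- (r j k * (u k - u j)) / u j = r j k * (1 - (if communicates J r j k then exp (h k - h j) else 0))"
        using j by (simp add: u_def exp_diff field_simps)
    qed
    finally show ?thesis .
  qed
  have g_off: "g j \<le> 0" if j: "j \<in> J" "j \<notin> D" for j
  proof -
    have "0 \<le> generator J r u j"
      unfolding generator_def
    proof (rule sum_nonneg)
      fix k assume "k \<in> J"
      then show "0 \<le> r j k * (u k - u j)"
        using lim.R_nonneg[OF j(1), of k] j by (cases "j = k") (auto simp: u_def)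
    qed
    then show ?thesis using j by (simp add: g_def u_def)
  qed
  \<comment> \<open>Here \<open>l\<close> is 1, so the cost per state is the right-hand side over
    \<open>G\<close>, minus 1; positivity of \<open>G\<close> is needed on the wells of
    \<open>D\<close> only.\<close>
  obtain G where G: "\<And>n x. n \<ge> 1 \<Longrightarrow> 1 * G n x - \<theta> n * generator UNIV (R n) (G n) x
        = (if pr x \<in> J then 1 * u (pr x) - generator J r u (pr x) else 0)"
    and Glim: "\<And>x. pr x \<in> J \<Longrightarrow> (\<lambda>n. G n x) \<longlonglongrightarrow> u (pr x)"
    using resolvent[OF zero_less_one, of u 0] by metis
  define gg where "gg j = (if j \<in> J then g j else 0)" for j
  have G': "G n x - \<theta> n * generator UNIV (R n) (G n) x = gg (pr x)" if "n \<ge> 1" for n x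
    using G[OF that, of x] by (simp add: gg_def g_def)
  have gg_off: "gg j \<le> 0" if "j \<notin> D" for j using g_off that by (simp add: gg_def)
  define A where "A n = {x. 0 < G n x}" for n
  define P where "P n \<rho> \<longleftrightarrow> set_pmf \<rho> \<subseteq> A n \<and>
    (\<forall>f. \<theta> n * ld_at UNIV (R n) (pmf \<rho>) f \<le> (\<Sum>x\<in>A n. pmf \<rho> x * (gg (pr x) / G n x - 1)))" for n \<rho>
  have Gpos: "\<forall>\<^sub>F n in sequentially. \<forall>x\<in>{x. pr x \<in> D}. 0 < G n x"
  proof (rule eventually_ball_finite)
    show "\<forall>x\<in>{x. pr x \<in> D}. \<forall>\<^sub>F n in sequentially. 0 < G n x"
      using Glim DJ by (auto intro!: order_tendstoD(1) simp: u_def)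
  qed simp
  have ex: "\<exists>\<rho>. P n \<rho>" if n: "n \<ge> 1" and Gpos: "\<forall>x\<in>{x. pr x \<in> D}. 0 < G n x" for n
  proof -
    interpret c: finite_chain UNIV "R n" using chain[OF n] .
    \<comment> \<open>The wells of \<open>D\<close> lie in \<open>A n\<close>, so the transform has
      a nonempty state space.\<close>
    obtain x0 where "pr x0 = i" using range_pr i by blast
    then have "A n \<noteq> {}" using Gpos DJ by (auto simp: A_def)
    then have "\<exists>m. (\<forall>x\<in>A n. 0 \<le> m x) \<and> sum m (A n) = 1 \<and> balanced (A n) (\<lambda>x y. R n x y * G n y / G n x) (m :: 'v \<Rightarrow> real)"
      using c.R_nonneg by (intro exists_balanced) (auto simp: A_def)
    then obtain m where m: "\<And>x. x \<in> A n \<Longrightarrow> 0 \<le> m x" "sum m (A n) = 1"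
      "balanced (A n) (\<lambda>x y. R n x y * G n y / G n x) m" by blast
    obtain \<rho> where \<rho>: "set_pmf \<rho> \<subseteq> A n" "\<And>x. pmf \<rho> x = (if x \<in> A n then m x else 0)"
      using exists_pmf[of "A n" m] m by auto
    have "\<theta> n * ld_at UNIV (R n) (pmf \<rho>) f \<le> (\<Sum>x\<in>A n. pmf \<rho> x * (gg (pr x) / G n x - 1))" for f
    proof -
      have "ld_at UNIV (R n) (pmf \<rho>) f \<le> (\<Sum>x\<in>A n. pmf \<rho> x * (- generator UNIV (R n) (G n) x / G n x))"
      proof (rule ld_at_transform_le)
        show "balanced (A n) (\<lambda>x y. R n x y * G n y / G n x) (pmf \<rho>)"
          using m(3) \<rho>(2) balanced_cong[of "A n" _ _ m "pmf \<rho>"] by simp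
      qed (use \<rho> m(1) c.R_nonneg in \<open>auto simp: A_def\<close>)
      then have "\<theta> n * ld_at UNIV (R n) (pmf \<rho>) f
          \<le> \<theta> n * (\<Sum>x\<in>A n. pmf \<rho> x * (- generator UNIV (R n) (G n) x / G n x))"
        using \<theta>_pos[OF n] by simp
      also have "\<dots> = (\<Sum>x\<in>A n. pmf \<rho> x * (gg (pr x) / G n x - 1))"
        unfolding sum_distrib_left
      proof (intro sum.cong refl)
        fix x assume "x \<in> A n"
        then have "0 < G n x" by (simp add: A_def)
        then have "- (\<theta> n * generator UNIV (R n) (G n) x) / G n x = gg (pr x) / G n x - 1"
          using G'[OF n, of x] by (simp add: field_simps)
        from this [symmetric] show "\<theta> n * (pmf \<rho> x * (- generator UNIV (R n) (G n) x / G n x))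
            = pmf \<rho> x * (gg (pr x) / G n x - 1)"
          by (simp only:) (simp add: mult.left_commute)
      qed
      finally show ?thesis .
    qed
    then show ?thesis using \<rho> unfolding P_def by blast
  qed
  define \<rho> where "\<rho> n = (SOME \<rho>. P n \<rho>)" for n
  \<comment> \<open>A bound of the cost: at a state of \<open>A n\<close> outside the wells of
    \<open>D\<close> the quotient is at most 0, which leaves -1.\<close>
  define e where "e n = (\<Sum>x\<in>UNIV. pmf (\<rho> n) x * (if pr x \<in> D then g (pr x) / G n x - 1 else - 1))" for n
  have bound: "\<forall>\<^sub>F n in sequentially. \<forall>f. \<theta> n * ld_at UNIV (R n) (pmf (\<rho> n)) f \<le> e n"
    using Gpos eventually_ge_at_top[of 1]
  proof eventually_elim
    case (elim n)
    have P: "P n (\<rho> n)" unfolding \<rho>_def using someI_ex[OF ex[OF elim(2,1)]] .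
    have "(\<Sum>x\<in>A n. pmf (\<rho> n) x * (gg (pr x) / G n x - 1))
        \<le> (\<Sum>x\<in>A n. pmf (\<rho> n) x * (if pr x \<in> D then g (pr x) / G n x - 1 else - 1))"
    proof (rule sum_mono)
      fix x assume "x \<in> A n"
      then have "0 < G n x" by (simp add: A_def)
      then have "pr x \<notin> D \<Longrightarrow> gg (pr x) / G n x \<le> 0" using gg_off[of "pr x"] by (simp add: divide_le_0_iff)
      then show "pmf (\<rho> n) x * (gg (pr x) / G n x - 1)
          \<le> pmf (\<rho> n) x * (if pr x \<in> D then g (pr x) / G n x - 1 else - 1)"
        using DJ by (intro mult_left_mono) (auto simp: gg_def)
    qed
    also have "\<dots> = e n"
      unfolding e_def using P by (intro sum.mono_neutral_left) (auto simp: P_def set_pmf_iff)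
    finally show ?case using P unfolding P_def by (meson order_trans)
  qed
  have elim: "(\<lambda>n. e (s n)) \<longlonglongrightarrow> (\<Sum>x\<in>UNIV. l x * (if pr x \<in> D then cost h (pr x) else - 1))"
    if s: "strict_mono s" "\<And>x. (\<lambda>n. pmf (\<rho> (s n)) x) \<longlonglongrightarrow> l x" for s l
    unfolding e_def
  proof (intro tendsto_sum tendsto_mult s(2))
    fix x
    show "(\<lambda>n. if pr x \<in> D then g (pr x) / G (s n) x - 1 else - 1)
        \<longlonglongrightarrow> (if pr x \<in> D then cost h (pr x) else - 1)"
    proof (cases "pr x \<in> D")
      case True
      have "(\<lambda>n. G (s n) x) \<longlonglongrightarrow> u (pr x)"
        using LIMSEQ_subseq_LIMSEQ[OF Glim s(1)] True DJ by (auto simp: o_def)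
      then have "(\<lambda>n. g (pr x) / G (s n) x - 1) \<longlonglongrightarrow> g (pr x) / u (pr x) - 1"
        using True by (intro tendsto_intros) (auto simp: u_def)
      then show ?thesis using True by (simp add: g_in)
    qed simp
  qed
  have \<rho>lim: "(\<lambda>n. pmf (\<rho> n) x) \<longlonglongrightarrow> ?m x" for x
  proof (rule bounded_unique_limit_tendsto[where B = 1])
    fix s l assume s: "strict_mono s" "\<And>x. (\<lambda>n. pmf (\<rho> (s n)) x) \<longlonglongrightarrow> l x"
    show "l = ?m"
      using limit_of_bounded_cost[OF i, folded D_def, OF w bal s bound elim[OF s]] by auto
  qed (simp add: pmf_le_1)
  have "(\<lambda>n. e n) \<longlonglongrightarrow> (\<Sum>x\<in>UNIV. ?m x * (if pr x \<in> D then cost h (pr x) else - 1))"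
    using elim[OF strict_mono_id, of ?m] \<rho>lim by (simp add: id_def)
  also have "(\<Sum>x\<in>UNIV. ?m x * (if pr x \<in> D then cost h (pr x) else - 1))
      = (\<Sum>j\<in>D. w j * (if j \<in> D then cost h j else - 1))"
    by (rule sum_mixture[OF DJ(1)])
  finally have e: "(\<lambda>n. e n) \<longlonglongrightarrow> (\<Sum>j\<in>D. w j * cost h j)" by simp
  show ?thesis
    unfolding recoverable_def
  proof (intro allI impI)
    fix \<epsilon> :: real assume \<epsilon>: "0 < \<epsilon>"
    have "\<forall>\<^sub>F n in sequentially. e n < (\<Sum>j\<in>D. w j * cost h j) + \<epsilon>"
      using e \<epsilon> by (intro order_tendstoD(2)) auto
    moreover have "\<forall>\<^sub>F n in sequentially. \<forall>x\<in>UNIV. \<bar>pmf (\<rho> n) x - ?m x\<bar> < \<epsilon>"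
      using \<rho>lim \<epsilon> by (intro eventually_ball_finite) (auto simp: tendsto_iff dist_real_def)
    ultimately show "\<forall>\<^sub>F n in sequentially. \<exists>\<rho>. (\<forall>x. \<bar>pmf \<rho> x - ?m x\<bar> < \<epsilon>) \<and>
        (\<forall>h'. \<theta> n * ld_at UNIV (R n) (pmf \<rho>) h' \<le> (\<Sum>j\<in>D. w j * cost h j) + \<epsilon>)"
      using bound
    proof eventually_elim
      case (elim n)
      then show ?case by (intro exI[of _ "\<rho> n"]) (auto intro: order_trans[OF _ less_imp_le])
    qed
  qed
qed

text \<open>\<open>w\<close> is the average over \<open>i\<close>, with weight \<open>w i\<close>,
  of its conditional laws on the class of \<open>i\<close>; no representatives of the classes have
  to be chosen. The costs average to \<open>ld_comm J r w h\<close>.\<close>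

lemma recoverable_positive:
  assumes w: "\<And>j. j \<in> J \<Longrightarrow> 0 < w j" "sum w J = 1"
    and c: "\<And>h. ld_comm J r w h \<le> c"
  shows "recoverable R \<theta> (\<lambda>x. \<Sum>j\<in>J. w j * pmf (\<nu> j) x) c"
proof -
  have "\<exists>h. \<forall>i\<in>J. balanced (class_of i) (\<lambda>j k. r j k * exp (h k - h j)) w"
    by (rule exists_tilt) (auto simp: lim.finite_S lim.R_nonneg w)
  then obtain h where "\<forall>i\<in>J. balanced (class_of i) (\<lambda>j k. r j k * exp (h k - h j)) w" ..
  then have h: "\<And>i. i \<in> J \<Longrightarrow> balanced (class_of i) (\<lambda>j k. r j k * exp (h k - h j)) w" by blast
  define W where "W i = sum w (class_of i)" for i
  have fin: "finite (class_of i)" for i using lim.finite_S by simp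
  have W: "0 < W i" if "i \<in> J" for i
    unfolding W_def using that w fin by (intro sum_pos2[of _ i]) (auto intro: less_imp_le)
  have rec: "recoverable R \<theta> (\<lambda>x. \<Sum>j\<in>class_of i. w j / W i * pmf (\<nu> j) x) (\<Sum>j\<in>class_of i. w j / W i * cost h j)"
    if i: "i \<in> J" for i
  proof (rule recoverable_class[OF i])
    show "0 < w j / W i" if "j \<in> class_of i" for j using W[OF i] w that by auto
    show "(\<Sum>j\<in>class_of i. w j / W i) = 1"
      using W[OF i] by (simp add: sum_divide_distrib [symmetric] W_def)
    \<comment> \<open>Scaling by \<open>1 / W i\<close>, written as a difference from the zero
      function.\<close>
    have "balanced (class_of i) (\<lambda>j k. r j k * exp (h k - h j)) (\<lambda>x. 0 - (- 1 / W i) * w x)"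
      by (rule balanced_scale_sub[OF h[OF i]]) (simp add: balanced_def)
    then show "balanced (class_of i) (\<lambda>j k. r j k * exp (h k - h j)) (\<lambda>j. w j / W i)" by simp
  qed
  have avg: "(\<Sum>i\<in>J. w i * (\<Sum>j\<in>class_of i. w j / W i * f j)) = (\<Sum>j\<in>J. w j * f j)" for f
  proof -
    have "(\<Sum>i\<in>J. w i * (\<Sum>j\<in>class_of i. w j / W i * f j))
        = (\<Sum>i\<in>J. \<Sum>j\<in>J. if communicates J r i j then w i * (w j / W i * f j) else 0)"
      using lim.finite_S
      by (simp add: sum.inter_filter sum_distrib_left if_distrib[of "(*) b" for b] cong: if_cong)
    also have "\<dots> = (\<Sum>j\<in>J. \<Sum>i\<in>J. if communicates J r i j then w i * (w j / W i * f j) else 0)"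
      by (rule sum.swap)
    also have "\<dots> = (\<Sum>j\<in>J. w j * f j)"
    proof (intro sum.cong refl)
      fix j assume j: "j \<in> J"
      have "(\<Sum>i\<in>J. if communicates J r i j then w i * (w j / W i * f j) else 0)
          = (\<Sum>i\<in>class_of j. w i * (w j / W j * f j))"
      proof -
        have WW: "W i = W j" if "communicates J r i j" for i
        proof -
          have "communicates J r i k \<longleftrightarrow> communicates J r j k" for k
            using communicates_trans[OF that, of k] communicates_trans[OF communicates_sym[OF that], of k] by blast
          then show ?thesis by (simp only: W_def)
        qed
        have "(if communicates J r i j then w i * (w j / W i * f j) else 0)
            = (if communicates J r j i then w i * (w j / W j * f j) else 0)" for i
          using communicates_sym[of J r i j] communicates_sym[of J r j i] WW[of i] by (cases "communicates J r i j") auto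
        then show ?thesis using lim.finite_S by (simp add: sum.inter_filter cong: if_cong)
      qed
      also have "\<dots> = W j * (w j / W j * f j)" unfolding W_def by (rule sum_distrib_right [symmetric])
      also have "\<dots> = w j * f j" using W[OF j] by simp
      finally show "(\<Sum>i\<in>J. if communicates J r i j then w i * (w j / W i * f j) else 0) = w j * f j" .
    qed
    finally show ?thesis .
  qed
  have "recoverable R \<theta> (\<lambda>x. \<Sum>i\<in>J. w i * (\<Sum>j\<in>class_of i. w j / W i * pmf (\<nu> j) x))
      (\<Sum>i\<in>J. w i * (\<Sum>j\<in>class_of i. w j / W i * cost h j))"
    using w by (intro recoverable_convex[OF lim.finite_S _ _ rec]) (auto intro: less_imp_le)
  then have "recoverable R \<theta> (\<lambda>x. \<Sum>j\<in>J. w j * pmf (\<nu> j) x) (\<Sum>j\<in>J. w j * cost h j)"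
    by (simp only: avg)
  then show ?thesis by (rule recoverable_mono) (use c[of h] in \<open>simp add: ld_comm_eq_cost\<close>)
qed

text \<open>Mixing with the uniform law makes the weights positive; it raises the cost by at most
  \<open>\<delta> * B\<close> and moves each mass by at most \<open>\<delta>\<close>.\<close>

lemma recoverable_mixture:
  assumes mix: "is_mixture J \<omega> \<nu> \<mu>" and c: "ld_functional J r \<omega> \<le> ereal c"
  shows "recoverable R \<theta> (pmf \<mu>) c"
proof (rule recoverable_limit)
  fix \<epsilon> :: real assume \<epsilon>: "0 < \<epsilon>"
  define N where "N = real (card J)"
  define B where "B = (\<Sum>i\<in>J. \<Sum>j\<in>J. \<bar>r i j\<bar>)"
  \<comment> \<open>The choice gives \<open>\<delta> * (B + 1) \<le> \<epsilon> / 2\<close>, which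
    covers both errors.\<close>
  define \<delta> where "\<delta> = min (1 / 2) (\<epsilon> / (2 * (B + 1)))"
  have ne: "J \<noteq> {}" using mix set_pmf_not_empty[of \<omega>] by (auto simp: is_mixture_def)
  have N: "0 < N" "1 \<le> N" using ne lim.finite_S by (auto simp: N_def card_gt_0_iff Suc_le_eq)
  have B: "0 \<le> B" unfolding B_def by (intro sum_nonneg) auto
  have \<delta>: "0 < \<delta>" "\<delta> < 1" "\<delta> * (B + 1) < \<epsilon>"
  proof -
    show "0 < \<delta>" "\<delta> < 1" using \<epsilon> B by (auto simp: \<delta>_def)
    have "\<delta> \<le> \<epsilon> / (2 * (B + 1))" by (simp add: \<delta>_def)
    then have "\<delta> * (B + 1) \<le> \<epsilon> / 2" using B by (simp add: field_simps)
    then show "\<delta> * (B + 1) < \<epsilon>" using \<epsilon> by linarith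
  qed
  define w where "w j = (1 - \<delta>) * pmf \<omega> j + \<delta> * (1 / N)" for j
  let ?m' = "\<lambda>x. \<Sum>j\<in>J. w j * pmf (\<nu> j) x"
  let ?U = "\<lambda>x. \<Sum>j\<in>J. (1 / N) * pmf (\<nu> j) x"
  have sum\<omega>: "sum (pmf \<omega>) J = 1" using mix lim.finite_S by (intro sum_pmf_eq_1) (auto simp: is_mixture_def)
  have dvw: "ld_at J r w h = (1 - \<delta>) * ld_at J r (pmf \<omega>) h + \<delta> * ld_at J r (\<lambda>_. 1 / N) h" for h
    unfolding ld_at_def w_def by (simp add: distrib_right sum.distrib sum_distrib_left mult.assoc)
  have c0: "ld_at J r (pmf \<omega>) h \<le> c" for h using c by (simp add: ld_functional_le_iff)
  have cpos: "0 \<le> c" using c0[of "\<lambda>_. 0"] by (simp add: ld_at_def)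
  have "ld_at J r w h \<le> c + \<delta> * B" for h
  proof -
    have "ld_at J r (\<lambda>_. 1 / N) h \<le> (\<Sum>x\<in>J. (1 / N) * (\<Sum>y\<in>J. \<bar>r x y\<bar>))"
      using N lim.R_nonneg by (intro ld_at_le_rates) auto
    also have "\<dots> \<le> (\<Sum>x\<in>J. 1 * (\<Sum>y\<in>J. \<bar>r x y\<bar>))"
      using N by (intro sum_mono mult_right_mono sum_nonneg) auto
    finally have "ld_at J r (\<lambda>_. 1 / N) h \<le> B" by (simp add: B_def)
    then have "\<delta> * ld_at J r (\<lambda>_. 1 / N) h \<le> \<delta> * B" using \<delta> by simp
    moreover have "(1 - \<delta>) * ld_at J r (pmf \<omega>) h \<le> (1 - \<delta>) * c" using \<delta> c0 by simp
    moreover have "(1 - \<delta>) * c \<le> 1 * c" using \<delta> cpos by (intro mult_right_mono) auto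
    ultimately show ?thesis unfolding dvw by linarith
  qed
  moreover have w: "0 < w j" for j
    unfolding w_def using \<delta> N by (intro add_nonneg_pos) auto
  moreover have sumw: "sum w J = 1"
    unfolding w_def sum.distrib sum_distrib_left [symmetric] using sum\<omega> N by (simp add: N_def)
  ultimately have "recoverable R \<theta> ?m' (c + \<delta> * B)"
  proof (intro recoverable_positive)
    fix h
    \<comment> \<open>The comparison of \<open>ld_comm\<close> with the functional is about a
      \<open>pmf\<close>, so the weights are packaged as one.\<close>
    obtain W where "set_pmf W \<subseteq> J" "\<And>x. pmf W x = (if x \<in> J then w x else 0)"
      using exists_pmf[OF lim.finite_S, of w] w sumw less_imp_le by metis
    then have W: "ld_at J r (pmf W) f = ld_at J r w f" "ld_comm J r (pmf W) f = ld_comm J r w f" for f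
      by (auto simp: ld_at_def ld_comm_def)
    assume "\<And>h. ld_at J r w h \<le> c + \<delta> * B"
    then have "ld_functional J r W \<le> ereal (c + \<delta> * B)" by (simp add: ld_functional_le_iff W)
    from order_trans[OF ld_comm_le_ld_functional[OF lim.finite_S lim.R_nonneg] this]
    show "ld_comm J r w h \<le> c + \<delta> * B" by (simp add: W [symmetric])
  qed auto
  moreover have "\<bar>?m' x - pmf \<mu> x\<bar> < \<epsilon>" for x
  proof -
    have "pmf \<mu> x = (\<Sum>j\<in>J. pmf \<omega> j * pmf (\<nu> j) x)" using mix by (simp add: is_mixture_def)
    then have "?m' x - pmf \<mu> x = \<delta> * (?U x - pmf \<mu> x)"
      by (simp add: w_def algebra_simps sum.distrib sum_subtractf sum_distrib_left)
    moreover have "0 \<le> ?U x" using N by (intro sum_nonneg) auto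
    moreover have "?U x \<le> (\<Sum>j\<in>J. (1 / N) * 1)"
      using N by (intro sum_mono mult_left_mono) (auto simp: pmf_le_1)
    then have "?U x \<le> 1" using N by (simp add: N_def)
    then have "\<bar>?U x - pmf \<mu> x\<bar> \<le> 1" using \<open>0 \<le> ?U x\<close> pmf_le_1[of \<mu> x] pmf_nonneg[of \<mu> x] by linarith
    ultimately have "\<bar>?m' x - pmf \<mu> x\<bar> \<le> \<delta>" using \<delta> by (simp add: abs_mult mult_left_le)
    moreover have "\<delta> * 1 \<le> \<delta> * (B + 1)" using \<delta> B by (intro mult_left_mono) auto
    ultimately show ?thesis using \<delta> by linarith
  qed
  moreover have "c + \<delta> * B \<le> c + \<epsilon>" using \<delta> by (simp add: algebra_simps)
  ultimately show "\<exists>m' c'. recoverable R \<theta> m' c' \<and> (\<forall>x. \<bar>m' x - pmf \<mu> x\<bar> < \<epsilon>) \<and> c' \<le> c + \<epsilon>"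
    by blast
qed

section \<open>The two inequalities of the convergence\<close>

lemma gamma_liminf:
  assumes s: "\<And>x. (\<lambda>n. pmf (s n) x) \<longlonglongrightarrow> pmf \<mu> x"
  shows "level_functional J r \<nu> \<mu> \<le> liminf (\<lambda>n. ereal (\<theta> n) * ld_functional UNIV (R n) (s n))"
proof -
  have lb: "ereal c \<le> liminf (\<lambda>n. ereal (\<theta> n) * ld_functional UNIV (R n) (s n))" if "lower_bound R \<theta> c \<mu>" for c
    unfolding le_Liminf_iff
  proof (intro allI impI)
    fix y assume y: "y < ereal c"
    obtain c' where c': "y < ereal c'" "c' < c" using ereal_dense2[OF y] by auto
    have "\<forall>\<^sub>F n in sequentially. \<exists>h. c' < \<theta> n * ld_at UNIV (R n) (pmf (s n)) h"
      using that[unfolded lower_bound_def, rule_format, of "\<lambda>n. n" s c'] s c' by (simp add: filterlim_ident)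
    with eventually_ge_at_top[of 1]
    show "\<forall>\<^sub>F n in sequentially. y < ereal (\<theta> n) * ld_functional UNIV (R n) (s n)"
    proof eventually_elim
      case (elim n)
      then obtain h where "c' < \<theta> n * ld_at UNIV (R n) (pmf (s n)) h" by blast
      then have "ereal c' < ereal (\<theta> n) * ereal (ld_at UNIV (R n) (pmf (s n)) h)" by simp
      also have "\<dots> \<le> ereal (\<theta> n) * ld_functional UNIV (R n) (s n)"
        using \<theta>_pos[OF elim(1)] by (intro ereal_mult_left_mono ld_at_le_ld_functional) auto
      finally show ?case using c' by (meson order_less_trans)
    qed
  qed
  show ?thesis
  proof (cases "\<exists>\<omega>. is_mixture J \<omega> \<nu> \<mu>")
    case True
    then obtain \<omega> where mix: "is_mixture J \<omega> \<nu> \<mu>" by blast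
    show ?thesis
      unfolding level_functional_mixture[OF mix] ld_functional_eq_SUP[of J r \<omega>]
      using lb lower_bound_mixture[OF mix] by (intro SUP_least) auto
  next
    case False
    then have "ereal c \<le> liminf (\<lambda>n. ereal (\<theta> n) * ld_functional UNIV (R n) (s n))" for c
      using lb lower_bound_non_mixture by blast
    then have "liminf (\<lambda>n. ereal (\<theta> n) * ld_functional UNIV (R n) (s n)) = \<infinity>"
      by (intro ereal_top) simp
    then show ?thesis by simp
  qed
qed

lemma gamma_limsup:
  "\<exists>s. (\<forall>x. (\<lambda>n. pmf (s n) x) \<longlonglongrightarrow> pmf \<mu> x) \<and>
    limsup (\<lambda>n. ereal (\<theta> n) * ld_functional UNIV (R n) (s n)) \<le> level_functional J r \<nu> \<mu>"
proof (cases "\<exists>\<omega>. is_mixture J \<omega> \<nu> \<mu>")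
  case False
  then show ?thesis by (intro exI[of _ "\<lambda>_. \<mu>"]) (simp add: level_functional_def)
next
  case True
  then obtain \<omega> where mix: "is_mixture J \<omega> \<nu> \<mu>" by blast
  \<comment> \<open>At mixtures the functional is finite, being bounded by the total rates;
    elsewhere the target is infinite.\<close>
  have "ld_functional J r \<omega> \<le> ereal (\<Sum>x\<in>J. pmf \<omega> x * (\<Sum>y\<in>J. \<bar>r x y\<bar>))"
    unfolding ld_functional_le_iff using lim.R_nonneg by (auto intro!: ld_at_le_rates)
  then obtain c where c: "ld_functional J r \<omega> = ereal c"
    using ld_functional_nonneg[of J r \<omega>] by (cases "ld_functional J r \<omega>") auto
  obtain s where s: "\<And>x. (\<lambda>n. pmf (s n) x) \<longlonglongrightarrow> pmf \<mu> x"
    "\<And>\<epsilon>. 0 < \<epsilon> \<Longrightarrow> \<forall>\<^sub>F n in sequentially. \<forall>h. \<theta> n * ld_at UNIV (R n) (pmf (s n)) h \<le> c + \<epsilon>"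
    using recoverable_sequence[OF recoverable_mixture[OF mix, of c]] c by auto
  have "limsup (\<lambda>n. ereal (\<theta> n) * ld_functional UNIV (R n) (s n)) \<le> ereal c"
  proof (rule ereal_le_epsilon2)
    fix \<epsilon> :: real assume \<epsilon>: "0 < \<epsilon>"
    show "limsup (\<lambda>n. ereal (\<theta> n) * ld_functional UNIV (R n) (s n)) \<le> ereal c + ereal \<epsilon>"
    proof (rule Limsup_bounded)
      show "\<forall>\<^sub>F n in sequentially. ereal (\<theta> n) * ld_functional UNIV (R n) (s n) \<le> ereal c + ereal \<epsilon>"
        using s(2)[OF \<epsilon>] eventually_ge_at_top[of 1]
      proof eventually_elim
        case (elim n)
        then have "ld_functional UNIV (R n) (s n) \<le> ereal ((c + \<epsilon>) / \<theta> n)"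
          using \<theta>_pos[of n] by (simp add: ld_functional_le_iff pos_le_divide_eq mult.commute)
        then have "ereal (\<theta> n) * ld_functional UNIV (R n) (s n) \<le> ereal (\<theta> n) * ereal ((c + \<epsilon>) / \<theta> n)"
          using \<theta>_pos[OF elim(2)] by (intro ereal_mult_left_mono) auto
        then show ?case using \<theta>_pos[OF elim(2)] by simp
      qed
    qed
  qed
  then show ?thesis using s(1) by (intro exI[of _ s]) (simp add: level_functional_mixture[OF mix] c)
qed

theorem gamma_converges_level:
  "gamma_converges weak_topology (\<lambda>n \<mu>. ereal (\<theta> n) * ld_functional UNIV (R n) \<mu>) (level_functional J r \<nu>)"
  unfolding gamma_converges_def limitin_weak_topology_iff topspace_weak_topology
  using gamma_liminf gamma_limsup by auto

end

section \<open>Induction over the levels\<close>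

text \<open>Outside all the sets the projection is an empty sum; since 0 is not an index, this value
  cannot be mistaken for a well.\<close>

lemma projection_eq_iff:
  assumes "finite J" "0 \<notin> J" and disj: "\<And>k l. k \<in> J \<Longrightarrow> l \<in> J \<Longrightarrow> x \<in> W k \<Longrightarrow> x \<in> W l \<Longrightarrow> k = l"
    and "j \<in> J"
  shows "projection J W x = j \<longleftrightarrow> x \<in> W j"
proof -
  have eq: "projection J W x = l" if "l \<in> J" "x \<in> W l" for l
  proof -
    have "projection J W x = (\<Sum>k\<in>J. if k = l then l else 0)"
      unfolding projection_def using disj that by (intro sum.cong refl) (auto simp: indicator_def)
    then show ?thesis using \<open>finite J\<close> that by simp
  qed
  show ?thesis
  proof
    assume p: "projection J W x = j"
    show "x \<in> W j"
    proof (rule ccontr)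
      assume "x \<notin> W j"
      show False
      proof (cases "\<exists>l\<in>J. x \<in> W l")
        case True
        then show False using eq p \<open>x \<notin> W j\<close> by metis
      next
        case False
        then have "projection J W x = 0" unfolding projection_def by (intro sum.neutral) auto
        then show False using p assms by simp
      qed
    qed
  qed (use eq assms in blast)
qed

lemma mean_jump_rate_nonneg:
  fixes R :: "'v::finite \<Rightarrow> 'v \<Rightarrow> real"
  assumes "finite_chain UNIV R"
  shows "0 \<le> mean_jump_rate UNIV R \<mu> J W i j"
  unfolding mean_jump_rate_def trace_rate_def
  by (intro mult_nonneg_nonneg sum_nonneg finite_chain.hr_nonneg[OF assms]) auto

lemma is_mixture_compose:
  assumes "finite J'" and \<omega>': "is_mixture J' \<omega>' M \<omega>" and \<omega>: "is_mixture J \<omega> \<nu> \<mu>" and "finite J"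
    and M: "\<And>k. k \<in> J' \<Longrightarrow> set_pmf (M k) = C k \<and> C k \<subseteq> J"
    and \<nu>': "\<And>k. k \<in> J' \<Longrightarrow> is_mixture (C k) (M k) \<nu> (\<nu>' k)"
  shows "is_mixture J' \<omega>' \<nu>' \<mu>"
  unfolding is_mixture_def
proof (intro conjI allI)
  show "set_pmf \<omega>' \<subseteq> J'" using \<omega>' by (simp add: is_mixture_def)
  fix x
  have \<nu>'x: "pmf (\<nu>' k) x = (\<Sum>j\<in>J. pmf (M k) j * pmf (\<nu> j) x)" if k: "k \<in> J'" for k
  proof -
    have "pmf (\<nu>' k) x = (\<Sum>j\<in>C k. pmf (M k) j * pmf (\<nu> j) x)"
      using \<nu>'[OF k] by (simp add: is_mixture_def)
    also have "\<dots> = (\<Sum>j\<in>J. pmf (M k) j * pmf (\<nu> j) x)"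
      using M[OF k] \<open>finite J\<close> by (intro sum.mono_neutral_left) (auto simp: set_pmf_iff)
    finally show ?thesis .
  qed
  have "pmf \<mu> x = (\<Sum>j\<in>J. pmf \<omega> j * pmf (\<nu> j) x)" using \<omega> by (simp add: is_mixture_def)
  also have "\<dots> = (\<Sum>j\<in>J. (\<Sum>k\<in>J'. pmf \<omega>' k * pmf (M k) j) * pmf (\<nu> j) x)"
    using \<omega>' by (simp add: is_mixture_def)
  also have "\<dots> = (\<Sum>k\<in>J'. pmf \<omega>' k * (\<Sum>j\<in>J. pmf (M k) j * pmf (\<nu> j) x))"
    by (simp add: sum_distrib_left sum_distrib_right mult.assoc) (rule sum.swap)
  finally show "pmf \<mu> x = (\<Sum>k\<in>J'. pmf \<omega>' k * pmf (\<nu>' k) x)" by (simp add: \<nu>'x)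
qed

text \<open>Either \<open>\<mu>\<close> is no mixture at this level, or its weights are not
  stationary. Both give a strictly positive bound on the scale \<open>\<theta>\<close>, hence any
  bound on the scale \<open>\<theta>'\<close>.\<close>

lemma (in metastable_level) lower_bound_next:
  assumes prec: "prec \<theta> \<theta>'" and pos: "\<And>n. n \<ge> 1 \<Longrightarrow> 0 < \<theta>' n"
    and unst: "\<And>\<omega>. is_mixture J \<omega> \<nu> \<mu> \<Longrightarrow> \<not> stationary_state J r \<omega>"
  shows "lower_bound R \<theta>' c \<mu>"
proof (cases "\<exists>\<omega>. is_mixture J \<omega> \<nu> \<mu>")
  case True
  then obtain \<omega> where mix: "is_mixture J \<omega> \<nu> \<mu>" by blast
  then have "\<not> ld_functional J r \<omega> \<le> ereal 0"
    using stationary_if_ld_functional_le_0[OF lim.finite_S, of \<omega> r] unst[OF mix]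
    by (auto simp: is_mixture_def zero_ereal_def)
  then obtain h where "0 < ld_at J r (pmf \<omega>) h" by (auto simp: ld_functional_le_iff not_le)
  with lower_bound_mixture[OF mix, of h] show ?thesis
    by (rule lower_bound_rescale[OF _ _ prec \<theta>_pos pos])
next
  case False
  then show ?thesis
    by (intro lower_bound_rescale[OF lower_bound_non_mixture _ prec \<theta>_pos pos, where c = 1]) auto
qed

text \<open>The level below the first: on the scale 1 the chain with rates \<open>R0\<close> is the
  limit, and for fixed \<open>h\<close> the expression \<open>ld_at\<close> converges.\<close>

lemma lower_bound_rates:
  fixes R :: "nat \<Rightarrow> 'v::finite \<Rightarrow> 'v \<Rightarrow> real"
  assumes "\<And>x y. x \<noteq> y \<Longrightarrow> (\<lambda>n. R n x y) \<longlonglongrightarrow> R0 x y"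
  shows "lower_bound R (\<lambda>_. 1) (ld_at UNIV R0 (pmf \<mu>) h) \<mu>"
  unfolding lower_bound_def
proof (intro allI impI)
  fix t :: "nat \<Rightarrow> nat" and s c
  assume t: "filterlim t at_top sequentially" and s: "\<forall>x. (\<lambda>k. pmf (s k) x) \<longlonglongrightarrow> pmf \<mu> x"
    and c: "c < ld_at UNIV R0 (pmf \<mu>) h"
  have "(\<lambda>k. R (t k) x y * (1 - exp (h y - h x))) \<longlonglongrightarrow> R0 x y * (1 - exp (h y - h x))" for x y
  proof (cases "x = y")
    case False
    then show ?thesis using filterlim_compose[OF assms t] by (intro tendsto_mult_right) auto
  qed simp
  then have "(\<lambda>k. ld_at UNIV (R (t k)) (pmf (s k)) h) \<longlonglongrightarrow> ld_at UNIV R0 (pmf \<mu>) h"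
    unfolding ld_at_def using s by (intro tendsto_sum tendsto_mult[of "\<lambda>k. pmf (s k) _"]) auto
  then have "\<forall>\<^sub>F k in sequentially. c < ld_at UNIV (R (t k)) (pmf (s k)) h"
    using c by (rule order_tendstoD(1))
  then show "\<forall>\<^sub>F k in sequentially. \<exists>h. c < 1 * ld_at UNIV (R (t k)) (pmf (s k)) h"
    by (rule eventually_mono) auto
qed

theorem theorem2p3:
  fixes R :: "nat \<Rightarrow> 'v::finite \<Rightarrow> 'v \<Rightarrow> real"
    and \<pi>n :: "nat \<Rightarrow> 'v pmf"
    and R0 :: "'v \<Rightarrow> 'v \<Rightarrow> real"
    and E :: "('v \<times> 'v) set"
    and N :: "nat \<Rightarrow> nat"
    and V :: "nat \<Rightarrow> nat \<Rightarrow> 'v set"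
    and \<pi> :: "nat \<Rightarrow> nat \<Rightarrow> 'v pmf"
    and \<theta> :: "nat \<Rightarrow> nat \<Rightarrow> real"
    and r :: "nat \<Rightarrow> nat \<Rightarrow> nat \<Rightarrow> real"
    and C :: "nat \<Rightarrow> nat \<Rightarrow> nat set"
    and M :: "nat \<Rightarrow> nat \<Rightarrow> nat pmf"
    and q :: nat
  assumes rates_nonneg: "\<And>n x y. n \<ge> 1 \<Longrightarrow> x \<noteq> y \<Longrightarrow> R n x y \<ge> 0"
    and irreducible: "\<And>n. n \<ge> 1 \<Longrightarrow> irreducible_chain UNIV (R n)"
    and stationary: "\<And>n. n \<ge> 1 \<Longrightarrow> stationary_state UNIV (R n) (\<pi>n n)"
    and A1_lim: "\<And>x y. x \<noteq> y \<Longrightarrow> (\<lambda>n. R n x y) \<longlonglongrightarrow> R0 x y"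
    and A1_nontrivial: "\<exists>x y. x \<noteq> y \<and> R0 x y > 0"
    and A2: "card {W. closed_irreducible_class UNIV R0 W} > 1"
    and A3_offdiag: "E \<subseteq> {(x, y). x \<noteq> y}"
    and A3: "\<And>n x y. n \<ge> 1 \<Longrightarrow> x \<noteq> y \<Longrightarrow> R n x y > 0 \<longleftrightarrow> (x, y) \<in> E"
    and A4: "\<And>m k l. m \<ge> 1 \<Longrightarrow> sum k E = m \<Longrightarrow> sum l E = (m::nat) \<Longrightarrow>
               comparable (\<lambda>n. \<Prod>(x, y)\<in>E. R n x y ^ k (x, y))
                          (\<lambda>n. \<Prod>(x, y)\<in>E. R n x y ^ l (x, y))"
    \<comment> \<open>first level; \<open>{1..N p}\<close> is the index set at level \<open>p\<close>\<close>
    and V1: "bij_betw (V 1) {1..N 1} {W. closed_irreducible_class UNIV R0 W}"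
    and \<pi>1: "\<And>j. j \<in> {1..N 1} \<Longrightarrow>
               stationary_state UNIV R0 (\<pi> 1 j) \<and> set_pmf (\<pi> 1 j) = V 1 j"
    \<comment> \<open>the last level \<open>q\<close> is the first \<open>p\<close> with \<open>N (p + 1) = 1\<close>\<close>
    and q: "q \<ge> 1" "N (Suc q) = 1" "\<And>p. 1 \<le> p \<Longrightarrow> p < q \<Longrightarrow> N (Suc p) \<noteq> 1"
    \<comment> \<open>time scales and limiting rates\<close>
    and \<theta>0: "\<And>n. \<theta> 0 n = 1"
    and \<theta>_pos: "\<And>p n. p \<in> {1..q} \<Longrightarrow> n \<ge> 1 \<Longrightarrow> \<theta> p n > 0"
    and \<theta>_prec: "\<And>p. p \<in> {1..q} \<Longrightarrow> prec (\<theta> (p - 1)) (\<theta> p)"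
    and r_lim: "\<And>p i j. p \<in> {1..q} \<Longrightarrow> i \<in> {1..N p} \<Longrightarrow> j \<in> {1..N p} \<Longrightarrow> i \<noteq> j \<Longrightarrow>
               (\<lambda>n. \<theta> p n * mean_jump_rate UNIV (R n) (\<pi>n n) {1..N p} (V p) i j)
                 \<longlonglongrightarrow> r p i j"
    and r_nontrivial: "\<And>p. p \<in> {1..q} \<Longrightarrow>
               \<exists>i\<in>{1..N p}. \<exists>j\<in>{1..N p}. i \<noteq> j \<and> r p i j \<noteq> 0"
    and \<pi>_lim: "\<And>p j z. p \<in> {1..q} \<Longrightarrow> j \<in> {1..N p} \<Longrightarrow> z \<in> V p j \<Longrightarrow>
               (\<lambda>n. pmf (\<pi>n n) z / measure_pmf.prob (\<pi>n n) (V p j)) \<longlonglongrightarrow> pmf (\<pi> p j) z"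
    \<comment> \<open>convergence of the finite-dimensional distributions of the projected process\<close>
    and fdd_lim: "\<And>p j x k (t :: nat \<Rightarrow> real) a.
               p \<in> {1..q} \<Longrightarrow> j \<in> {1..N p} \<Longrightarrow> x \<in> V p j \<Longrightarrow> (\<And>i. i < k \<Longrightarrow> t i \<ge> 0) \<Longrightarrow>
               (\<lambda>n. \<P>(\<omega> in chain_noise UNIV (R n).
                  \<forall>i<k. projection {1..N p} (V p) (chain_path UNIV (R n) x \<omega> (t i * \<theta> p n)) = a i))
                 \<longlonglongrightarrow> \<P>(\<omega> in chain_noise {1..N p} (r p).
                        \<forall>i<k. chain_path {1..N p} (r p) j \<omega> (t i) = a i)"
    \<comment> \<open>from level \<open>p\<close> to level \<open>p + 1\<close>\<close>
    and C_classes: "\<And>p. p \<in> {1..q} \<Longrightarrow>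
               bij_betw (C p) {1..N (Suc p)} {D. closed_irreducible_class {1..N p} (r p) D}"
    and M_stationary: "\<And>p m. p \<in> {1..q} \<Longrightarrow> m \<in> {1..N (Suc p)} \<Longrightarrow>
               stationary_state {1..N p} (r p) (M p m) \<and> set_pmf (M p m) = C p m"
    and V_Suc: "\<And>p m. p \<in> {1..q} \<Longrightarrow> m \<in> {1..N (Suc p)} \<Longrightarrow> V (Suc p) m = (\<Union>j\<in>C p m. V p j)"
    and \<pi>_Suc: "\<And>p m. p \<in> {1..q} \<Longrightarrow> m \<in> {1..N (Suc p)} \<Longrightarrow>
               is_mixture (C p m) (M p m) (\<pi> p) (\<pi> (Suc p) m)"
  shows "\<forall>p\<in>{1..q}.
           gamma_converges weak_topology
             (\<lambda>n \<mu>. ereal (\<theta> p n) * ld_functional UNIV (R n) \<mu>)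
             (level_functional {1..N p} (r p) (\<pi> p))"
proof
  fix p0 assume p0: "p0 \<in> {1..q}"
  let ?J = "\<lambda>p. {1..N p}"
  note scale_pos = \<theta>_pos
  have ch: "finite_chain UNIV (R n)" if "n \<ge> 1" for n
    using rates_nonneg[OF that] by unfold_locales auto
  have R0: "0 \<le> R0 x y" if "x \<noteq> y" for x y
    by (rule LIMSEQ_le_const[OF A1_lim[OF that]]) (use rates_nonneg that in blast)
  have r_nonneg: "0 \<le> r p i j" if p: "p \<in> {1..q}" and ij: "i \<in> ?J p" "j \<in> ?J p" "i \<noteq> j" for p i j
  proof (rule LIMSEQ_le_const[OF r_lim[OF p ij]], intro exI[of _ 1] allI impI)
    fix n :: nat assume "1 \<le> n"
    then show "0 \<le> \<theta> p n * mean_jump_rate UNIV (R n) (\<pi>n n) (?J p) (V p) i j"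
      using \<theta>_pos[OF p] mean_jump_rate_nonneg[OF ch] by (simp add: less_imp_le)
  qed
  have Ccl: "closed_irreducible_class (?J p) (r p) (C p m)" if "p \<in> {1..q}" "m \<in> ?J (Suc p)" for p m
    using bij_betw_apply[OF C_classes[OF that(1)] that(2)] by simp
  then have CJ: "C p m \<subseteq> ?J p" if "p \<in> {1..q}" "m \<in> ?J (Suc p)" for p m
    using that unfolding closed_irreducible_class_def by blast
  have wells: "(\<forall>j\<in>?J p. set_pmf (\<pi> p j) = V p j) \<and>
      (\<forall>j\<in>?J p. \<forall>k\<in>?J p. V p j \<inter> V p k \<noteq> {} \<longrightarrow> j = k)" if "p \<in> {1..q}" for p
    using that
  proof (induction p)
    case (Suc p)
    show ?case
    proof (cases "p = 0")
      case True
      have "j = k" if jk: "j \<in> ?J 1" "k \<in> ?J 1" "V 1 j \<inter> V 1 k \<noteq> {}" for j k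
      proof -
        obtain x where "x \<in> V 1 j" "x \<in> V 1 k" using jk by blast
        moreover have "closed_irreducible_class UNIV R0 (V 1 j)" "closed_irreducible_class UNIV R0 (V 1 k)"
          using bij_betw_apply[OF V1] jk by auto
        ultimately have "V 1 j = V 1 k" using closed_irreducible_disjoint by metis
        then show ?thesis using V1 jk by (metis bij_betw_imp_inj_on inj_onD)
      qed
      then show ?thesis using True \<pi>1 by simp
    next
      case False
      then have p: "p \<in> {1..q}" using Suc.prems by simp
      have V: "\<And>j. j \<in> ?J p \<Longrightarrow> set_pmf (\<pi> p j) = V p j"
        and disj: "\<And>j k x. j \<in> ?J p \<Longrightarrow> k \<in> ?J p \<Longrightarrow> x \<in> V p j \<Longrightarrow> x \<in> V p k \<Longrightarrow> j = k"
        using Suc.IH[OF p] by blast+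
      have "set_pmf (\<pi> (Suc p) m) = V (Suc p) m" if m: "m \<in> ?J (Suc p)" for m
      proof -
        have fin: "finite (C p m)" by (rule finite_subset[OF CJ[OF p m]]) simp
        have M: "\<And>j. j \<in> C p m \<Longrightarrow> 0 < pmf (M p m) j"
          using M_stationary[OF p m] by (simp add: pmf_positive)
        have pos: "0 \<le> pmf (M p m) j * pmf (\<pi> p j) x" for j x by simp
        \<comment> \<open>The weights are positive on \<open>C p m\<close>, so the support of the
          mixture is the union of the supports.\<close>
        have "x \<in> set_pmf (\<pi> (Suc p) m) \<longleftrightarrow> (\<exists>j\<in>C p m. x \<in> set_pmf (\<pi> p j))" for x
        proof -
          have "pmf (\<pi> (Suc p) m) x = (\<Sum>j\<in>C p m. pmf (M p m) j * pmf (\<pi> p j) x)"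
            using \<pi>_Suc[OF p m] by (simp add: is_mixture_def)
          then have "pmf (\<pi> (Suc p) m) x = 0 \<longleftrightarrow> (\<forall>j\<in>C p m. pmf (M p m) j * pmf (\<pi> p j) x = 0)"
            using fin pos by (simp add: sum_nonneg_eq_0_iff)
          then show ?thesis using M by (force simp: set_pmf_iff)
        qed
        moreover have "set_pmf (\<pi> p j) = V p j" if "j \<in> C p m" for j using V that CJ[OF p m] by blast
        ultimately show ?thesis unfolding V_Suc[OF p m] by blast
      qed
      moreover have "m = m'" if m: "m \<in> ?J (Suc p)" "m' \<in> ?J (Suc p)" "V (Suc p) m \<inter> V (Suc p) m' \<noteq> {}" for m m'
      proof -
        obtain x j k where x: "j \<in> C p m" "k \<in> C p m'" "x \<in> V p j" "x \<in> V p k"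
          using m unfolding V_Suc[OF p m(1)] V_Suc[OF p m(2)] by blast
        then have "j = k" using disj CJ[OF p m(1)] CJ[OF p m(2)] by blast
        moreover have "closed_irreducible_class (?J p) (r p) (C p m)" "closed_irreducible_class (?J p) (r p) (C p m')"
          using Ccl[OF p] m by blast+
        ultimately have "C p m = C p m'" using x closed_irreducible_disjoint by metis
        then show ?thesis using C_classes[OF p] m by (metis bij_betw_imp_inj_on inj_onD)
      qed
      ultimately show ?thesis by blast
    qed
  qed simp
  have pr: "projection (?J p) (V p) x = j \<longleftrightarrow> x \<in> V p j" if "p \<in> {1..q}" "j \<in> ?J p" for p j x
  proof (rule projection_eq_iff[OF _ _ _ that(2)])
    show "k = l" if "k \<in> ?J p" "l \<in> ?J p" "x \<in> V p k" "x \<in> V p l" for k l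
      using wells[OF \<open>p \<in> {1..q}\<close>] that by blast
  qed auto
  \<comment> \<open>All assumptions of the locale except the divergence off the mixtures hold at
    each level separately, so the induction has to provide that one only.\<close>
  have level: "metastable_level R (?J p) (r p) (projection (?J p) (V p)) (\<pi> p) (\<theta> p)"
    if p: "p \<in> {1..q}" and nonmix: "\<And>\<mu> c. \<nexists>\<omega>. is_mixture (?J p) \<omega> (\<pi> p) \<mu> \<Longrightarrow> lower_bound R (\<theta> p) c \<mu>" for p
  proof (unfold_locales, goal_cases)
    case (5 n)
    then show ?case using \<theta>_pos[OF p] by simp
  next
    case (6 j)
    have "set_pmf (\<pi> p j) = V p j" using wells[OF p] 6 by blast
    then show ?case using pr[OF p 6] by simp
  next
    case (7 t x i)
    let ?j = "projection (?J p) (V p) x"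
    have "x \<in> V p ?j" using pr[OF p 7(2), of x] by blast
    from fdd_lim[OF p 7(2) this, of "Suc 0" "\<lambda>_. t" "\<lambda>_. i"] 7(1)
    show ?case by simp
  next
    case (8 \<mu> c)
    then show ?case using nonmix by blast
  qed (use rates_nonneg r_nonneg[OF p] in auto)
  have "metastable_level R (?J p) (r p) (projection (?J p) (V p)) (\<pi> p) (\<theta> p)"
    if "p \<in> {1..q}" for p
    using that
  proof (induction p)
    case (Suc p)
    show ?case
    proof (cases "p = 0")
      case True
      have q1: "1 \<in> {1..q}" using q by simp
      \<comment> \<open>At the first level a non-mixture is not stationary for \<open>R0\<close>; it
        has positive cost on the scale 1, and \<open>\<theta> 1\<close> diverges.\<close>
      have "lower_bound R (\<theta> 1) c \<mu>" if nm: "\<nexists>\<omega>. is_mixture (?J 1) \<omega> (\<pi> 1) \<mu>" for \<mu> c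
      proof -
        have "\<not> stationary_state UNIV R0 \<mu>"
          using stationary_is_mixture[OF _ _ V1 _ \<pi>1, of \<mu>] R0 nm by auto
        then have "\<not> ld_functional UNIV R0 \<mu> \<le> ereal 0"
          using stationary_if_ld_functional_le_0[of UNIV \<mu> R0] by (auto simp: zero_ereal_def)
        then obtain h where h: "0 < ld_at UNIV R0 (pmf \<mu>) h" by (auto simp: ld_functional_le_iff not_le)
        have "prec (\<lambda>_. 1) (\<theta> 1)" using \<theta>_prec[OF q1] \<theta>0 by (simp add: prec_def)
        from lower_bound_rescale[OF lower_bound_rates[OF A1_lim] h this] \<theta>_pos[OF q1]
        show ?thesis by simp
      qed
      then show ?thesis using level[OF q1] True by simp
    next
      case False
      then have p: "p \<in> {1..q}" using Suc.prems by simp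
      interpret metastable_level R "?J p" "r p" "projection (?J p) (V p)" "\<pi> p" "\<theta> p"
        using Suc.IH[OF p] .
      show ?thesis
      proof (rule level[OF Suc.prems])
        fix \<mu> c assume nm: "\<nexists>\<omega>. is_mixture (?J (Suc p)) \<omega> (\<pi> (Suc p)) \<mu>"
        \<comment> \<open>Stationary weights are mixtures of the \<open>M p\<close>, and composing
          the two mixtures would exhibit \<open>\<mu>\<close> as a mixture at the next
          level.\<close>
        have "\<not> stationary_state (?J p) (r p) \<omega>" if mix: "is_mixture (?J p) \<omega> (\<pi> p) \<mu>" for \<omega>
        proof
          assume "stationary_state (?J p) (r p) \<omega>"
          then obtain \<omega>' where "is_mixture (?J (Suc p)) \<omega>' (M p) \<omega>"
            using stationary_is_mixture[OF lim.finite_S lim.R_nonneg C_classes[OF p] _ M_stationary[OF p]] by auto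
          from is_mixture_compose[OF _ this mix, where C = "C p" and \<nu>' = "\<pi> (Suc p)"]
          have "is_mixture (?J (Suc p)) \<omega>' (\<pi> (Suc p)) \<mu>"
            using M_stationary[OF p] CJ[OF p] \<pi>_Suc[OF p] by blast
          with nm show False by blast
        qed
        moreover have "prec (\<theta> p) (\<theta> (Suc p))" using \<theta>_prec[OF Suc.prems] by simp
        ultimately show "lower_bound R (\<theta> (Suc p)) c \<mu>"
          using scale_pos[OF Suc.prems] by (intro lower_bound_next) auto
      qed
    qed
  qed simp
  from metastable_level.gamma_converges_level[OF this[OF p0]]
  show "gamma_converges weak_topology (\<lambda>n \<mu>. ereal (\<theta> p0 n) * ld_functional UNIV (R n) \<mu>)
      (level_functional (?J p0) (r p0) (\<pi> p0))" .
qed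

end
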